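(* Assume (A.1), (A.2) and (A.3), which are the following conditions: (A.1) there exists $c>0$ such that $c^{-1}\mathcal E[u]\le\mathcal E^n[u]\le c\,\mathcal E[u]$ for all $u\in\mathcal D$, $n\in\mathbb N\cup\{\infty\}$; (A.2) $J_1\colon(\mathcal D\cap L^2(X,\mu),\mathcal E_1)\to L^2(X,\mu)$, $u\mapsto u$, is continuous; (A.3) $J_1^nK^nu\to J_1^\infty K^\infty u$ in $L^2(X,\mu)$ for all $u\in L^2(X,m)$. Let $(\mathcal E^n)$ be Mosco-convergent to $\mathcal E^\infty$. Then: (a) The sequence of trace forms $(\check{\mathcal E}^n_\lambda)_n$ Mosco-converges to the corresponding trace form $\check{\mathcal E}^\infty_\lambda$ for every $\lambda>0$. (b) For every sequence $(\lambda_j)$ in $(0,\infty)$ such that $\lambda_j\downarrow0$ there exists a sequence $(n_j)$ in $\mathbb N$ with $n_j\to\infty$ such that $(\check{\mathcal E}^{n_j}_{\lambda_j})_j$ Mosco-converges to the trace form $\check{\mathcal E}^\infty$.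
   Context: Let $X$ be a locally compact separable metric space, $m$ a positive Radon measure on $X$ with full support $X$, and $\mathcal E$ a regular Dirichlet form in $L^2(X,m)$ with domain $\mathcal D$. Let $\mu$ be a positive Radon measure on $X$ charging no set of zero capacity. Let $(\mathcal E^n)_{n\in\mathbb N}$ be a sequence of regular Dirichlet forms in $L^2(X,m)$ with $\operatorname{dom}\mathcal E^n=\mathcal D$ for all $n$, and $\mathcal E^\infty$ a Dirichlet form in $L^2(X,m)$ with $\operatorname{dom}\mathcal E^\infty=\mathcal D$. Elements of $\mathcal D$ are taken quasi-continuous (under (A.1) all these forms induce equivalent capacities). For a form $\mathcal F$ on $\mathcal D$ and $\lambda>0$, $\mathcal F_\lambda[u]:=\mathcal F[u]+\lambda\|u\|^2_{L^2(X,m)}$. Let $J\colon\operatorname{dom}J:=\mathcal D\cap L^2(X,\mu)\to L^2(X,\mu)$, $Ju:=u$. For $n\in\mathbb N\cup\{\infty\}$ let $J^n_1\colon(\mathcal D\cap L^2(X,\mu),\mathcal E^n_1)\to L^2(X,\mu)$, $u\mapsto u$; under (A.1), (A.2) the densely defined operators $J_1$ and $J_1^n$ are continuous and are extended to $\mathcal D$. Let $H^n$ be the positive self-adjoint operator in $L^2(X,m)$ associated with $\mathcal E^n$ and $K^n:=(H^n+1)^{-1}$. Traces: for $n\in\mathbb N\cup\{\infty\}$ and $\lambda>0$, $\check{\mathcal E}^n_\lambda$ is the trace of $\mathcal E^n_\lambda$ with respect to $\mu$ (i.e. with respect to $J$): the closed form in $L^2(X,\mu)$ with $\operatorname{dom}\check{\mathcal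 E}^n_\lambda=\operatorname{ran}J$ and $\check{\mathcal E}^n_\lambda[Ju]=\mathcal E^n_\lambda[P^n_\lambda u]$ for $u\in\operatorname{dom}J$, where $P^n_\lambda$ is the $\mathcal E^n_\lambda$-orthogonal projection in $\mathcal D$ onto the $\mathcal E^n_\lambda$-orthogonal complement of $\ker J$; let $\check H^n_\lambda$ be the associated positive self-adjoint operator. The trace form $\check{\mathcal E}^\infty$ is the closed form associated with the positive self-adjoint operator $\check H^\infty$ determined by $(\check H^\infty_\lambda+1)^{-1}\to(\check H^\infty+1)^{-1}$ strongly as $\lambda\downarrow0$; equivalently, it is the closure of the regular part (largest closable minorant with the same domain) of $Ju\mapsto\lim_{\lambda\downarrow0}\check{\mathcal E}^\infty_\lambda[Ju]$ on $\operatorname{ran}J$. Mosco convergence: a sequence $(a_n)$ of positive quadratic forms in a Hilbert space $\mathcal G$ (extended by $+\infty$ outside their domains) Mosco-converges to a quadratic form $a_\infty$ in $\mathcal G$ if (M1) $u_n\to u$ weakly in $\mathcal G$ implies $\liminf_n a_n[u_n]\ge a_\infty[u]$, and (M2) for every $u\in\mathcal G$ there is a sequence $u_n\to u$ in $\mathcal G$ with $\limsup_n a_n[u_n]\le a_\infty[u]$. Mosco convergence of $(\mathcal E^n)$ is understood in $L^2(X,m)$, that of trace forms in $L^2(X,\mu)$. *)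

theory Defs
  imports "HOL-Analysis.Analysis"
begin

text \<open>
  Elements of the real Hilbert space \<open>L\<^sup>2(M)\<close> are represented by Borel functions, two functions
  representing the same element iff they agree almost everywhere.  Sets and maps that live on
  \<open>L\<^sup>2(M)\<close> are therefore required to be invariant under almost everywhere equality.
\<close>

definition L2 :: "'a measure \<Rightarrow> ('a \<Rightarrow> real) set" where
  "L2 M = {f \<in> borel_measurable M. integrable M (\<lambda>x. (f x)\<^sup>2)}"

definition ip :: "'a measure \<Rightarrow> ('a \<Rightarrow> real) \<Rightarrow> ('a \<Rightarrow> real) \<Rightarrow> real" where
  "ip M f g = (\<integral>x. f x * g x \<partial>M)"

definition l2norm :: "'a measure \<Rightarrow> ('a \<Rightarrow> real) \<Rightarrow> real" where
  "l2norm M f = sqrt (ip M f f)"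

definition strong_conv :: "'a measure \<Rightarrow> ('b \<Rightarrow> 'a \<Rightarrow> real) \<Rightarrow> ('a \<Rightarrow> real) \<Rightarrow> 'b filter \<Rightarrow> bool" where
  "strong_conv M u v Fl \<longleftrightarrow> ((\<lambda>i. l2norm M (\<lambda>x. u i x - v x)) \<longlongrightarrow> 0) Fl"

definition weak_conv :: "'a measure \<Rightarrow> (nat \<Rightarrow> 'a \<Rightarrow> real) \<Rightarrow> ('a \<Rightarrow> real) \<Rightarrow> bool" where
  "weak_conv M u v \<longleftrightarrow> (\<forall>g\<in>L2 M. (\<lambda>i. ip M (u i) g) \<longlonglongrightarrow> ip M v g)"


section \<open>Forms\<close>

text \<open>A form is a domain together with a bilinear form; \<open>\<F>[u]\<close> is \<open>bil \<F> u u\<close>.\<close>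

datatype 'a form =
  Form (fdom: "('a \<Rightarrow> real) set") (bil: "('a \<Rightarrow> real) \<Rightarrow> ('a \<Rightarrow> real) \<Rightarrow> real")

definition shift_form :: "'a measure \<Rightarrow> 'a form \<Rightarrow> real \<Rightarrow> 'a form" where
  "shift_form M F l = Form (fdom F) (\<lambda>u v. bil F u v + l * ip M u v)"

definition positive_form :: "'a measure \<Rightarrow> 'a form \<Rightarrow> bool" where
  "positive_form M F \<longleftrightarrow>
     fdom F \<subseteq> L2 M \<and>
     (\<lambda>x. 0) \<in> fdom F \<and>
     (\<forall>u\<in>fdom F. \<forall>v\<in>fdom F. \<forall>a b. (\<lambda>x. a * u x + b * v x) \<in> fdom F) \<and>
     (\<forall>u\<in>fdom F. \<forall>v\<in>borel_measurable M. (AE x in M. v x = u x) \<longrightarrow> v \<in> fdom F) \<and>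
     (\<forall>u\<in>fdom F. \<forall>u'\<in>fdom F. \<forall>v\<in>fdom F. (AE x in M. u x = u' x) \<longrightarrow> bil F u v = bil F u' v) \<and>
     (\<forall>u\<in>fdom F. \<forall>v\<in>fdom F. \<forall>w\<in>fdom F. \<forall>a b.
        bil F (\<lambda>x. a * u x + b * v x) w = a * bil F u w + b * bil F v w) \<and>
     (\<forall>u\<in>fdom F. \<forall>v\<in>fdom F. bil F u v = bil F v u) \<and>
     (\<forall>u\<in>fdom F. bil F u u \<ge> 0)"

definition form_conv :: "'a form \<Rightarrow> (nat \<Rightarrow> 'a \<Rightarrow> real) \<Rightarrow> ('a \<Rightarrow> real) \<Rightarrow> bool" where
  "form_conv F u v \<longleftrightarrow> (\<lambda>i. bil F (\<lambda>x. u i x - v x) (\<lambda>x. u i x - v x)) \<longlonglongrightarrow> 0"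

definition form_Cauchy :: "'a form \<Rightarrow> (nat \<Rightarrow> 'a \<Rightarrow> real) \<Rightarrow> bool" where
  "form_Cauchy F u \<longleftrightarrow>
     (\<forall>e>0. \<exists>N. \<forall>i\<ge>N. \<forall>j\<ge>N. bil F (\<lambda>x. u i x - u j x) (\<lambda>x. u i x - u j x) < e)"

definition densely_defined :: "'a measure \<Rightarrow> 'a form \<Rightarrow> bool" where
  "densely_defined M F \<longleftrightarrow>
     (\<forall>f\<in>L2 M. \<forall>e>0. \<exists>u\<in>fdom F. l2norm M (\<lambda>x. f x - u x) < e)"

definition closed_form :: "'a measure \<Rightarrow> 'a form \<Rightarrow> bool" where
  "closed_form M F \<longleftrightarrow>
     positive_form M F \<and>
     (\<forall>u. range u \<subseteq> fdom F \<and> form_Cauchy (shift_form M F 1) u \<longrightarrow>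
        (\<exists>v\<in>fdom F. form_conv (shift_form M F 1) u v))"

text \<open>Graph of the self-adjoint operator associated with a densely defined closed form.\<close>

definition assoc_op :: "'a measure \<Rightarrow> 'a form \<Rightarrow> (('a \<Rightarrow> real) \<times> ('a \<Rightarrow> real)) set" where
  "assoc_op M F = {(u, f). u \<in> fdom F \<and> f \<in> L2 M \<and> (\<forall>v\<in>fdom F. bil F u v = ip M f v)}"

text \<open>\<open>(H + 1)\<^sup>-\<^sup>1 f\<close>, for the operator \<open>H\<close> associated with \<open>F\<close>.\<close>

definition resolvent1 :: "'a measure \<Rightarrow> 'a form \<Rightarrow> ('a \<Rightarrow> real) \<Rightarrow> ('a \<Rightarrow> real)" where
  "resolvent1 M F f = (SOME u. \<exists>g. (u, g) \<in> assoc_op M F \<and> (AE x in M. g x + u x = f x))"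

definition ext_form :: "'a form \<Rightarrow> ('a \<Rightarrow> real) \<Rightarrow> ereal" where
  "ext_form F u = (if u \<in> fdom F then ereal (bil F u u) else \<infinity>)"

definition Mosco_conv :: "'a measure \<Rightarrow> (nat \<Rightarrow> 'a form) \<Rightarrow> 'a form \<Rightarrow> bool" where
  "Mosco_conv M a b \<longleftrightarrow>
     (\<forall>u v. range u \<subseteq> L2 M \<and> v \<in> L2 M \<and> weak_conv M u v \<longrightarrow>
        liminf (\<lambda>n. ext_form (a n) (u n)) \<ge> ext_form b v) \<and>
     (\<forall>v\<in>L2 M. \<exists>u. range u \<subseteq> L2 M \<and> strong_conv M u v sequentially \<and>
        limsup (\<lambda>n. ext_form (a n) (u n)) \<le> ext_form b v)"


section \<open>Dirichlet forms, capacity, quasi-continuity\<close>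

text \<open>
  On a locally compact separable metric space a Borel measure that is finite on compact sets is
  automatically regular, so that no regularity needs to be demanded of a Radon measure.
\<close>

definition radon_measure :: "'a::topological_space measure \<Rightarrow> bool" where
  "radon_measure M \<longleftrightarrow> sets M = sets borel \<and> (\<forall>K. compact K \<longrightarrow> emeasure M K < \<infinity>)"

definition full_support :: "'a::topological_space measure \<Rightarrow> bool" where
  "full_support M \<longleftrightarrow> (\<forall>U. open U \<and> U \<noteq> {} \<longrightarrow> emeasure M U > 0)"

definition dirichlet_form :: "'a measure \<Rightarrow> 'a form \<Rightarrow> bool" where
  "dirichlet_form M F \<longleftrightarrow>
     closed_form M F \<and> densely_defined M F \<and>
     (\<forall>u\<in>fdom F. (\<lambda>x. min (max (u x) 0) 1) \<in> fdom F \<and>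
        bil F (\<lambda>x. min (max (u x) 0) 1) (\<lambda>x. min (max (u x) 0) 1) \<le> bil F u u)"

definition Cc :: "('a::topological_space \<Rightarrow> real) set" where
  "Cc = {f. continuous_on UNIV f \<and> compact (closure {x. f x \<noteq> 0})}"

definition regular_dirichlet_form :: "'a::topological_space measure \<Rightarrow> 'a form \<Rightarrow> bool" where
  "regular_dirichlet_form M F \<longleftrightarrow>
     dirichlet_form M F \<and>
     (\<forall>u\<in>fdom F. \<forall>e>0. \<exists>f\<in>fdom F \<inter> Cc.
        bil (shift_form M F 1) (\<lambda>x. u x - f x) (\<lambda>x. u x - f x) < e) \<and>
     (\<forall>f\<in>Cc. \<forall>e>0. \<exists>g\<in>fdom F \<inter> Cc. \<forall>x. \<bar>f x - g x\<bar> < e)"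

definition open_capacity :: "'a::topological_space measure \<Rightarrow> 'a form \<Rightarrow> 'a set \<Rightarrow> ennreal" where
  "open_capacity M F U =
     Inf {ennreal (bil (shift_form M F 1) u u) | u. u \<in> fdom F \<and> (AE x in M. x \<in> U \<longrightarrow> u x \<ge> 1)}"

definition capacity :: "'a::topological_space measure \<Rightarrow> 'a form \<Rightarrow> 'a set \<Rightarrow> ennreal" where
  "capacity M F A = Inf {open_capacity M F U | U. open U \<and> A \<subseteq> U}"

definition quasi_continuous ::
  "'a::topological_space measure \<Rightarrow> 'a form \<Rightarrow> ('a \<Rightarrow> real) \<Rightarrow> bool" where
  "quasi_continuous M F u \<longleftrightarrow>
     (\<forall>e>0. \<exists>U. open U \<and> capacity M F U < ennreal e \<and> continuous_on (- U) u)"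

definition charges_no_zero_capacity ::
  "'a::topological_space measure \<Rightarrow> 'a form \<Rightarrow> 'a measure \<Rightarrow> bool" where
  "charges_no_zero_capacity M F N \<longleftrightarrow>
     (\<forall>A\<in>sets borel. capacity M F A = 0 \<longrightarrow> emeasure N A = 0)"


section \<open>The map J and traces\<close>

text \<open>
  The map \<open>J\<close> is the identity on quasi-continuous representatives.  As \<open>fdom E\<close> contains all
  \<open>m\<close>-versions of its elements, the restriction to quasi-continuous ones is part of
  \<open>dom J = \<D> \<inter> L\<^sup>2(\<mu>)\<close>.  Quasi-continuous versions are unique up to sets of capacity zero,
  hence up to \<open>\<mu>\<close>-null sets.
\<close>

definition domJ ::
  "'a::topological_space measure \<Rightarrow> 'a measure \<Rightarrow> 'a form \<Rightarrow> ('a \<Rightarrow> real) set" where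
  "domJ m \<mu> E = {u \<in> fdom E. quasi_continuous m E u \<and> u \<in> L2 \<mu>}"

definition ranJ ::
  "'a::topological_space measure \<Rightarrow> 'a measure \<Rightarrow> 'a form \<Rightarrow> ('a \<Rightarrow> real) set" where
  "ranJ m \<mu> E = {v \<in> L2 \<mu>. \<exists>u\<in>domJ m \<mu> E. AE x in \<mu>. v x = u x}"

definition kerJ ::
  "'a::topological_space measure \<Rightarrow> 'a measure \<Rightarrow> 'a form \<Rightarrow> ('a \<Rightarrow> real) set" where
  "kerJ m \<mu> E = {u \<in> domJ m \<mu> E. AE x in \<mu>. u x = 0}"

text \<open>Continuity of \<open>J\<close> from \<open>dom J\<close>, with the norm of \<open>F\<^sub>1\<close>, to \<open>L\<^sup>2(\<mu>)\<close>.\<close>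

definition J1_continuous ::
  "'a::topological_space measure \<Rightarrow> 'a measure \<Rightarrow> 'a form \<Rightarrow> 'a form \<Rightarrow> bool" where
  "J1_continuous m \<mu> E F \<longleftrightarrow>
     (\<forall>u\<in>domJ m \<mu> E. \<forall>e>0. \<exists>d>0. \<forall>v\<in>domJ m \<mu> E.
        sqrt (bil (shift_form m F 1) (\<lambda>x. v x - u x) (\<lambda>x. v x - u x)) < d \<longrightarrow>
        l2norm \<mu> (\<lambda>x. v x - u x) < e)"

text \<open>The extension by continuity of that map from \<open>dom J\<close> to all of \<open>\<D>\<close>.\<close>

definition J1_ext ::
  "'a::topological_space measure \<Rightarrow> 'a measure \<Rightarrow> 'a form \<Rightarrow> 'a form \<Rightarrow> ('a \<Rightarrow> real) \<Rightarrow> ('a \<Rightarrow> real)"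
  where
  "J1_ext m \<mu> E F u = (SOME v. v \<in> L2 \<mu> \<and>
     (\<forall>w. range w \<subseteq> domJ m \<mu> E \<and> form_conv (shift_form m F 1) w u \<longrightarrow>
        strong_conv \<mu> w v sequentially))"

definition orth_compl :: "'a form \<Rightarrow> ('a \<Rightarrow> real) set \<Rightarrow> ('a \<Rightarrow> real) set" where
  "orth_compl F S = {u \<in> fdom F. \<forall>s\<in>S. bil F u s = 0}"

definition orth_proj :: "'a form \<Rightarrow> ('a \<Rightarrow> real) set \<Rightarrow> ('a \<Rightarrow> real) \<Rightarrow> ('a \<Rightarrow> real)" where
  "orth_proj F V u = (SOME p. p \<in> V \<and> (\<forall>w\<in>V. bil F (\<lambda>x. u x - p x) w = 0))"

definition P_proj ::
  "'a::topological_space measure \<Rightarrow> 'a measure \<Rightarrow> 'a form \<Rightarrow> 'a form \<Rightarrow> real \<Rightarrow> ('a \<Rightarrow> real) \<Rightarrow> ('a \<Rightarrow> real)"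
  where
  "P_proj m \<mu> E F l =
     (let F\<^sub>l = shift_form m F l in orth_proj F\<^sub>l (orth_compl F\<^sub>l (kerJ m \<mu> E)))"

text \<open>
  The trace of \<open>F\<^sub>\<lambda>\<close>, in the polarized form \<open>(Ju, Jv) \<mapsto> F\<^sub>\<lambda>(P\<^sub>\<lambda> u, P\<^sub>\<lambda> v)\<close>.  The value does not
  depend on the preimages chosen, as two of them differ by an element of the kernel of \<open>J\<close>.
\<close>

definition preimJ ::
  "'a::topological_space measure \<Rightarrow> 'a measure \<Rightarrow> 'a form \<Rightarrow> ('a \<Rightarrow> real) \<Rightarrow> ('a \<Rightarrow> real)" where
  "preimJ m \<mu> E v = (SOME u. u \<in> domJ m \<mu> E \<and> (AE x in \<mu>. v x = u x))"

definition trace_form ::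
  "'a::topological_space measure \<Rightarrow> 'a measure \<Rightarrow> 'a form \<Rightarrow> 'a form \<Rightarrow> real \<Rightarrow> 'a form" where
  "trace_form m \<mu> E F l =
     Form (ranJ m \<mu> E)
       (\<lambda>v w. bil (shift_form m F l)
          (P_proj m \<mu> E F l (preimJ m \<mu> E v)) (P_proj m \<mu> E F l (preimJ m \<mu> E w)))"

text \<open>
  The trace of \<open>F\<close> itself: the closed form whose operator is the strong resolvent limit, as
  \<open>\<lambda> \<down> 0\<close>, of the operators of the traces of \<open>F\<^sub>\<lambda>\<close>.  A densely defined closed form is determined,
  on its domain, by its resolvent.
\<close>

definition trace_form0 ::
  "'a::topological_space measure \<Rightarrow> 'a measure \<Rightarrow> 'a form \<Rightarrow> 'a form \<Rightarrow> 'a form" where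
  "trace_form0 m \<mu> E F =
     (SOME G. closed_form \<mu> G \<and> densely_defined \<mu> G \<and>
        (\<forall>f\<in>L2 \<mu>. strong_conv \<mu> (\<lambda>l. resolvent1 \<mu> (trace_form m \<mu> E F l) f)
           (resolvent1 \<mu> G f) (at_right 0)))"

end

theory Submission
  imports Defs "HOL-Library.Function_Algebras" "HOL-Library.Diagonal_Subsequence"
begin

text \<open>
  Mosco convergence of closed forms is equivalent to the strong convergence of their resolvents, and
  the resolvents of the traces have a description in which no trace occurs.  Let \<open>D\<close> be the domain of
  \<open>J\<close>, consisting of quasi-continuous functions.  As \<open>J\<close> is continuous for the form norm, every element
  of the form domain has a version in \<open>D\<close>, so that \<open>D\<close> is complete for the form norm
  (\<open>version_exists\<close>, \<open>D_semi_hilbert\<close>), and \<open>J\<close> is the identity of functions on \<open>D\<close>.  The resolvent at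
  \<open>f\<close> of the trace of \<open>\<E>\<^sub>\<lambda>\<close> is the element \<open>u\<close> of \<open>D\<close> with
  \<open>\<E>\<^sub>\<lambda>(u, w) + \<langle>u, w\<rangle>\<^sub>\<mu> = \<langle>f, w\<rangle>\<^sub>\<mu>\<close> for all \<open>w \<in> D\<close>, read as a function in \<open>L\<^sup>2(\<mu>)\<close>
  (\<open>trace_resolvent_lift\<close>).

  For a fixed \<open>\<lambda>\<close>, let \<open>u\<^sub>n\<close> and \<open>u\<close> be these solutions for \<open>\<E>\<^sup>n\<close> and \<open>\<E>\<^sup>\<infinity>\<close>, and let \<open>y\<^sub>n\<close> solve
  \<open>\<E>\<^sup>n\<^sub>1(y\<^sub>n, \<cdot>) = \<E>\<^sup>\<infinity>\<^sub>1(u, \<cdot>)\<close>.  If the right hand side is \<open>\<langle>g, \<cdot>\<rangle>\<^sub>m\<close>, then \<open>y\<^sub>n = K\<^sup>n g\<close> and \<open>u = K\<^sup>\<infinity> g\<close>,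
  so \<open>y\<^sub>n \<rightarrow> u\<close> in \<open>L\<^sup>2(m)\<close> by the Mosco convergence of the forms and in \<open>L\<^sup>2(\<mu>)\<close> by \<open>A3\<close>; since such
  \<open>u\<close> are dense and the forms are uniformly equivalent by \<open>A1\<close>, this holds for all \<open>u \<in> D\<close>
  (\<open>dual_solutions_converge\<close>).  Subtracting the equations for \<open>u\<^sub>n\<close> and \<open>y\<^sub>n\<close>, the forms cancel and only
  inner products with \<open>u - y\<^sub>n\<close> in \<open>L\<^sup>2(m)\<close> and \<open>L\<^sup>2(\<mu>)\<close> remain on the right; hence \<open>u\<^sub>n - y\<^sub>n \<rightarrow> 0\<close>
  (\<open>trace_resolvents_converge\<close>), and the first claim follows.

  For \<open>\<lambda> \<down> 0\<close> the solutions \<open>u\<^sub>\<lambda>\<close> for \<open>\<E>\<^sup>\<infinity>\<close> converge in the completion of \<open>D\<close> for the norm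
  \<open>\<E>\<^sup>\<infinity> + \<langle>\<cdot>, \<cdot>\<rangle>\<^sub>\<mu>\<close>.  The form which this completion induces on its image in \<open>L\<^sup>2(\<mu>)\<close> is closed and has the
  limits of the resolvents as its resolvent (\<open>vanishing_shift\<close>); so the trace for \<open>\<lambda> = 0\<close> exists, and
  its resolvent is the limit of those for \<open>\<lambda>\<^sub>j\<close>.  Resolvents are contractions and \<open>L\<^sup>2(\<mu>)\<close> contains a
  countable total set, so a diagonal choice of \<open>n\<^sub>j\<close> gives strong convergence
  (\<open>trace_Mosco_vanishing_shift\<close>).

  Functions in \<open>L\<^sup>2\<close> and in the form domains are not identified when they agree almost everywhere.  The
  Hilbert space arguments are therefore made for semi-inner products on linear subspaces.
\<close>

section \<open>Complete semi-inner product spaces\<close>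

text \<open>
  Functions, sequences of functions and pairs of these form real vector spaces.  The spaces \<open>L\<^sup>2\<close>, the
  form domains, their completions and the graphs of resolvents are subspaces of such spaces, with null
  vectors instead of equivalence classes.
\<close>

instantiation "fun" :: (type, real_vector) real_vector
begin

definition scaleR_fun_def: "c *\<^sub>R f = (\<lambda>x. c *\<^sub>R f x)"

instance
  by standard (auto simp: scaleR_fun_def fun_eq_iff algebra_simps)

end

lemma scaleR_fun_apply [simp]: "(c *\<^sub>R f) x = c *\<^sub>R f x"
  by (simp add: scaleR_fun_def)

lemma fun_lincomb_eq: "(\<lambda>x. a * f x + b * g x) = a *\<^sub>R f + b *\<^sub>R (g :: 'a \<Rightarrow> real)"
  by (simp add: fun_eq_iff)

abbreviation (input) sq :: "('v \<Rightarrow> 'v \<Rightarrow> real) \<Rightarrow> 'v \<Rightarrow> real" where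
  "sq b x \<equiv> b x x"

locale semi_inner =
  fixes V :: "'v::real_vector set" and b :: "'v \<Rightarrow> 'v \<Rightarrow> real"
  assumes subspace: "subspace V"
    and add_left: "x \<in> V \<Longrightarrow> y \<in> V \<Longrightarrow> z \<in> V \<Longrightarrow> b (x + y) z = b x z + b y z"
    and scale_left: "x \<in> V \<Longrightarrow> z \<in> V \<Longrightarrow> b (c *\<^sub>R x) z = c * b x z"
    and sym: "x \<in> V \<Longrightarrow> y \<in> V \<Longrightarrow> b x y = b y x"
    and nonneg: "x \<in> V \<Longrightarrow> 0 \<le> b x x"
begin

lemma zero_mem [simp, intro]: "0 \<in> V"
  and add_mem [simp, intro]: "x \<in> V \<Longrightarrow> y \<in> V \<Longrightarrow> x + y \<in> V"
  and scale_mem [simp, intro]: "x \<in> V \<Longrightarrow> c *\<^sub>R x \<in> V"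
  using subspace by (auto simp: subspace_def)

lemma diff_mem [simp, intro]: "x \<in> V \<Longrightarrow> y \<in> V \<Longrightarrow> x - y \<in> V"
  using subspace by (rule subspace_diff)

lemma diff_left: "x \<in> V \<Longrightarrow> y \<in> V \<Longrightarrow> z \<in> V \<Longrightarrow> b (x - y) z = b x z - b y z"
  using add_left[of x "(-1) *\<^sub>R y" z] scale_left[of y z "-1"] scale_mem[of y "-1"] by simp

lemma add_right: "x \<in> V \<Longrightarrow> y \<in> V \<Longrightarrow> z \<in> V \<Longrightarrow> b z (x + y) = b z x + b z y"
  using add_left[of x y z] sym[of z "x + y"] sym[of z x] sym[of z y] by auto

lemma scale_right: "x \<in> V \<Longrightarrow> z \<in> V \<Longrightarrow> b z (c *\<^sub>R x) = c * b z x"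
  using scale_left[of x z c] sym[of z "c *\<^sub>R x"] sym[of z x] by auto

lemma diff_right: "x \<in> V \<Longrightarrow> y \<in> V \<Longrightarrow> z \<in> V \<Longrightarrow> b z (x - y) = b z x - b z y"
  using diff_left[of x y z] sym[of z "x - y"] sym[of z x] sym[of z y] by auto

lemmas expand = add_left add_right scale_left scale_right diff_left diff_right

lemma zero_left [simp]: "x \<in> V \<Longrightarrow> b 0 x = 0"
  using scale_left[of x x 0] by simp

lemma zero_right [simp]: "x \<in> V \<Longrightarrow> b x 0 = 0"
  using scale_right[of x x 0] by simp

lemma sq_diff: "x \<in> V \<Longrightarrow> y \<in> V \<Longrightarrow> b (x - y) (x - y) = b x x - 2 * b x y + b y y"
  by (simp add: expand sym[of y x])

lemma sq_add: "x \<in> V \<Longrightarrow> y \<in> V \<Longrightarrow> b (x + y) (x + y) = b x x + 2 * b x y + b y y"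
  by (simp add: expand sym[of y x])

lemma sq_scale: "x \<in> V \<Longrightarrow> sq b (c *\<^sub>R x) = c\<^sup>2 * b x x"
  by (simp add: expand power2_eq_square)

lemma sq_diff_commute: "x \<in> V \<Longrightarrow> y \<in> V \<Longrightarrow> b (x - y) (x - y) = b (y - x) (y - x)"
  by (simp add: sq_diff sym[of y x])

lemma young: "x \<in> V \<Longrightarrow> y \<in> V \<Longrightarrow> 2 * b x y \<le> b x x + b y y"
  using sq_diff[of x y] nonneg[of "x - y"] by simp

lemma sq_add_le: "x \<in> V \<Longrightarrow> y \<in> V \<Longrightarrow> b (x + y) (x + y) \<le> 2 * b x x + 2 * b y y"
  using sq_add[of x y] young[of x y] by simp

lemma sq_triangle:
  assumes "x \<in> V" "y \<in> V" "z \<in> V"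
  shows "b (x - z) (x - z) \<le> 2 * b (x - y) (x - y) + 2 * b (y - z) (y - z)"
  using sq_add_le[of "x - y" "y - z"] assms by simp

lemma cauchy_schwarz:
  assumes "x \<in> V" "y \<in> V"
  shows "(b x y)\<^sup>2 \<le> b x x * b y y"
proof (cases "b y y = 0")
  case True
  have *: "0 \<le> b x x + 2 * t * b x y" for t
    using nonneg[of "x + t *\<^sub>R y"] assms True by (simp add: sq_add sq_scale scale_left scale_right)
  have "b x y = 0"
  proof (rule ccontr)
    assume n: "b x y \<noteq> 0"
    have "0 \<le> b x x + 2 * (- (b x x + 1) / (2 * b x y)) * b x y"
      by (rule *)
    also have "\<dots> = -1"
      using n by (simp add: field_simps)
    finally show False by simp
  qed
  then show ?thesis using True by simp
next
  case False
  then have p: "b y y > 0" using nonneg[of y] assms by simp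
  have "0 \<le> sq b (x - (b x y / b y y) *\<^sub>R y)"
    using assms by (intro nonneg) auto
  also have "\<dots> = b x x - (b x y)\<^sup>2 / b y y"
    using assms p by (simp add: sq_diff sq_scale scale_left scale_right field_simps power2_eq_square)
  finally show ?thesis using p by (simp add: field_simps)
qed

lemma abs_le_sqrt:
  assumes "x \<in> V" "y \<in> V"
  shows "\<bar>b x y\<bar> \<le> sqrt (b x x) * sqrt (b y y)"
  using cauchy_schwarz[OF assms] by (simp add: real_le_rsqrt flip: real_sqrt_mult)

lemma null_left: "x \<in> V \<Longrightarrow> y \<in> V \<Longrightarrow> b x x = 0 \<Longrightarrow> b x y = 0"
  using cauchy_schwarz[of x y] by simp

lemma norm_triangle:
  assumes "x \<in> V" "y \<in> V"
  shows "sqrt (b (x + y) (x + y)) \<le> sqrt (b x x) + sqrt (b y y)"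
proof (rule real_le_lsqrt)
  have "b (x + y) (x + y) \<le> b x x + 2 * (sqrt (b x x) * sqrt (b y y)) + b y y"
    using abs_le_sqrt[OF assms] assms by (simp add: sq_add)
  also have "\<dots> = (sqrt (b x x) + sqrt (b y y))\<^sup>2"
    using nonneg assms by (simp add: power2_sum)
  finally show "b (x + y) (x + y) \<le> (sqrt (b x x) + sqrt (b y y))\<^sup>2" .
qed (use nonneg assms in auto)

lemma norm_triangle_diff:
  assumes "x \<in> V" "y \<in> V" "z \<in> V"
  shows "sqrt (b (x - z) (x - z)) \<le> sqrt (b (x - y) (x - y)) + sqrt (b (y - z) (y - z))"
  using norm_triangle[of "x - y" "y - z"] assms by simp

definition conv :: "(nat \<Rightarrow> 'v) \<Rightarrow> 'v \<Rightarrow> bool" where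
  "conv s v \<longleftrightarrow> (\<lambda>n. sq b (s n - v)) \<longlonglongrightarrow> 0"

lemma tendsto_left:
  assumes "\<And>n. s n \<in> V" "v \<in> V" "y \<in> V" "conv s v"
  shows "(\<lambda>n. b (s n) y) \<longlonglongrightarrow> b v y"
proof -
  have "(\<lambda>n. sqrt (sq b (s n - v)) * sqrt (b y y)) \<longlonglongrightarrow> sqrt 0 * sqrt (b y y)"
    using assms(4) unfolding conv_def by (intro tendsto_intros)
  then have "(\<lambda>n. sqrt (sq b (s n - v)) * sqrt (b y y)) \<longlonglongrightarrow> 0"
    by simp
  then have "(\<lambda>n. b (s n) y - b v y) \<longlonglongrightarrow> 0"
    by (rule Lim_null_comparison[rotated])
      (use abs_le_sqrt[of "s _ - v" y] assms in \<open>auto simp: expand\<close>)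
  then show ?thesis by (simp add: LIM_zero_iff)
qed

lemma tendsto_sq:
  assumes "\<And>n. s n \<in> V" "v \<in> V" "conv s v"
  shows "(\<lambda>n. b (s n) (s n)) \<longlonglongrightarrow> b v v"
proof -
  have "(\<lambda>n. sq b (s n - v) + 2 * b (s n) v - b v v) \<longlonglongrightarrow> 0 + 2 * b v v - b v v"
    using assms(3) unfolding conv_def
    by (intro tendsto_intros tendsto_left) (use assms in auto)
  then show ?thesis
    using assms by (simp add: sq_diff)
qed

end

locale semi_hilbert = semi_inner +
  assumes complete:
    "\<And>s. (\<And>n. s n \<in> V) \<Longrightarrow>
      (\<And>e. e > 0 \<Longrightarrow> \<exists>N. \<forall>i\<ge>N. \<forall>j\<ge>N. sq b (s i - s j) < e) \<Longrightarrow> \<exists>v\<in>V. conv s v"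
begin

text \<open>
  A minimising sequence of the convex functional \<open>b (A x) (A x) - 2 l x\<close> is Cauchy by the
  parallelogram law, and the first variation vanishes at its limit.  As the functional is minimised
  over the image of an arbitrary space \<open>W\<close>, this one statement contains the representation theorem
  of Riesz, the projection onto the closure of a subspace, and the representation of functionals
  that are given on the graph of an operator only.
\<close>

lemma riesz_image:
  fixes A :: "'w::real_vector \<Rightarrow> 'a"
  assumes W: "subspace W" and A: "\<And>x. x \<in> W \<Longrightarrow> A x \<in> V"
    and Aadd: "\<And>x y. x \<in> W \<Longrightarrow> y \<in> W \<Longrightarrow> A (x + y) = A x + A y"
    and Asc: "\<And>x c. x \<in> W \<Longrightarrow> A (c *\<^sub>R x) = c *\<^sub>R A x"
    and ladd: "\<And>x y. x \<in> W \<Longrightarrow> y \<in> W \<Longrightarrow> l (x + y) = l x + l y"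
    and lsc: "\<And>x c. x \<in> W \<Longrightarrow> l (c *\<^sub>R x) = c * l x"
    and bd: "\<And>x. x \<in> W \<Longrightarrow> (l x)\<^sup>2 \<le> C * b (A x) (A x)"
  obtains s v where "\<And>n. s n \<in> W" "v \<in> V" "conv (\<lambda>n. A (s n)) v" "\<And>x. x \<in> W \<Longrightarrow> b v (A x) = l x"
proof -
  define J where "J x = b (A x) (A x) - 2 * l x" for x
  have W0: "0 \<in> W" and Wadd: "\<And>x y. x \<in> W \<Longrightarrow> y \<in> W \<Longrightarrow> x + y \<in> W"
    and Wsc: "\<And>x c. x \<in> W \<Longrightarrow> c *\<^sub>R x \<in> W"
    using W by (auto simp: subspace_def)
  have low: "- \<bar>C\<bar> \<le> J x" if "x \<in> W" for x
  proof -
    have p: "0 \<le> b (A x) (A x)" using nonneg A that by auto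
    have "(l x)\<^sup>2 \<le> \<bar>C\<bar> * b (A x) (A x)"
      using bd[OF that] p by (smt (verit) mult_right_mono)
    then have "(2 * l x)\<^sup>2 \<le> (\<bar>C\<bar> + b (A x) (A x))\<^sup>2"
      using sum_squares_ge_zero[of "\<bar>C\<bar> - b (A x) (A x)" 0]
      by (simp add: power2_eq_square algebra_simps)
    then have "2 * l x \<le> \<bar>C\<bar> + b (A x) (A x)"
      by (rule power2_le_imp_le) (use p in simp)
    then show ?thesis by (simp add: J_def)
  qed
  define I where "I = Inf (J ` W)"
  have bdd: "bdd_below (J ` W)"
    using low by (auto intro!: bdd_belowI)
  have I_le: "I \<le> J x" if "x \<in> W" for x
    unfolding I_def using that bdd by (auto intro: cInf_lower)
  have "\<exists>x\<in>W. J x < I + 1 / real (Suc n)" for n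
    using cInf_less_iff[of "J ` W" "I + 1 / real (Suc n)"] bdd W0 unfolding I_def by auto
  then obtain s where s: "\<And>n. s n \<in> W" "\<And>n. J (s n) < I + 1 / real (Suc n)"
    by metis
  have par: "sq b (A x - A y) \<le> 2 * (J x - I) + 2 * (J y - I)" if "x \<in> W" "y \<in> W" for x y
  proof -
    \<comment> \<open>The midpoint cannot lie below the infimum.\<close>
    have "I \<le> J ((1/2) *\<^sub>R (x + y))"
      using that by (intro I_le Wsc Wadd)
    also have "J ((1/2) *\<^sub>R (x + y)) = sq b (A x + A y) / 4 - (l x + l y)"
      using that A Wadd
      by (simp add: J_def Asc Aadd lsc ladd sq_scale power2_eq_square add_divide_distrib)
    also have "\<dots> = (2 * b (A x) (A x) + 2 * b (A y) (A y) - sq b (A x - A y)) / 4 - (l x + l y)"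
      using that A by (simp add: sq_add sq_diff)
    finally show ?thesis by (simp add: J_def field_simps)
  qed
  have "\<exists>v\<in>V. conv (\<lambda>n. A (s n)) v"
  proof (rule complete)
    show "A (s n) \<in> V" for n using s A by auto
    fix e :: real assume e: "e > 0"
    then obtain N where N: "1 / real (Suc N) < e / 4"
      using nat_approx_posE[of "e/4"] by auto
    have "sq b (A (s i) - A (s j)) < e" if "i \<ge> N" "j \<ge> N" for i j
    proof -
      have "1 / real (Suc i) \<le> 1 / real (Suc N)" "1 / real (Suc j) \<le> 1 / real (Suc N)"
        using that by (auto intro!: divide_left_mono)
      then have "J (s i) - I < e / 4" "J (s j) - I < e / 4"
        using s(2)[of i] s(2)[of j] N by (smt (verit))+
      then show ?thesis
        using par[OF s(1) s(1), of i j] by (simp add: field_simps)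
    qed
    then show "\<exists>N. \<forall>i\<ge>N. \<forall>j\<ge>N. sq b (A (s i) - A (s j)) < e" by blast
  qed
  then obtain v where v: "v \<in> V" "conv (\<lambda>n. A (s n)) v" by auto
  have "b v (A x) = l x" if x: "x \<in> W" for x
  proof -
    define d where "d = b v (A x) - l x"
    define a where "a = b (A x) (A x)"
    have a0: "a \<ge> 0" using nonneg A x by (auto simp: a_def)
    have ge: "0 \<le> 2 * t * d + t\<^sup>2 * a" for t
    proof -
      have "- (1 / real (Suc n)) \<le> 2 * t * (b (A (s n)) (A x) - l x) + t\<^sup>2 * a" for n
      proof -
        have "I \<le> J (s n + t *\<^sub>R x)"
          using s x by (intro I_le Wsc Wadd)
        also have "\<dots> = J (s n) + 2 * t * (b (A (s n)) (A x) - l x) + t\<^sup>2 * a"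
          using s(1)[of n] x A Wsc
          by (simp add: J_def a_def Aadd Asc ladd lsc sq_add sq_scale scale_left scale_right
              power2_eq_square algebra_simps)
        finally show ?thesis using s(2)[of n] by linarith
      qed
      moreover have "(\<lambda>n. 2 * t * (b (A (s n)) (A x) - l x) + t\<^sup>2 * a) \<longlonglongrightarrow> 2 * t * d + t\<^sup>2 * a"
        unfolding d_def using s x A v
        by (intro tendsto_intros tendsto_left) auto
      moreover have "(\<lambda>n. - (1 / real (Suc n))) \<longlonglongrightarrow> - 0"
        by (rule tendsto_minus) (rule LIMSEQ_Suc[OF lim_1_over_n])
      ultimately show ?thesis
        using LIMSEQ_le[of "\<lambda>n. - (1 / real (Suc n))" "-0"] by auto
    qed
    have "d = 0"
    proof (rule ccontr)
      assume "d \<noteq> 0"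
      then have "d\<^sup>2 > 0" by simp
      have "0 \<le> 2 * (- d / (a + 1)) * d + (- d / (a + 1))\<^sup>2 * a" by (rule ge)
      also have "\<dots> = - (d\<^sup>2 * (a + 2) / (a + 1)\<^sup>2)"
        using a0 by (simp add: divide_simps power2_eq_square) (simp add: algebra_simps)
      also have "\<dots> < 0"
        using \<open>d\<^sup>2 > 0\<close> a0 by (simp add: divide_simps)
      finally show False by simp
    qed
    then show ?thesis by (simp add: d_def)
  qed
  with s v show ?thesis using that by blast
qed

lemma riesz:
  assumes "\<And>x y. x \<in> V \<Longrightarrow> y \<in> V \<Longrightarrow> l (x + y) = l x + l y"
    and "\<And>x c. x \<in> V \<Longrightarrow> l (c *\<^sub>R x) = c * l x"
    and "\<And>x. x \<in> V \<Longrightarrow> (l x)\<^sup>2 \<le> C * b x x"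
  obtains v where "v \<in> V" "\<And>x. x \<in> V \<Longrightarrow> b v x = l x"
  using riesz_image[of V "\<lambda>x. x" l C] subspace assms by metis

lemma projection:
  assumes W: "subspace W" and A: "\<And>x. x \<in> W \<Longrightarrow> A x \<in> V"
    and Aadd: "\<And>x y. x \<in> W \<Longrightarrow> y \<in> W \<Longrightarrow> A (x + y) = A x + A y"
    and Asc: "\<And>x c. x \<in> W \<Longrightarrow> A (c *\<^sub>R x) = c *\<^sub>R A x"
    and u: "u \<in> V"
  obtains s v where "\<And>n. s n \<in> W" "v \<in> V" "conv (\<lambda>n. A (s n)) v"
    "\<And>x. x \<in> W \<Longrightarrow> b (u - v) (A x) = 0"
proof -
  obtain s v where "\<And>n. s n \<in> W" "v \<in> V" "conv (\<lambda>n. A (s n)) v"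
    "\<And>x. x \<in> W \<Longrightarrow> b v (A x) = b u (A x)"
    using riesz_image[OF W A Aadd Asc, of "\<lambda>x. b u (A x)" "b u u"] u A Aadd Asc cauchy_schwarz[OF u]
    by (smt (verit) add_right scale_right)
  then show ?thesis
    using that[of s v] u A by (simp add: diff_left)
qed

lemma dense_image:
  assumes W: "subspace W" and A: "\<And>x. x \<in> W \<Longrightarrow> A x \<in> V"
    and Aadd: "\<And>x y. x \<in> W \<Longrightarrow> y \<in> W \<Longrightarrow> A (x + y) = A x + A y"
    and Asc: "\<And>x c. x \<in> W \<Longrightarrow> A (c *\<^sub>R x) = c *\<^sub>R A x"
    and triv: "\<And>z. z \<in> V \<Longrightarrow> (\<And>x. x \<in> W \<Longrightarrow> b z (A x) = 0) \<Longrightarrow> b z z = 0"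
    and u: "u \<in> V" and e: "e > 0"
  obtains x where "x \<in> W" "sq b (u - A x) < e"
proof -
  obtain s v where s: "\<And>n. s n \<in> W" "v \<in> V" "conv (\<lambda>n. A (s n)) v"
    "\<And>x. x \<in> W \<Longrightarrow> b (u - v) (A x) = 0"
    using projection[OF W A Aadd Asc u] by metis
  have z: "b (u - v) (u - v) = 0"
    using s u by (intro triv) auto
  have "eventually (\<lambda>n. sq b (A (s n) - v) < e / 2) sequentially"
    using s(3) e unfolding conv_def by (intro order_tendstoD(2)) auto
  then obtain n where n: "sq b (A (s n) - v) < e / 2"
    by (auto simp: eventually_sequentially)
  have "sq b (u - A (s n)) \<le> 2 * b (u - v) (u - v) + 2 * sq b (v - A (s n))"
    using u s A by (intro sq_triangle) auto
  also have "\<dots> < e"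
    using z n sq_diff_commute[of v "A (s n)"] s A by simp
  finally show ?thesis using s that by blast
qed

text \<open>
  The set \<open>W\<close> of all vectors against which a subsequence converges is a subspace that contains the
  sequence.  On \<open>W\<close> the limit is represented by Riesz, and what is orthogonal to \<open>W\<close> is orthogonal to
  the whole sequence.
\<close>

lemma weak_compactness:
  fixes x :: "nat \<Rightarrow> 'a"
  assumes x: "\<And>n. x n \<in> V" and bd: "\<And>n. b (x n) (x n) \<le> B"
  obtains r w where "strict_mono (r::nat \<Rightarrow> nat)" "w \<in> V"
    "\<And>f. f \<in> V \<Longrightarrow> (\<lambda>n. b (x (r n)) f) \<longlonglongrightarrow> b w f"
proof -
  have B0: "B \<ge> 0" using bd[of 0] nonneg[OF x, of 0] by simp
  have ub: "\<bar>b (x n) f\<bar> \<le> sqrt B * sqrt (b f f)" if "f \<in> V" for n f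
  proof -
    have "\<bar>b (x n) f\<bar> \<le> sqrt (b (x n) (x n)) * sqrt (b f f)"
      using x that by (intro abs_le_sqrt)
    also have "\<dots> \<le> sqrt B * sqrt (b f f)"
      by (rule mult_right_mono) (simp_all add: bd nonneg that)
    finally show ?thesis .
  qed
  interpret D: subseqs "\<lambda>i r. convergent (\<lambda>n. b (x (r n)) (x i))"
  proof
    fix i and s :: "nat \<Rightarrow> nat" assume "strict_mono s"
    have "bounded (range (\<lambda>n. b (x (s n)) (x i)))"
      using ub[OF x] by (auto simp: bounded_iff)
    then obtain l r where "strict_mono r" "((\<lambda>n. b (x (s n)) (x i)) \<circ> r) \<longlonglongrightarrow> l"
      using bounded_imp_convergent_subsequence by blast
    then show "\<exists>r'. strict_mono r' \<and> convergent (\<lambda>n. b (x ((s \<circ> r') n)) (x i))"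
      by (auto simp: o_def convergent_def)
  qed
  define r where "r = D.diagseq"
  have r: "strict_mono r" unfolding r_def by (rule D.subseq_diagseq)
  have conv_x: "convergent (\<lambda>n. b (x (r n)) (x i))" for i
  proof -
    have "convergent (\<lambda>n. b (x ((D.diagseq \<circ> (+) (Suc i)) n)) (x i))"
    proof (rule D.diagseq_holds)
      fix s t :: "nat \<Rightarrow> nat" and k
      assume "strict_mono s" "convergent (\<lambda>n. b (x (t n)) (x k))"
      then show "convergent (\<lambda>n. b (x ((t \<circ> s) n)) (x k))"
        using convergent_subseq_convergent[of "\<lambda>n. b (x (t n)) (x k)" s] by (simp add: o_def)
    qed
    then have "convergent (\<lambda>n. b (x (r (n + Suc i))) (x i))"
      by (simp add: r_def o_def add.commute)
    then show ?thesis
      by (subst (asm) convergent_ignore_initial_segment[of "\<lambda>n. b (x (r n)) (x i)"])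
  qed
  define W where "W = {f \<in> V. convergent (\<lambda>n. b (x (r n)) f)}"
  define l where "l f = lim (\<lambda>n. b (x (r n)) f)" for f
  have W: "subspace W"
    using x by (auto simp: W_def subspace_def expand zero_right intro!: convergent_add convergent_mult convergent_const)
  have lim: "(\<lambda>n. b (x (r n)) f) \<longlonglongrightarrow> l f" if "f \<in> W" for f
    using that by (simp add: W_def l_def convergent_LIMSEQ_iff)
  have ladd: "l (f + g) = l f + l g" if "f \<in> W" "g \<in> W" for f g
  proof (rule LIMSEQ_unique[OF lim])
    show "f + g \<in> W" using that W by (auto simp: subspace_def)
    have "(\<lambda>n. b (x (r n)) f + b (x (r n)) g) \<longlonglongrightarrow> l f + l g"
      using that by (intro tendsto_add lim)
    then show "(\<lambda>n. b (x (r n)) (f + g)) \<longlonglongrightarrow> l f + l g"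
      using that x by (simp add: W_def expand)
  qed
  have lsc: "l (c *\<^sub>R f) = c * l f" if "f \<in> W" for f c
  proof (rule LIMSEQ_unique[OF lim])
    show "c *\<^sub>R f \<in> W" using that W by (auto simp: subspace_def)
    have "(\<lambda>n. c * b (x (r n)) f) \<longlonglongrightarrow> c * l f"
      using that by (intro tendsto_mult lim tendsto_const)
    then show "(\<lambda>n. b (x (r n)) (c *\<^sub>R f)) \<longlonglongrightarrow> c * l f"
      using that x by (simp add: W_def expand)
  qed
  have lbd: "(l f)\<^sup>2 \<le> B * b f f" if "f \<in> W" for f
  proof -
    have fV: "f \<in> V" using that by (simp add: W_def)
    have "\<bar>l f\<bar> \<le> sqrt B * sqrt (b f f)"
      using tendsto_rabs[OF lim[OF that]] ub[OF fV] by (intro LIMSEQ_le_const2) auto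
    then have "\<bar>l f\<bar>\<^sup>2 \<le> (sqrt B * sqrt (b f f))\<^sup>2"
      by (intro power_mono) auto
    then show ?thesis using B0 nonneg[OF fV] by (simp add: power_mult_distrib)
  qed
  obtain s w where s: "\<And>n. s n \<in> W" and w: "w \<in> V" and sw: "conv s w"
    and wl: "\<And>f. f \<in> W \<Longrightarrow> b w f = l f"
    by (rule riesz_image[OF W, of "\<lambda>x. x" l B]) (use ladd lsc lbd in \<open>auto simp: W_def\<close>)
  have "(\<lambda>n. b (x (r n)) f) \<longlonglongrightarrow> b w f" if f: "f \<in> V" for f
  proof -
    obtain t v where t: "\<And>n. t n \<in> W" and v: "v \<in> V" and tv: "conv t v"
      and orth: "\<And>g. g \<in> W \<Longrightarrow> b (f - v) g = 0"
      by (rule projection[OF W, of "\<lambda>x. x" f]) (use f in \<open>auto simp: W_def\<close>)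
    have tV: "t n \<in> V" "s n \<in> V" for n using t s by (auto simp: W_def)
    have xW: "x n \<in> W" for n using conv_x x by (simp add: W_def)
    have ox: "b (x n) f = b (x n) v" for n
      using orth[OF xW[of n]] x[of n] f v by (simp add: sym[of "x n"] diff_left)
    have "(\<lambda>n. b (s n) (f - v)) \<longlonglongrightarrow> b w (f - v)"
      using tV w f v sw by (intro tendsto_left) auto
    moreover have "b (s n) (f - v) = 0" for n
      using orth[OF s] tV f v by (simp add: sym[of "s n"])
    ultimately have "b w (f - v) = 0"
      using LIMSEQ_unique[OF tendsto_const[of "0::real"]] by force
    then have ow: "b w f = b w v" using w f v by (simp add: diff_right)
    have "(\<lambda>n. b (x (r n)) v) \<longlonglongrightarrow> b w v"
    proof (rule LIMSEQ_I)
      fix e :: real assume e: "e > 0"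
      define K where "K = sqrt B + sqrt (b w w) + 1"
      have K: "K > 0" using B0 nonneg[OF w] by (simp add: K_def add_nonneg_pos)
      have sqt: "(\<lambda>n. sqrt (sq b (t n - v))) \<longlonglongrightarrow> sqrt 0"
        using tv unfolding conv_def by (intro tendsto_intros)
      obtain k where k: "sqrt (sq b (t k - v)) < e / (2 * K)"
        using order_tendstoD(2)[OF sqt, of "e / (2 * K)"] e K by (auto simp: eventually_sequentially)
      obtain N where N: "\<And>n. n \<ge> N \<Longrightarrow> norm (b (x (r n)) (t k) - l (t k)) < e / 2"
        using LIMSEQ_D[OF lim[OF t[of k]], of "e / 2"] e by auto
      have "norm (b (x (r n)) v - b w v) < e" if "n \<ge> N" for n
      proof -
        have "b (x (r n)) v - b w v = (b (x (r n)) (t k) - l (t k)) - b (x (r n)) (t k - v) + b w (t k - v)"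
          using x tV v w wl[OF t[of k]] by (simp add: diff_right)
        moreover have "\<bar>b (x (r n)) (t k - v)\<bar> \<le> sqrt B * sqrt (sq b (t k - v))"
          using tV v by (intro ub) auto
        moreover have "\<bar>b w (t k - v)\<bar> \<le> sqrt (b w w) * sqrt (sq b (t k - v))"
          using tV v w by (intro abs_le_sqrt) auto
        moreover have "sqrt B * sqrt (sq b (t k - v)) + sqrt (b w w) * sqrt (sq b (t k - v))
            \<le> K * sqrt (sq b (t k - v))"
          using nonneg[of "t k - v"] tV v by (simp add: K_def algebra_simps)
        moreover have "K * sqrt (sq b (t k - v)) < e / 2"
          using k K by (simp add: field_simps)
        ultimately show ?thesis using N[OF that] by (simp add: abs_if split: if_splits)
      qed
      then show "\<exists>N. \<forall>n\<ge>N. norm (b (x (r n)) v - b w v) < e" by blast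
    qed
    then show ?thesis by (simp add: ox ow)
  qed
  then show ?thesis using that r w by blast
qed

text \<open>
  The uniform boundedness principle for functionals, by a gliding hump: if the norms were unbounded,
  one could add to a vector steps of length \<open>3\<^sup>-\<^sup>k\<close> along elements of norm at least \<open>4\<^sup>k\<close>, with signs
  for which the value on that element does not decrease.  The later steps are too short to undo it.
\<close>

lemma uniform_boundedness:
  fixes x :: "nat \<Rightarrow> 'a"
  assumes x: "\<And>n. x n \<in> V" and bd: "\<And>f. f \<in> V \<Longrightarrow> \<exists>B. \<forall>n. \<bar>b (x n) f\<bar> \<le> B"
  obtains B where "\<And>n. b (x n) (x n) \<le> B"
proof (rule ccontr)
  assume "\<not> thesis"
  then have "\<exists>n. b (x n) (x n) > B" for B using that by (metis not_less)
  then have "\<forall>k. \<exists>n. b (x n) (x n) > (4 ^ k)\<^sup>2" by blast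
  then obtain N :: "nat \<Rightarrow> nat" where N: "\<And>k. sq b (x (N k)) > (4 ^ k)\<^sup>2"
    by metis
  define a where "a k = sqrt (sq b (x (N k)))" for k :: nat
  have a: "a k > 4 ^ k" for k
    unfolding a_def using N[of k] real_less_rsqrt by blast
  have a2: "sq b (x (N k)) = a k * a k" for k
    unfolding a_def using nonneg[OF x] by simp
  have a0: "a k > 0" for k using a[of k] by (smt (verit) zero_less_power)
  define t where "t k y = (if b (x (N k)) y \<ge> 0 then 1 else -1) * ((1/3) ^ k / a k)" for k y
  define y where "y = rec_nat 0 (\<lambda>k y. y + t k y *\<^sub>R x (N k))"
  have yS: "y (Suc k) = y k + t k (y k) *\<^sub>R x (N k)" for k by (simp add: y_def)
  have yV: "y k \<in> V" for k
    by (induction k) (auto simp: yS x, simp add: y_def)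
  have t_abs: "\<bar>t k z\<bar> = (1/3) ^ k / a k" for k z
    using a0[of k] by (simp add: t_def abs_mult)
  have step: "sq b (y (Suc k) - y k) = ((1/3) ^ k)\<^sup>2" for k
  proof -
    have "sq b (y (Suc k) - y k) = \<bar>t k (y k)\<bar>\<^sup>2 * (a k * a k)"
      using x by (simp add: yS sq_scale a2)
    also have "\<dots> = ((1/3) ^ k)\<^sup>2"
      using a0[of k] by (simp add: t_abs power2_eq_square field_simps)
    finally show ?thesis .
  qed
  have hump: "\<bar>b (x (N k)) (y (Suc k))\<bar> \<ge> (1/3) ^ k * a k" for k
  proof -
    have "b (x (N k)) (y (Suc k)) = b (x (N k)) (y k) + t k (y k) * (a k * a k)"
      using x yV by (simp add: yS expand a2)
    also have "t k (y k) * (a k * a k) = (if b (x (N k)) (y k) \<ge> 0 then 1 else -1) * ((1/3) ^ k * a k)"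
      using a0[of k] by (simp add: t_def)
    finally have eq: "b (x (N k)) (y (Suc k)) = b (x (N k)) (y k)
      + (if b (x (N k)) (y k) \<ge> 0 then 1 else -1) * ((1/3) ^ k * a k)" .
    have "0 < (1/3) ^ k * a k" using a0[of k] by simp
    with eq show ?thesis by (auto split: if_splits)
  qed
  have tele: "sqrt (sq b (y (k + j) - y k)) \<le> (3/2) * (1/3) ^ k * (1 - (1/3) ^ j)" for k j
  proof (induction j)
    case (Suc j)
    have "sqrt (sq b (y (k + Suc j) - y k))
        \<le> sqrt (sq b (y (k + Suc j) - y (k + j)))
          + sqrt (sq b (y (k + j) - y k))"
      using yV by (intro norm_triangle_diff) auto
    also have "\<dots> \<le> (1/3) ^ (k + j) + (3/2) * (1/3) ^ k * (1 - (1/3) ^ j)"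
      using Suc step[of "k + j"] by simp
    also have "\<dots> = (3/2) * (1/3) ^ k * (1 - (1/3) ^ Suc j)"
      by (simp add: power_add field_simps)
    finally show ?case .
  qed (use yV in simp)
  have tele': "sqrt (sq b (y j - y k)) \<le> (3/2) * (1/3) ^ k" if "j \<ge> k" for j k
  proof -
    have "sqrt (sq b (y j - y k)) \<le> (3/2) * (1/3) ^ k * (1 - (1/3) ^ (j - k))"
      using tele[of k "j - k"] that by simp
    also have "\<dots> \<le> (3/2) * (1/3) ^ k * 1"
      by (intro mult_left_mono) auto
    finally show ?thesis by simp
  qed
  have "\<exists>v\<in>V. conv y v"
  proof (rule complete)
    fix e :: real assume e: "e > 0"
    have "(\<lambda>k. (3/2) * (1/3::real) ^ k) \<longlonglongrightarrow> 3/2 * 0"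
      by (intro tendsto_intros LIMSEQ_power_zero) simp
    then have "eventually (\<lambda>k. (3/2) * (1/3::real) ^ k < sqrt e / 2) sequentially"
      by (rule order_tendstoD(2)) (use e in simp)
    then obtain k where k: "(3/2) * (1/3::real) ^ k < sqrt e / 2"
      unfolding eventually_sequentially by blast
    have "sq b (y i - y j) < e" if "i \<ge> k" "j \<ge> k" for i j
    proof -
      have "sqrt (sq b (y i - y j)) \<le> sqrt (sq b (y i - y k)) + sqrt (sq b (y k - y j))"
        using yV by (intro norm_triangle_diff) auto
      also have "\<dots> < sqrt e"
        using tele'[OF that(1)] tele'[OF that(2)] k sq_diff_commute[OF yV yV, of k j] by simp
      finally show ?thesis by simp
    qed
    then show "\<exists>N. \<forall>i\<ge>N. \<forall>j\<ge>N. sq b (y i - y j) < e" by blast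
  qed (use yV in auto)
  then obtain v where v: "v \<in> V" "conv y v" by auto
  have dist: "sqrt (sq b (y k - v)) \<le> (3/2) * (1/3) ^ k" for k
  proof -
    have "conv (\<lambda>j. y j - y k) (v - y k)"
      using v(2) by (simp add: conv_def)
    then have "(\<lambda>j. sq b (y j - y k)) \<longlonglongrightarrow> sq b (v - y k)"
      using yV v by (intro tendsto_sq) auto
    then have "(\<lambda>j. sqrt (sq b (y j - y k))) \<longlonglongrightarrow> sqrt (sq b (v - y k))"
      by (rule tendsto_real_sqrt)
    then have "sqrt (sq b (v - y k)) \<le> (3/2) * (1/3) ^ k"
      using tele' by (intro LIMSEQ_le_const2) auto
    then show ?thesis using sq_diff_commute[OF yV v(1), of k] by simp
  qed
  have low: "\<bar>b (x (N k)) v\<bar> \<ge> (1/2) * (4/3) ^ k" for k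
  proof -
    have "\<bar>b (x (N k)) (y (Suc k) - v)\<bar> \<le> a k * sqrt (sq b (y (Suc k) - v))"
      unfolding a_def using x yV v by (intro abs_le_sqrt) auto
    also have "\<dots> \<le> a k * ((3/2) * (1/3) ^ Suc k)"
      using a0[of k] by (intro mult_left_mono dist) auto
    finally have "\<bar>b (x (N k)) (y (Suc k) - v)\<bar> \<le> (1/2) * ((1/3) ^ k * a k)"
      by (simp add: mult.commute)
    then have "\<bar>b (x (N k)) v\<bar> \<ge> (1/2) * ((1/3) ^ k * a k)"
      using hump[of k] x yV v by (simp add: diff_right abs_if split: if_splits)
    moreover have "(1/3) ^ k * 4 ^ k \<le> (1/3) ^ k * a k"
      using a[of k] by (intro mult_left_mono) auto
    moreover have "(1/3::real) ^ k * 4 ^ k = (4/3) ^ k"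
      by (simp flip: power_mult_distrib)
    ultimately show ?thesis by linarith
  qed
  obtain B where B: "\<And>n. \<bar>b (x n) v\<bar> \<le> B" using bd[OF v(1)] by auto
  obtain k where "(4/3::real) ^ k > 2 * B"
    using real_arch_pow[of "4/3" "2 * B"] by auto
  then show False using low[of k] B[of "N k"] by linarith
qed

end

lemma semi_hilbert_equivalent:
  fixes V :: "'v::real_vector set"
  assumes "semi_hilbert V b" and "semi_inner V b'" and "c > 0"
    and lower: "\<And>x. x \<in> V \<Longrightarrow> c * b x x \<le> b' x x"
    and upper: "\<And>x. x \<in> V \<Longrightarrow> b' x x \<le> C * b x x"
  shows "semi_hilbert V b'"
proof -
  interpret semi_hilbert V b by fact
  interpret b': semi_inner V b' by fact
  show ?thesis
  proof
    fix s :: "nat \<Rightarrow> 'v" assume s: "\<And>n. s n \<in> V"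
      and cau: "\<And>e. e > 0 \<Longrightarrow> \<exists>N. \<forall>i\<ge>N. \<forall>j\<ge>N. sq b' (s i - s j) < e"
    have "\<exists>v\<in>V. conv s v"
    proof (rule complete[OF s])
      fix e :: real assume e: "e > 0"
      obtain N where N: "\<forall>i\<ge>N. \<forall>j\<ge>N. sq b' (s i - s j) < c * e"
        using cau[of "c * e"] e \<open>c > 0\<close> by auto
      have "sq b (s i - s j) < e" if "i \<ge> N" "j \<ge> N" for i j
        using N that lower[of "s i - s j"] s \<open>c > 0\<close> by (smt (verit) diff_mem mult_less_cancel_left_pos)
      then show "\<exists>N. \<forall>i\<ge>N. \<forall>j\<ge>N. sq b (s i - s j) < e" by blast
    qed
    then obtain v where v: "v \<in> V" "conv s v" by auto
    have "(\<lambda>n. C * sq b (s n - v)) \<longlonglongrightarrow> C * 0"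
      using v(2) unfolding conv_def by (intro tendsto_intros)
    then have "(\<lambda>n. C * sq b (s n - v)) \<longlonglongrightarrow> 0"
      by simp
    then have "(\<lambda>n. sq b' (s n - v)) \<longlonglongrightarrow> 0"
      by (rule Lim_null_comparison[rotated])
        (use upper[of "s _ - v"] b'.nonneg[of "s _ - v"] s v in \<open>auto intro!: eventuallyI\<close>)
    then show "\<exists>v\<in>V. b'.conv s v" using v(1) by (auto simp: b'.conv_def)
  qed
qed

section \<open>The space of square integrable functions\<close>

lemma l2norm_diff: "l2norm M (\<lambda>x. f x - g x) = sqrt (ip M (f - g) (f - g))"
  by (simp add: l2norm_def fun_diff_def)

lemma form_conv_iff: "form_conv F u v \<longleftrightarrow> (\<lambda>i. sq (bil F) (u i - v)) \<longlonglongrightarrow> 0"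
  by (simp add: form_conv_def fun_diff_def)

lemma form_Cauchy_iff:
  "form_Cauchy F u \<longleftrightarrow> (\<forall>e>0. \<exists>N. \<forall>i\<ge>N. \<forall>j\<ge>N. sq (bil F) (u i - u j) < e)"
  by (simp add: form_Cauchy_def fun_diff_def)

lemma L2_measurable [measurable_dest]: "f \<in> L2 M \<Longrightarrow> f \<in> borel_measurable M"
  by (simp add: L2_def)

lemma L2_integrable_square: "f \<in> L2 M \<Longrightarrow> integrable M (\<lambda>x. (f x)\<^sup>2)"
  by (simp add: L2_def)

lemma L2_integrable_mult:
  assumes f: "f \<in> L2 M" and g: "g \<in> L2 M"
  shows "integrable M (\<lambda>x. f x * g x)"
proof (rule Bochner_Integration.integrable_bound)
  show "integrable M (\<lambda>x. (f x)\<^sup>2 + (g x)\<^sup>2)"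
    using assms by (intro Bochner_Integration.integrable_add L2_integrable_square)
  show "(\<lambda>x. f x * g x) \<in> borel_measurable M"
    using assms by measurable
  have "\<bar>f x * g x\<bar> \<le> \<bar>(f x)\<^sup>2 + (g x)\<^sup>2\<bar>" for x
  proof -
    have "0 \<le> \<bar>f x\<bar> * \<bar>g x\<bar>" by simp
    moreover have "2 * \<bar>f x\<bar> * \<bar>g x\<bar> \<le> (f x)\<^sup>2 + (g x)\<^sup>2"
      using sum_squares_bound[of "\<bar>f x\<bar>" "\<bar>g x\<bar>"] by simp
    ultimately show ?thesis unfolding abs_mult by linarith
  qed
  then show "AE x in M. norm (f x * g x) \<le> norm ((f x)\<^sup>2 + (g x)\<^sup>2)"
    by simp
qed

lemma L2_lincomb:
  assumes "f \<in> L2 M" "g \<in> L2 M"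
  shows "(\<lambda>x. a * f x + b * g x) \<in> L2 M"
proof -
  have "integrable M (\<lambda>x. a\<^sup>2 * (f x)\<^sup>2 + 2 * a * b * (f x * g x) + b\<^sup>2 * (g x)\<^sup>2)"
    using assms by (intro Bochner_Integration.integrable_add integrable_mult_right L2_integrable_square L2_integrable_mult)
  also have "(\<lambda>x. a\<^sup>2 * (f x)\<^sup>2 + 2 * a * b * (f x * g x) + b\<^sup>2 * (g x)\<^sup>2) = (\<lambda>x. (a * f x + b * g x)\<^sup>2)"
    by (simp add: fun_eq_iff power2_eq_square algebra_simps)
  finally show ?thesis
    using L2_measurable[OF assms(1)] L2_measurable[OF assms(2)] by (simp add: L2_def)
qed

lemma L2_subspace: "subspace (L2 M)"
proof (rule subspaceI)
  show "0 \<in> L2 M" by (simp add: L2_def zero_fun_def)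
  show "x + y \<in> L2 M" if "x \<in> L2 M" "y \<in> L2 M" for x y
    using L2_lincomb[OF that, of 1 1] by (simp add: plus_fun_def)
  show "c *\<^sub>R x \<in> L2 M" if "x \<in> L2 M" for c x
    using L2_lincomb[OF that that, of c 0] by (simp add: scaleR_fun_def)
qed

lemma L2_semi_inner: "semi_inner (L2 M) (ip M)"
proof
  fix x y z :: "'a \<Rightarrow> real" and c
  assume x: "x \<in> L2 M" and z: "z \<in> L2 M"
  show "ip M (x + y) z = ip M x z + ip M y z" if y: "y \<in> L2 M"
    unfolding ip_def using L2_integrable_mult[OF x z] L2_integrable_mult[OF y z]
    by (simp add: algebra_simps)
  show "ip M (c *\<^sub>R x) z = c * ip M x z"
    unfolding ip_def by (simp add: mult.assoc)
  show "ip M x z = ip M z x"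
    unfolding ip_def by (simp add: mult.commute)
  show "0 \<le> ip M x x"
    unfolding ip_def by simp
qed (rule L2_subspace)

lemma L2_AE_cong:
  assumes "v \<in> borel_measurable M" "AE x in M. v x = u x" "u \<in> L2 M"
  shows "v \<in> L2 M"
proof -
  have "integrable M (\<lambda>x. (v x)\<^sup>2) = integrable M (\<lambda>x. (u x)\<^sup>2)"
    using assms by (intro Bochner_Integration.integrable_cong_AE) auto
  then show ?thesis using assms by (simp add: L2_def)
qed

lemma ip_AE_cong:
  assumes "u \<in> borel_measurable M" "u' \<in> borel_measurable M" "v \<in> borel_measurable M" "v' \<in> borel_measurable M"
    and "AE x in M. u x = u' x" "AE x in M. v x = v' x"
  shows "ip M u v = ip M u' v'"
  unfolding ip_def using assms by (intro integral_cong_AE) auto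

lemma ip_null_iff:
  assumes "f \<in> L2 M"
  shows "ip M f f = 0 \<longleftrightarrow> (AE x in M. f x = 0)"
proof -
  have "ip M f f = (\<integral>x. (f x)\<^sup>2 \<partial>M)"
    by (simp add: ip_def power2_eq_square)
  then show ?thesis
    using integral_nonneg_eq_0_iff_AE[OF L2_integrable_square[OF assms]] by simp
qed

lemma ip_diff_null_iff:
  assumes "f \<in> L2 M" "g \<in> L2 M"
  shows "ip M (f - g) (f - g) = 0 \<longleftrightarrow> (AE x in M. f x = g x)"
proof -
  interpret semi_inner "L2 M" "ip M" by (rule L2_semi_inner)
  show ?thesis
    using assms by (subst ip_null_iff) auto
qed

lemma strong_conv_iff:
  assumes "\<And>i. u i \<in> L2 M" "v \<in> L2 M"
  shows "strong_conv M u v Fl \<longleftrightarrow> ((\<lambda>i. sq (ip M) (u i - v)) \<longlongrightarrow> 0) Fl"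
proof -
  interpret semi_inner "L2 M" "ip M" by (rule L2_semi_inner)
  show ?thesis
  proof
    assume "strong_conv M u v Fl"
    then have "((\<lambda>i. (l2norm M (\<lambda>x. u i x - v x))\<^sup>2) \<longlongrightarrow> 0\<^sup>2) Fl"
      unfolding strong_conv_def by (intro tendsto_intros)
    then show "((\<lambda>i. sq (ip M) (u i - v)) \<longlongrightarrow> 0) Fl"
      unfolding l2norm_diff real_sqrt_pow2[OF nonneg[OF diff_mem[OF assms]]] by simp
  next
    assume "((\<lambda>i. sq (ip M) (u i - v)) \<longlongrightarrow> 0) Fl"
    then have "((\<lambda>i. sqrt (sq (ip M) (u i - v))) \<longlongrightarrow> sqrt 0) Fl"
      by (intro tendsto_intros)
    then show "strong_conv M u v Fl"
      unfolding strong_conv_def l2norm_diff by simp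
  qed
qed

lemma strong_conv_versions:
  assumes "\<And>i. u i \<in> L2 M" "v \<in> L2 M" "\<And>i. u' i \<in> L2 M" "v' \<in> L2 M"
    and "\<And>i. AE x in M. u i x = u' i x" "AE x in M. v x = v' x"
  shows "strong_conv M u v Fl \<longleftrightarrow> ((\<lambda>i. sq (ip M) (u' i - v')) \<longlongrightarrow> 0) Fl"
proof -
  interpret semi_inner "L2 M" "ip M" by (rule L2_semi_inner)
  have "sq (ip M) (u i - v) = sq (ip M) (u' i - v')" for i
    by (rule ip_AE_cong; (intro L2_measurable diff_mem assms(1-4))?)
      (use assms(5)[of i] assms(6) in \<open>eventually_elim, simp\<close>)+
  then show ?thesis using strong_conv_iff[of u M v] assms(1,2) by simp
qed

lemma tendsto_null_squeeze:
  fixes x a b :: "nat \<Rightarrow> real"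
  assumes "\<And>n. 0 \<le> x n" "\<And>n. x n \<le> p * a n + q * b n" "a \<longlonglongrightarrow> 0" "b \<longlonglongrightarrow> 0"
  shows "x \<longlonglongrightarrow> 0"
proof (rule Lim_null_comparison[OF eventuallyI])
  show "norm (x n) \<le> p * a n + q * b n" for n using assms(1,2) by simp
  have "(\<lambda>n. p * a n + q * b n) \<longlonglongrightarrow> p * 0 + q * 0" by (intro tendsto_intros assms(3,4))
  then show "(\<lambda>n. p * a n + q * b n) \<longlonglongrightarrow> 0" by simp
qed

lemma L2_AE_subsequence:
  fixes s :: "nat \<Rightarrow> 'a \<Rightarrow> real"
  assumes "\<And>n. s n \<in> L2 M" "f \<in> L2 M" "(\<lambda>n. sq (ip M) (s n - f)) \<longlonglongrightarrow> 0"
  obtains r where "strict_mono (r :: nat \<Rightarrow> nat)" "AE x in M. (\<lambda>n. s (r n) x) \<longlonglongrightarrow> f x"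
proof -
  interpret semi_inner "L2 M" "ip M" by (rule L2_semi_inner)
  have "\<exists>r::nat\<Rightarrow>nat. strict_mono r \<and> (AE x in M. (\<lambda>n. ((s (r n) - f) x)\<^sup>2) \<longlonglongrightarrow> 0)"
    using assms(3) L2_integrable_square[OF diff_mem[OF assms(1,2)]]
    by (intro tendsto_L1_AE_subseq) (auto simp: ip_def power2_eq_square)
  then obtain r where r: "strict_mono r" "AE x in M. (\<lambda>n. ((s (r n) - f) x)\<^sup>2) \<longlonglongrightarrow> 0"
    by blast
  have "AE x in M. (\<lambda>n. s (r n) x) \<longlonglongrightarrow> f x"
    using r(2)
  proof eventually_elim
    case (elim x)
    then have "(\<lambda>n. sqrt (((s (r n) - f) x)\<^sup>2)) \<longlonglongrightarrow> sqrt 0"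
      by (rule tendsto_real_sqrt)
    then have "(\<lambda>n. s (r n) x - f x) \<longlonglongrightarrow> 0"
      by (simp add: tendsto_rabs_zero_iff)
    then show ?case by (simp add: LIM_zero_iff)
  qed
  with r(1) show ?thesis using that by blast
qed

lemma summable_of_weighted_square_bound:
  fixes d :: "nat \<Rightarrow> real"
  assumes "\<And>k. 2 ^ k * (d k)\<^sup>2 \<le> C"
  shows "summable d"
proof (rule summable_comparison_test')
  show "summable (\<lambda>k. sqrt C * (1 / sqrt 2) ^ k)"
    by (intro summable_mult summable_geometric) auto
  have C: "C \<ge> 0" using assms[of 0] by (smt (verit) mult_nonneg_nonneg power_0 zero_le_power2)
  fix k :: nat
  have "(d k)\<^sup>2 \<le> C / 2 ^ k" using assms[of k] by (simp add: field_simps)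
  then have "\<bar>d k\<bar> \<le> sqrt (C / 2 ^ k)" by (simp add: real_le_rsqrt)
  also have "\<dots> = sqrt C * (1 / sqrt 2) ^ k"
    using C by (simp add: real_sqrt_divide real_sqrt_power power_one_over)
  finally show "norm (d k) \<le> sqrt C * (1 / sqrt 2) ^ k" by simp
qed

lemma ennreal_suminf_term_le: "f k \<le> (\<Sum>k. f k :: ennreal)"
  using sum_le_suminf[of f "{k}"] by simp

text \<open>
  A subsequence whose increments \<open>d\<^sub>k\<close> satisfy \<open>ip d\<^sub>k d\<^sub>k \<le> 8\<^sup>-\<^sup>k\<close> converges almost everywhere, since
  \<open>\<Sum> 2\<^sup>k d\<^sub>k\<^sup>2\<close> is integrable; Fatou's lemma identifies the pointwise limit as the limit in \<open>L\<^sup>2\<close>.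
\<close>

lemma L2_semi_hilbert: "semi_hilbert (L2 M) (ip M)"
proof -
  interpret semi_inner "L2 M" "ip M" by (rule L2_semi_inner)
  show ?thesis
  proof
    fix s :: "nat \<Rightarrow> 'a \<Rightarrow> real"
    assume s: "\<And>n. s n \<in> L2 M"
      and cau: "\<And>e. e > 0 \<Longrightarrow> \<exists>N. \<forall>i\<ge>N. \<forall>j\<ge>N. sq (ip M) (s i - s j) < e"
    note [measurable] = L2_measurable[OF s]
    have nn: "(\<integral>\<^sup>+x. ennreal ((s i x - s j x)\<^sup>2) \<partial>M) = ennreal (sq (ip M) (s i - s j))" for i j
      using L2_integrable_square[OF diff_mem[OF s s]]
      by (subst nn_integral_eq_integral) (auto simp: ip_def power2_eq_square)
    have "\<forall>k. \<exists>N. \<forall>i\<ge>N. \<forall>j\<ge>N. sq (ip M) (s i - s j) < (1/8) ^ k"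
      by (intro allI cau) auto
    then obtain N where N: "\<And>k i j. i \<ge> N k \<Longrightarrow> j \<ge> N k \<Longrightarrow> sq (ip M) (s i - s j) < (1/8) ^ k"
      by metis
    define r where "r k = (\<Sum>i\<le>k. N i) + k" for k
    have rN: "r k \<ge> N k" for k
      unfolding r_def using member_le_sum[of k "{..k}" N] by simp
    have r_Suc: "r k \<le> r (Suc k)" for k by (simp add: r_def)
    have r_ge: "r k \<ge> k" for k by (simp add: r_def)
    define d where "d k x = s (r (Suc k)) x - s (r k) x" for k x
    have [measurable]: "d k \<in> borel_measurable M" for k unfolding d_def by measurable
    have d_small: "(\<integral>\<^sup>+x. ennreal ((d k x)\<^sup>2) \<partial>M) \<le> ennreal ((1/8) ^ k)" for k
      unfolding d_def nn using N[of k "r (Suc k)" "r k"] rN[of k] r_Suc[of k]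
      by (intro ennreal_leI) auto
    have "(\<integral>\<^sup>+x. (\<Sum>k. ennreal (2 ^ k * (d k x)\<^sup>2)) \<partial>M) = (\<Sum>k. \<integral>\<^sup>+x. ennreal (2 ^ k * (d k x)\<^sup>2) \<partial>M)"
      by (rule nn_integral_suminf) measurable
    also have "\<dots> \<le> (\<Sum>k. ennreal ((1/4) ^ k))"
    proof (rule suminf_le)
      fix k
      have "(\<integral>\<^sup>+x. ennreal (2 ^ k * (d k x)\<^sup>2) \<partial>M) = ennreal (2 ^ k) * (\<integral>\<^sup>+x. ennreal ((d k x)\<^sup>2) \<partial>M)"
        by (simp add: ennreal_mult nn_integral_cmult)
      also have "\<dots> \<le> ennreal (2 ^ k) * ennreal ((1/8) ^ k)"
        by (intro mult_left_mono d_small) auto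
      also have "\<dots> = ennreal ((1/4) ^ k)"
        by (simp flip: ennreal_mult power_mult_distrib)
      finally show "(\<integral>\<^sup>+x. ennreal (2 ^ k * (d k x)\<^sup>2) \<partial>M) \<le> ennreal ((1/4) ^ k)" .
    qed auto
    also have "\<dots> = ennreal (\<Sum>k. (1/4) ^ k)"
      by (rule suminf_ennreal2) (auto intro!: summable_geometric)
    also have "\<dots> < \<infinity>" by simp
    finally have "AE x in M. (\<Sum>k. ennreal (2 ^ k * (d k x)\<^sup>2)) \<noteq> \<infinity>"
      by (intro nn_integral_PInf_AE) (simp_all add: less_top)
    then have ae: "AE x in M. convergent (\<lambda>k. s (r k) x)"
    proof eventually_elim
      case (elim x)
      define C where "C = enn2real (\<Sum>k. ennreal (2 ^ k * (d k x)\<^sup>2))"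
      have "2 ^ k * (d k x)\<^sup>2 \<le> C" for k
      proof -
        have "ennreal (2 ^ k * (d k x)\<^sup>2) \<le> (\<Sum>k. ennreal (2 ^ k * (d k x)\<^sup>2))"
          by (rule ennreal_suminf_term_le)
        also have "\<dots> = ennreal C"
          unfolding C_def ennreal_enn2real_if using elim by (simp only: if_False infinity_ennreal_def)
        finally show ?thesis
          by (rule ennreal_le_iff[THEN iffD1, rotated]) (simp add: C_def)
      qed
      then have "summable (\<lambda>k. d k x)" by (rule summable_of_weighted_square_bound)
      then have "convergent (\<lambda>k. \<Sum>i<k. d i x)" by (simp add: summable_iff_convergent)
      then have "convergent (\<lambda>k. s (r k) x - s (r 0) x)"
        unfolding d_def by (subst (asm) sum_lessThan_telescope) auto
      then have "convergent (\<lambda>k. s (r k) x - s (r 0) x + s (r 0) x)"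
        by (intro convergent_add convergent_const)
      then show ?case by simp
    qed
    define f where "f x = lim (\<lambda>k. s (r k) x)" for x
    have f_meas [measurable]: "f \<in> borel_measurable M"
      unfolding f_def by (rule borel_measurable_lim_metric) measurable
    have ae_f: "AE x in M. (\<lambda>k. s (r k) x) \<longlonglongrightarrow> f x"
      using ae by eventually_elim (simp add: f_def convergent_LIMSEQ_iff)
    have fatou: "(\<integral>\<^sup>+x. ennreal ((s n x - f x)\<^sup>2) \<partial>M) \<le> ennreal e"
      if n: "\<And>j. j \<ge> K \<Longrightarrow> sq (ip M) (s n - s j) < e" for n K e
    proof -
      have "(\<integral>\<^sup>+x. ennreal ((s n x - f x)\<^sup>2) \<partial>M)
          = (\<integral>\<^sup>+x. liminf (\<lambda>k. ennreal ((s n x - s (r k) x)\<^sup>2)) \<partial>M)"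
      proof (rule nn_integral_cong_AE)
        show "AE x in M. ennreal ((s n x - f x)\<^sup>2) = liminf (\<lambda>k. ennreal ((s n x - s (r k) x)\<^sup>2))"
          using ae_f
        proof eventually_elim
          case (elim x)
          have "(\<lambda>k. ennreal ((s n x - s (r k) x)\<^sup>2)) \<longlonglongrightarrow> ennreal ((s n x - f x)\<^sup>2)"
            by (intro tendsto_intros elim tendsto_ennrealI)
          then show ?case by (rule lim_imp_Liminf[OF trivial_limit_sequentially, symmetric])
        qed
      qed
      also have "\<dots> \<le> liminf (\<lambda>k. \<integral>\<^sup>+x. ennreal ((s n x - s (r k) x)\<^sup>2) \<partial>M)"
        by (rule nn_integral_liminf) measurable
      also have "\<dots> \<le> limsup (\<lambda>k. \<integral>\<^sup>+x. ennreal ((s n x - s (r k) x)\<^sup>2) \<partial>M)"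
        by (rule Liminf_le_Limsup) simp
      also have "\<dots> \<le> ennreal e"
      proof (rule Limsup_bounded)
        show "eventually (\<lambda>k. (\<integral>\<^sup>+x. ennreal ((s n x - s (r k) x)\<^sup>2) \<partial>M) \<le> ennreal e) sequentially"
          unfolding nn using eventually_ge_at_top[of K]
        proof eventually_elim
          case (elim k)
          then have "K \<le> r k" using r_ge[of k] by simp
          then show ?case using n[of "r k"] by (intro ennreal_leI) simp
        qed
      qed
      finally show ?thesis .
    qed
    have sf: "s n - f \<in> L2 M \<and> sq (ip M) (s n - f) \<le> e"
      if n: "\<And>j. j \<ge> K \<Longrightarrow> sq (ip M) (s n - s j) < e" and e: "e > 0" for n K e
    proof -
      have F: "(\<integral>\<^sup>+x. ennreal ((s n x - f x)\<^sup>2) \<partial>M) \<le> ennreal e"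
        using n by (rule fatou)
      have m: "s n - f \<in> borel_measurable M"
        unfolding fun_diff_def by measurable
      have i: "integrable M (\<lambda>x. (s n x - f x)\<^sup>2)"
        using F by (intro integrableI_bounded) (auto intro: le_less_trans)
      have "ennreal (\<integral>x. (s n x - f x)\<^sup>2 \<partial>M) \<le> ennreal e"
        using F nn_integral_eq_integral[OF i] by simp
      then have "(\<integral>x. (s n x - f x)\<^sup>2 \<partial>M) \<le> e" using e by simp
      then show ?thesis
        using m i by (simp add: L2_def ip_def power2_eq_square)
    qed
    obtain K where K: "\<forall>i\<ge>K. \<forall>j\<ge>K. sq (ip M) (s i - s j) < 1"
      using cau[of 1] by auto
    have "s K - f \<in> L2 M" using sf[of K K 1] K by simp
    then have "s K - (s K - f) \<in> L2 M" using s by blast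
    then have fL: "f \<in> L2 M" by simp
    have "conv s f"
      unfolding conv_def
    proof (rule LIMSEQ_I)
      fix e :: real assume e: "e > 0"
      obtain K where K: "\<forall>i\<ge>K. \<forall>j\<ge>K. sq (ip M) (s i - s j) < e / 2"
        using cau[of "e/2"] e by auto
      have "norm (sq (ip M) (s n - f) - 0) < e" if "n \<ge> K" for n
        using sf[of K n "e/2"] K that e nonneg[of "s n - f"] by fastforce
      then show "\<exists>K. \<forall>n\<ge>K. norm (sq (ip M) (s n - f) - 0) < e" by blast
    qed
    with fL show "\<exists>v\<in>L2 M. conv s v" by blast
  qed
qed

section \<open>Forms and resolvents\<close>

lemma shift_form_simps [simp]:
  "fdom (shift_form M F l) = fdom F"
  "bil (shift_form M F l) u v = bil F u v + l * ip M u v"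
  by (simp_all add: shift_form_def)

abbreviation "form1 M F \<equiv> bil (shift_form M F 1)"

lemma positive_form_L2: "positive_form M F \<Longrightarrow> u \<in> fdom F \<Longrightarrow> u \<in> L2 M"
  by (auto simp: positive_form_def)

lemma positive_form_semi_inner:
  assumes "positive_form M F"
  shows "semi_inner (fdom F) (bil F)"
proof
  show "subspace (fdom F)"
  proof (rule subspaceI)
    show "0 \<in> fdom F" using assms by (simp add: positive_form_def zero_fun_def)
    show "x + y \<in> fdom F" if "x \<in> fdom F" "y \<in> fdom F" for x y
    proof -
      have "(\<lambda>z. 1 * x z + 1 * y z) \<in> fdom F"
        using assms that unfolding positive_form_def by blast
      then show ?thesis by (simp add: plus_fun_def)
    qed
    show "c *\<^sub>R x \<in> fdom F" if "x \<in> fdom F" for c x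
    proof -
      have "(\<lambda>z. c * x z + 0 * x z) \<in> fdom F"
        using assms that unfolding positive_form_def by blast
      then show ?thesis by (simp add: scaleR_fun_def)
    qed
  qed
  fix x y z c assume x: "x \<in> fdom F" and z: "z \<in> fdom F"
  have lin: "bil F (\<lambda>t. a * x t + b * y t) z = a * bil F x z + b * bil F y z" if "y \<in> fdom F" for a b y
    using assms that x z unfolding positive_form_def by blast
  show "bil F (x + y) z = bil F x z + bil F y z" if "y \<in> fdom F"
    using lin[OF that, of 1 1] by (simp add: plus_fun_def)
  show "bil F (c *\<^sub>R x) z = c * bil F x z"
    using lin[OF x, of c 0] by (simp add: scaleR_fun_def)
  show "bil F x z = bil F z x"
    using assms x z unfolding positive_form_def by blast
  show "0 \<le> bil F x x"
    using assms x unfolding positive_form_def by blast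
qed

lemma positive_form_AE_mem:
  assumes "positive_form M F" "u \<in> fdom F" "v \<in> borel_measurable M" "AE x in M. v x = u x"
  shows "v \<in> fdom F"
  using assms unfolding positive_form_def by blast

lemma positive_form_AE_cong:
  assumes "positive_form M F" "u \<in> fdom F" "u' \<in> fdom F" "v \<in> fdom F" "v' \<in> fdom F"
    and "AE x in M. u x = u' x" "AE x in M. v x = v' x"
  shows "bil F u v = bil F u' v'"
proof -
  interpret semi_inner "fdom F" "bil F" using assms(1) by (rule positive_form_semi_inner)
  have "bil F u v = bil F u' v"
    using assms unfolding positive_form_def by blast
  also have "\<dots> = bil F v u'" using assms by (simp add: sym)
  also have "\<dots> = bil F v' u'"
    using assms unfolding positive_form_def by blast
  finally show ?thesis using assms by (simp add: sym)
qed

lemma semi_inner_plus: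
  fixes V :: "'v::real_vector set"
  assumes "semi_inner V b" "semi_inner V' b'" "V \<subseteq> V'" "c \<ge> 0"
  shows "semi_inner V (\<lambda>x y. b x y + c * b' x y)"
proof -
  interpret b: semi_inner V b by fact
  interpret b': semi_inner V' b' by fact
  show ?thesis
    using assms(3,4)
    by unfold_locales
      (auto simp: b.expand b'.expand b.subspace algebra_simps subset_iff b.sym b'.sym b.nonneg b'.nonneg)
qed

lemma positive_form_shift:
  assumes "positive_form M F" "l \<ge> 0"
  shows "positive_form M (shift_form M F l)"
proof -
  interpret L: semi_inner "L2 M" "ip M" by (rule L2_semi_inner)
  interpret F: semi_inner "fdom F" "bil F" using assms(1) by (rule positive_form_semi_inner)
  have sub: "fdom F \<subseteq> L2 M" using assms(1) by (rule positive_form_L2[THEN subsetI])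
  interpret S: semi_inner "fdom F" "\<lambda>u v. bil F u v + l * ip M u v"
    by (rule semi_inner_plus[OF F.semi_inner_axioms L.semi_inner_axioms sub assms(2)])
  show ?thesis
    unfolding positive_form_def shift_form_simps fun_lincomb_eq
  proof (intro conjI ballI allI impI)
    fix u u' v assume u: "u \<in> fdom F" "u' \<in> fdom F" "v \<in> fdom F" and ae: "AE x in M. u x = u' x"
    have "bil F u v = bil F u' v"
      using u ae by (intro positive_form_AE_cong[OF assms(1)]) auto
    moreover have "ip M u v = ip M u' v"
      using u ae sub by (intro ip_AE_cong L2_measurable) auto
    ultimately show "bil F u v + l * ip M u v = bil F u' v + l * ip M u' v" by simp
  next
    fix u v w a b assume "u \<in> fdom F" "v \<in> fdom F" "w \<in> fdom F"
    then show "bil F (a *\<^sub>R u + b *\<^sub>R v) w + l * ip M (a *\<^sub>R u + b *\<^sub>R v) w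
        = a * (bil F u w + l * ip M u w) + b * (bil F v w + l * ip M v w)"
      using S.add_left[of "a *\<^sub>R u" "b *\<^sub>R v" w] S.scale_left[of u w a] S.scale_left[of v w b] by simp
  next
    show "(\<lambda>x. 0) \<in> fdom F" using F.zero_mem by (simp add: zero_fun_def)
  qed (use sub S.sym S.nonneg positive_form_AE_mem[OF assms(1)] in auto)
qed

lemma closed_form_semi_hilbert:
  assumes "closed_form M F"
  shows "semi_hilbert (fdom F) (form1 M F)"
proof -
  have pos: "positive_form M F" using assms by (simp add: closed_form_def)
  interpret semi_inner "fdom F" "form1 M F"
    using positive_form_semi_inner[OF positive_form_shift[OF pos, of 1]] by simp
  show ?thesis
  proof
    fix s :: "nat \<Rightarrow> 'a \<Rightarrow> real"
    assume s: "\<And>n. s n \<in> fdom F"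
      and cau: "\<And>e. e > 0 \<Longrightarrow> \<exists>N. \<forall>i\<ge>N. \<forall>j\<ge>N. sq (form1 M F) (s i - s j) < e"
    have "form_Cauchy (shift_form M F 1) s"
      unfolding form_Cauchy_iff by (intro allI impI cau)
    then have "\<exists>v\<in>fdom F. form_conv (shift_form M F 1) s v"
      using assms s unfolding closed_form_def by blast
    then show "\<exists>v\<in>fdom F. conv s v"
      unfolding form_conv_iff conv_def .
  qed
qed

lemma closed_formI:
  assumes pos: "positive_form M F" and "semi_hilbert (fdom F) (form1 M F)"
  shows "closed_form M F"
proof -
  interpret semi_hilbert "fdom F" "form1 M F" by fact
  show ?thesis
    unfolding closed_form_def form_conv_iff form_Cauchy_iff
  proof (intro conjI pos allI impI)
    fix u :: "nat \<Rightarrow> 'a \<Rightarrow> real"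
    assume "range u \<subseteq> fdom F \<and>
      (\<forall>e>0. \<exists>N. \<forall>i\<ge>N. \<forall>j\<ge>N. sq (form1 M F) (u i - u j) < e)"
    then show "\<exists>v\<in>fdom F. (\<lambda>i. sq (form1 M F) (u i - v)) \<longlonglongrightarrow> 0"
      using complete[of u] unfolding conv_def by auto
  qed
qed

lemma shift_form_null_AE:
  assumes "positive_form M F" "u \<in> fdom F" "l > 0" "bil (shift_form M F l) u u = 0"
  shows "AE x in M. u x = 0"
proof -
  interpret L: semi_inner "L2 M" "ip M" by (rule L2_semi_inner)
  interpret F: semi_inner "fdom F" "bil F" using assms(1) by (rule positive_form_semi_inner)
  have u: "u \<in> L2 M" using assms by (auto intro: positive_form_L2)
  have "l * ip M u u = 0"
    using assms(3,4) F.nonneg[OF assms(2)] L.nonneg[OF u] by (smt (verit) mult_nonneg_nonneg shift_form_simps(2))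
  then show ?thesis
    using ip_null_iff[OF u] \<open>l > 0\<close> by simp
qed

text \<open>
  The graph of \<open>f \<mapsto> (H + 1)\<^sup>-\<^sup>1 f\<close> with its components exchanged; unlike the chosen representatives of
  the values it is a linear space.
\<close>

definition res_graph :: "'a measure \<Rightarrow> 'a form \<Rightarrow> (('a \<Rightarrow> real) \<times> ('a \<Rightarrow> real)) set" where
  "res_graph M F =
     {(u, f). u \<in> fdom F \<and> f \<in> L2 M \<and> (\<forall>v\<in>fdom F. form1 M F u v = ip M f v)}"

lemma res_graph_exists:
  assumes "closed_form M F" "f \<in> L2 M"
  obtains u where "(u, f) \<in> res_graph M F"
proof -
  interpret L: semi_inner "L2 M" "ip M" by (rule L2_semi_inner)
  have pos: "positive_form M F" using assms by (simp add: closed_form_def)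
  interpret F: semi_inner "fdom F" "bil F" using pos by (rule positive_form_semi_inner)
  interpret H: semi_hilbert "fdom F" "form1 M F"
    using assms(1) by (rule closed_form_semi_hilbert)
  note L2 = positive_form_L2[OF pos]
  obtain u where "u \<in> fdom F" "\<And>v. v \<in> fdom F \<Longrightarrow> form1 M F u v = ip M f v"
  proof (rule H.riesz[of "ip M f" "ip M f f"])
    fix x assume x: "x \<in> fdom F"
    have "(ip M f x)\<^sup>2 \<le> ip M f f * ip M x x"
      using assms L2[OF x] by (intro L.cauchy_schwarz)
    also have "\<dots> \<le> ip M f f * form1 M F x x"
      using assms F.nonneg[OF x] by (intro mult_left_mono L.nonneg) auto
    finally show "(ip M f x)\<^sup>2 \<le> ip M f f * form1 M F x x" .
  qed (use assms L2 in \<open>auto simp: L.expand\<close>)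
  then show ?thesis using that assms by (auto simp: res_graph_def)
qed

lemma res_graph_unique:
  assumes "positive_form M F" "(u, f) \<in> res_graph M F" "(u', f') \<in> res_graph M F" "AE x in M. f x = f' x"
  shows "AE x in M. u x = u' x"
proof -
  interpret F: semi_inner "fdom F" "form1 M F"
    using positive_form_semi_inner[OF positive_form_shift[OF assms(1), of 1]] by simp
  have u: "u \<in> fdom F" "u' \<in> fdom F" "f \<in> L2 M" "f' \<in> L2 M"
    using assms by (auto simp: res_graph_def)
  have "ip M f v = ip M f' v" if "v \<in> fdom F" for v
    using u assms(4) positive_form_L2[OF assms(1) that] by (intro ip_AE_cong L2_measurable) auto
  then have "form1 M F u v = form1 M F u' v" if "v \<in> fdom F" for v
    using assms(2,3) that unfolding res_graph_def by auto
  from this[of "u - u'"] have "sq (form1 M F) (u - u') = 0"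
    using F.diff_left[of u u' "u - u'"] u F.diff_mem by auto
  then have "AE x in M. (u - u') x = 0"
    by (intro shift_form_null_AE[OF assms(1) F.diff_mem[OF u(1,2)], of 1]) simp
  then show ?thesis by simp
qed

lemma resolvent1_graph:
  assumes "closed_form M F" "f \<in> L2 M"
  shows "(resolvent1 M F f, f) \<in> res_graph M F"
proof -
  interpret L: semi_inner "L2 M" "ip M" by (rule L2_semi_inner)
  have pos: "positive_form M F" using assms by (simp add: closed_form_def)
  note L2 = positive_form_L2[OF pos]
  have iff: "(\<exists>g. (u, g) \<in> assoc_op M F \<and> (AE x in M. g x + u x = f x)) \<longleftrightarrow> (u, f) \<in> res_graph M F" for u
  proof
    assume "\<exists>g. (u, g) \<in> assoc_op M F \<and> (AE x in M. g x + u x = f x)"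
    then obtain g where g: "(u, g) \<in> assoc_op M F" "AE x in M. (g + u) x = f x"
      by auto
    then have u: "u \<in> fdom F" "g \<in> L2 M" by (auto simp: assoc_op_def)
    have "form1 M F u v = ip M f v" if v: "v \<in> fdom F" for v
    proof -
      have "form1 M F u v = ip M (g + u) v"
        using g v u L2 by (simp add: assoc_op_def L.expand)
      also have "\<dots> = ip M f v"
        using g u L2 v assms by (intro ip_AE_cong L2_measurable L.add_mem) auto
      finally show ?thesis .
    qed
    then show "(u, f) \<in> res_graph M F" using u assms by (auto simp: res_graph_def)
  next
    assume g: "(u, f) \<in> res_graph M F"
    then have u: "u \<in> fdom F" "u \<in> L2 M" using L2 by (auto simp: res_graph_def)
    have "bil F u v = ip M (f - u) v" if v: "v \<in> fdom F" for v
    proof -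
      have "bil F u v + ip M u v = ip M f v" using g v by (auto simp: res_graph_def)
      then show ?thesis using u assms L2[OF v] by (simp add: L.diff_left)
    qed
    then have "(u, f - u) \<in> assoc_op M F"
      using g u assms by (auto simp: assoc_op_def)
    then show "\<exists>g. (u, g) \<in> assoc_op M F \<and> (AE x in M. g x + u x = f x)"
      by (intro exI[of _ "f - u"]) auto
  qed
  show ?thesis
    unfolding resolvent1_def iff
    using res_graph_exists[OF assms] by (metis (mono_tags, lifting) someI_ex)
qed

lemma resolvent1_mem:
  assumes "closed_form M F" "f \<in> L2 M"
  shows "resolvent1 M F f \<in> fdom F" "resolvent1 M F f \<in> L2 M"
  using resolvent1_graph[OF assms] assms(1) positive_form_L2[of M F]
  by (auto simp: res_graph_def closed_form_def)

lemma resolvent1_AE_eqI: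
  assumes "closed_form M F" "(u, f) \<in> res_graph M F"
  shows "AE x in M. resolvent1 M F f x = u x"
  using res_graph_unique[OF _ resolvent1_graph assms(2)] assms
  by (auto simp: closed_form_def res_graph_def)

lemma res_graph_subspace:
  assumes "positive_form M F"
  shows "subspace (res_graph M F)"
proof -
  interpret L: semi_inner "L2 M" "ip M" by (rule L2_semi_inner)
  interpret F: semi_inner "fdom F" "form1 M F"
    using positive_form_semi_inner[OF positive_form_shift[OF assms(1), of 1]] by simp
  note L2 = positive_form_L2[OF assms]
  show ?thesis
  proof (rule subspaceI)
    show "0 \<in> res_graph M F"
      unfolding res_graph_def zero_prod_def using F.zero_left L2 by auto
    show "x + y \<in> res_graph M F" if "x \<in> res_graph M F" "y \<in> res_graph M F" for x y
      using that L2 unfolding res_graph_def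
      by (auto simp del: shift_form_simps(2) simp: L.add_left F.add_left)
    show "c *\<^sub>R x \<in> res_graph M F" if "x \<in> res_graph M F" for x c
      using that L2 unfolding res_graph_def
      by (auto simp del: shift_form_simps(2) simp: L.scale_left F.scale_left)
  qed
qed

lemma res_graph_contraction:
  assumes "positive_form M F" "(u, f) \<in> res_graph M F"
  shows "ip M u u \<le> ip M f f"
proof -
  interpret L: semi_inner "L2 M" "ip M" by (rule L2_semi_inner)
  interpret F: semi_inner "fdom F" "bil F" using assms(1) by (rule positive_form_semi_inner)
  have u: "u \<in> fdom F" "f \<in> L2 M" "u \<in> L2 M"
    using assms(2) positive_form_L2[OF assms(1)] by (auto simp: res_graph_def)
  have "bil F u u + ip M u u = ip M f u" using assms(2) u by (auto simp: res_graph_def)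
  then show ?thesis
    using L.young[OF u(2,3)] F.nonneg[OF u(1)] by linarith
qed

text \<open>
  If \<open>z\<close> is orthogonal to the operator domain in the form norm, pairing it with the resolvent of \<open>z\<close>
  itself gives \<open>\<langle>z, z\<rangle> = 0\<close>.
\<close>

lemma operator_domain_core:
  assumes "closed_form M F" "v \<in> fdom F"
  obtains s where "\<And>n::nat. s n \<in> res_graph M F"
    "(\<lambda>n. sq (form1 M F) (fst (s n) - v)) \<longlonglongrightarrow> 0"
proof -
  interpret L: semi_inner "L2 M" "ip M" by (rule L2_semi_inner)
  have pos: "positive_form M F" using assms by (simp add: closed_form_def)
  interpret H: semi_hilbert "fdom F" "form1 M F"
    using assms(1) by (rule closed_form_semi_hilbert)
  have gr: "fst x \<in> fdom F" if "x \<in> res_graph M F" for x using that by (auto simp: res_graph_def)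
  obtain s w where s: "\<And>n. s n \<in> res_graph M F" and w: "w \<in> fdom F" "H.conv (\<lambda>n. fst (s n)) w"
    and orth: "\<And>x. x \<in> res_graph M F \<Longrightarrow> form1 M F (v - w) (fst x) = 0"
    by (rule H.projection[OF res_graph_subspace[OF pos], of fst v])
      (use assms gr in auto)
  have vw: "v - w \<in> fdom F" using assms w by (intro H.diff_mem)
  have vwL: "v - w \<in> L2 M" using positive_form_L2[OF pos vw] .
  obtain g where g: "(g, v - w) \<in> res_graph M F" using res_graph_exists[OF assms(1) vwL] .
  then have "ip M (v - w) (v - w) = form1 M F g (v - w)"
    using vw unfolding res_graph_def by auto
  also have "\<dots> = 0"
    using orth[OF g] H.sym[OF vw gr[OF g]] by simp
  finally have "AE x in M. (v - w) x = 0 x"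
    using ip_null_iff[OF vwL] by simp
  then have "form1 M F (v - w) (v - w) = form1 M F 0 0"
    using vw by (intro positive_form_AE_cong[OF positive_form_shift[OF pos]]) auto
  also have "\<dots> = 0" by (rule H.zero_left) simp
  finally have null: "form1 M F (w - v) (w - v) = 0"
    using H.sq_diff_commute[OF w(1) assms(2)] by simp
  have "(\<lambda>n. sq (form1 M F) (fst (s n) - v)) \<longlonglongrightarrow> 0"
  proof (rule tendsto_null_squeeze)
    fix n
    show "sq (form1 M F) (fst (s n) - v) \<le> 2 * sq (form1 M F) (fst (s n) - w) + 0 * 0"
      using H.sq_triangle[OF gr[OF s] w(1) assms(2), of n] null by simp
    show "0 \<le> sq (form1 M F) (fst (s n) - v)" by (intro H.nonneg H.diff_mem gr s assms(2))
  qed (use w(2) in \<open>auto simp: H.conv_def\<close>)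
  with s show ?thesis using that by blast
qed

section \<open>Mosco convergence and convergence of resolvents\<close>

text \<open>
  Stage \<open>n\<close> meets the strongest requirement \<open>k \<le> n\<close> that can be met at this stage; each fixed \<open>k\<close> is
  among them from some stage on.
\<close>

lemma diagonal_choice:
  fixes P :: "nat \<Rightarrow> nat \<Rightarrow> 'b \<Rightarrow> bool"
  assumes ev: "\<And>k. \<forall>\<^sub>F n in sequentially. \<exists>u. P k n u"
    and anti: "\<And>k k' n u. k \<le> k' \<Longrightarrow> P k' n u \<Longrightarrow> P k n u"
  obtains u where "\<And>k. \<forall>\<^sub>F n in sequentially. P k n (u n)"
proof -
  define S where "S n = {k. k \<le> n \<and> (\<exists>u. P k n u)}" for n
  define u where "u n = (SOME u. P (Max (S n)) n u)" for n
  have fin: "finite (S n)" for n unfolding S_def by simp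
  have "\<forall>\<^sub>F n in sequentially. P k n (u n)" for k
    using ev[of k] eventually_ge_at_top[of k]
  proof eventually_elim
    case (elim n)
    then have k: "k \<in> S n" by (simp add: S_def)
    then have "Max (S n) \<in> S n" by (intro Max_in fin) auto
    then have "P (Max (S n)) n (u n)"
      unfolding u_def S_def by (auto intro: someI_ex)
    moreover have "k \<le> Max (S n)" using k by (intro Max_ge fin)
    ultimately show ?case using anti by blast
  qed
  then show ?thesis using that by blast
qed

text \<open>
  The lower bound in Mosco convergence speaks about whole sequences; subsequences are brought under it
  by inserting their weak limit at the missing places.
\<close>

lemma weak_conv_subsequence_fill:
  assumes "strict_mono (r :: nat \<Rightarrow> nat)" "weak_conv M (\<lambda>j. x (r j)) y"
  shows "weak_conv M (\<lambda>n. if n \<in> range r then x n else y) y"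
  unfolding weak_conv_def
proof
  fix g assume g: "g \<in> L2 M"
  show "(\<lambda>n. ip M (if n \<in> range r then x n else y) g) \<longlonglongrightarrow> ip M y g"
  proof (rule LIMSEQ_I)
    fix e :: real assume e: "e > 0"
    obtain N where N: "\<And>j. j \<ge> N \<Longrightarrow> norm (ip M (x (r j)) g - ip M y g) < e"
      using assms(2) g e unfolding weak_conv_def by (metis LIMSEQ_D)
    have "norm (ip M (if n \<in> range r then x n else y) g - ip M y g) < e" if n: "n \<ge> r N" for n
    proof (cases "n \<in> range r")
      case True
      then obtain j where j: "n = r j" by auto
      then have "j \<ge> N" using n assms(1) by (simp add: strict_mono_less_eq)
      then show ?thesis using N[of j] j by simp
    next
      case False then show ?thesis using e by simp
    qed
    then show "\<exists>N. \<forall>n\<ge>N. norm (ip M (if n \<in> range r then x n else y) g - ip M y g) < e" by blast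
  qed
qed

text \<open>
  The difference to the product with the fixed limit \<open>w'\<close> is controlled by the norms of \<open>v\<^sub>n\<close>, which are
  bounded by the uniform boundedness principle.
\<close>

lemma tendsto_weak_strong:
  fixes v w :: "nat \<Rightarrow> 'a \<Rightarrow> real"
  assumes v: "\<And>n. v n \<in> L2 M" and w: "\<And>n. w n \<in> L2 M" and L2: "v' \<in> L2 M" "w' \<in> L2 M"
    and weak: "weak_conv M v v'" and strong: "(\<lambda>n. sq (ip M) (w n - w')) \<longlonglongrightarrow> 0"
  shows "(\<lambda>n. ip M (v n) (w n)) \<longlonglongrightarrow> ip M v' w'"
proof -
  interpret semi_hilbert "L2 M" "ip M" by (rule L2_semi_hilbert)
  obtain B where B: "\<And>n. ip M (v n) (v n) \<le> B"
  proof (rule uniform_boundedness[OF v])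
    fix f assume f: "f \<in> L2 M"
    then have "(\<lambda>n. ip M (v n) f) \<longlonglongrightarrow> ip M v' f"
      using weak unfolding weak_conv_def by blast
    then have "Bseq (\<lambda>n. ip M (v n) f)" by (rule convergent_imp_Bseq[OF convergentI])
    then show "\<exists>B. \<forall>n. \<bar>ip M (v n) f\<bar> \<le> B" by (auto simp: Bseq_def)
  qed blast
  have "(\<lambda>n. sqrt B * sqrt (sq (ip M) (w n - w'))) \<longlonglongrightarrow> sqrt B * sqrt 0"
    by (intro tendsto_intros strong)
  then have lim: "(\<lambda>n. sqrt B * sqrt (sq (ip M) (w n - w'))) \<longlonglongrightarrow> 0" by simp
  have "(\<lambda>n. ip M (v n) (w n - w')) \<longlonglongrightarrow> 0"
  proof (rule Lim_null_comparison[OF eventuallyI lim])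
    fix n
    have "\<bar>ip M (v n) (w n - w')\<bar> \<le> sqrt (ip M (v n) (v n)) * sqrt (sq (ip M) (w n - w'))"
      using v w L2 by (intro abs_le_sqrt) auto
    also have "\<dots> \<le> sqrt B * sqrt (sq (ip M) (w n - w'))"
      by (rule mult_right_mono) (simp_all add: B nonneg w L2)
    finally show "norm (ip M (v n) (w n - w')) \<le> sqrt B * sqrt (sq (ip M) (w n - w'))" by simp
  qed
  moreover have "(\<lambda>n. ip M (v n) w') \<longlonglongrightarrow> ip M v' w'"
    using weak L2 unfolding weak_conv_def by blast
  ultimately have "(\<lambda>n. ip M (v n) (w n - w') + ip M (v n) w') \<longlonglongrightarrow> 0 + ip M v' w'"
    by (rule tendsto_add)
  then show ?thesis using v w L2 by (simp add: diff_right)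
qed

lemma limsup_le_of_eventually_le:
  fixes f :: "nat \<Rightarrow> ereal"
  assumes "\<And>k. \<forall>\<^sub>F n in sequentially. f n \<le> ereal (c + 1 / real (Suc k))"
  shows "limsup f \<le> ereal c"
proof -
  have *: "limsup f \<le> ereal (c + 1 / real (Suc k))" for k
    using assms[of k] by (rule Limsup_bounded)
  have "(\<lambda>k. c + 1 / real (Suc k)) \<longlonglongrightarrow> c + 0"
    by (intro tendsto_intros LIMSEQ_Suc[OF lim_1_over_n])
  then have "(\<lambda>k. ereal (c + 1 / real (Suc k))) \<longlonglongrightarrow> ereal c"
    by (simp add: tendsto_ereal)
  then show ?thesis by (rule LIMSEQ_le_const) (use * in auto)
qed

text \<open>
  From the resolvents to the forms.  For the lower bound in Mosco convergence one tests
  \<open>a\<^sub>n[v\<^sub>n] \<ge> 2 a\<^sub>n(v\<^sub>n, z\<^sub>n) - a\<^sub>n[z\<^sub>n]\<close> with the resolvents \<open>z\<^sub>n\<close> of a fixed \<open>f\<close>: then \<open>a\<^sub>n(v\<^sub>n, z\<^sub>n)\<close> is the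
  product of the weakly convergent \<open>v\<^sub>n\<close> and the strongly convergent \<open>f - z\<^sub>n\<close>.  The resulting
  inequality bounds \<open>f \<mapsto> \<langle>v, f\<rangle>\<close> by the form norm of the resolvent of \<open>f\<close>, so by Riesz the weak limit
  \<open>v\<close> lies in the form domain.
\<close>

locale resolvent_convergence =
  fixes M :: "'a measure" and a :: "nat \<Rightarrow> 'a form" and b :: "'a form"
  assumes closed_a: "\<And>n. closed_form M (a n)" and closed_b: "closed_form M b"
    and res_conv: "\<And>f. f \<in> L2 M \<Longrightarrow>
      strong_conv M (\<lambda>n. resolvent1 M (a n) f) (resolvent1 M b f) sequentially"
begin

lemma pos: "positive_form M (a n)" "positive_form M b"
  using closed_a closed_b by (auto simp: closed_form_def)

lemma graph_limits:
  assumes "(x, f) \<in> res_graph M b"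
  defines "z \<equiv> \<lambda>n. resolvent1 M (a n) f"
  shows "z n \<in> fdom (a n)" "z n \<in> L2 M" "x \<in> L2 M" "f \<in> L2 M" "x \<in> fdom b"
    and "(\<lambda>n. sq (ip M) (z n - x)) \<longlonglongrightarrow> 0"
    and "v \<in> fdom (a n) \<Longrightarrow> bil (a n) (z n) v = ip M (f - z n) v"
    and "(\<lambda>n. bil (a n) (z n) (z n)) \<longlonglongrightarrow> bil b x x"
    and "v \<in> fdom b \<Longrightarrow> bil b x v = ip M (f - x) v"
proof -
  interpret L: semi_hilbert "L2 M" "ip M" by (rule L2_semi_hilbert)
  show f: "f \<in> L2 M" and xb: "x \<in> fdom b" and x: "x \<in> L2 M"
    using assms positive_form_L2[OF pos(2)] by (auto simp: res_graph_def)
  show z: "z n \<in> fdom (a n)" "z n \<in> L2 M" for n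
    unfolding z_def using resolvent1_mem[OF closed_a f] by auto
  have R: "resolvent1 M b f \<in> L2 M" using resolvent1_mem[OF closed_b f] by simp
  show zx: "(\<lambda>n. sq (ip M) (z n - x)) \<longlonglongrightarrow> 0"
    unfolding z_def
    by (rule strong_conv_versions[THEN iffD1, rotated -1, OF res_conv[OF f]])
      (use z R x resolvent1_AE_eqI[OF closed_b assms(1)] in \<open>simp_all add: z_def\<close>)
  show bz: "bil (a n) (z n) v = ip M (f - z n) v" if v: "v \<in> fdom (a n)" for n v
  proof -
    have "bil (a n) (z n) v + ip M (z n) v = ip M f v"
      using resolvent1_graph[OF closed_a f, of n] v by (auto simp: res_graph_def z_def)
    then show ?thesis using f z positive_form_L2[OF pos(1) v] by (simp add: L.diff_left)
  qed
  show bx: "bil b x v = ip M (f - x) v" if v: "v \<in> fdom b" for v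
  proof -
    have "bil b x v + ip M x v = ip M f v"
      using assms(1) v by (auto simp: res_graph_def)
    then show ?thesis using f x positive_form_L2[OF pos(2) v] by (simp add: L.diff_left)
  qed
  have "(\<lambda>n. ip M (z n) f - ip M (z n) (z n)) \<longlonglongrightarrow> ip M x f - ip M x x"
    by (intro tendsto_diff L.tendsto_left L.tendsto_sq) (use z x f zx in \<open>auto simp: L.conv_def\<close>)
  moreover have "ip M (z n) f - ip M (z n) (z n) = bil (a n) (z n) (z n)" for n
    using bz[OF z(1)] f z by (simp add: L.diff_left L.sym[of f])
  moreover have "ip M x f - ip M x x = bil b x x"
    using bx[OF xb] f x by (simp add: L.diff_left L.sym[of f])
  ultimately show "(\<lambda>n. bil (a n) (z n) (z n)) \<longlonglongrightarrow> bil b x x" by simp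
qed

text \<open>
  For \<open>v\<close> in the domain of the limit operator, say \<open>v = (H + 1)\<^sup>-\<^sup>1 f\<close>, the resolvents of \<open>f\<close> along the
  sequence are a recovery sequence; the other \<open>v\<close> are approximated by such elements in the form norm.
\<close>

lemma recovery:
  assumes v: "v \<in> fdom b"
  obtains u where "\<And>n. u n \<in> L2 M" "strong_conv M u v sequentially"
    "limsup (\<lambda>n. ext_form (a n) (u n)) \<le> ereal (bil b v v)"
proof -
  interpret L: semi_hilbert "L2 M" "ip M" by (rule L2_semi_hilbert)
  interpret B: semi_inner "fdom b" "bil b" using pos(2) by (rule positive_form_semi_inner)
  have vL: "v \<in> L2 M" using positive_form_L2[OF pos(2) v] .
  obtain s where s: "\<And>n. s n \<in> res_graph M b"
    and sv: "(\<lambda>n. sq (form1 M b) (fst (s n) - v)) \<longlonglongrightarrow> 0"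
    using operator_domain_core[OF closed_b v] by blast
  have sm: "fst (s n) \<in> fdom b" "fst (s n) \<in> L2 M" for n
    using graph_limits(3,5)[of "fst (s n)" "snd (s n)"] s[of n] by auto
  have sv1: "(\<lambda>n. sq (bil b) (fst (s n) - v)) \<longlonglongrightarrow> 0"
    by (rule Lim_null_comparison[OF eventuallyI sv])
      (use B.nonneg[OF B.diff_mem[OF sm(1) v]] L.nonneg[OF L.diff_mem[OF sm(2) vL]] in auto)
  have sv2: "(\<lambda>n. sq (ip M) (fst (s n) - v)) \<longlonglongrightarrow> 0"
    by (rule Lim_null_comparison[OF eventuallyI sv])
      (use B.nonneg[OF B.diff_mem[OF sm(1) v]] L.nonneg[OF L.diff_mem[OF sm(2) vL]] in auto)
  have sb: "(\<lambda>n. sq (bil b) (fst (s n))) \<longlonglongrightarrow> bil b v v"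
    by (rule B.tendsto_sq) (use sm v sv1 in \<open>auto simp: B.conv_def\<close>)
  define P where "P k n u \<longleftrightarrow> u \<in> L2 M \<and> ip M (u - v) (u - v) \<le> 1 / real (Suc k)
      \<and> ext_form (a n) u \<le> ereal (bil b v v + 1 / real (Suc k))" for k n u
  obtain u where u: "\<And>k. \<forall>\<^sub>F n in sequentially. P k n (u n)"
  proof (rule diagonal_choice[of P])
    fix k
    define e where "e = 1 / real (Suc k)"
    have e: "e > 0" by (simp add: e_def)
    have "\<forall>\<^sub>F j in sequentially. sq (ip M) (fst (s j) - v) < e / 4"
      "\<forall>\<^sub>F j in sequentially. sq (bil b) (fst (s j)) < bil b v v + e / 2"
      using order_tendstoD(2)[OF sv2, of "e/4"] order_tendstoD(2)[OF sb, of "bil b v v + e / 2"] e by auto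
    then have "\<forall>\<^sub>F j in sequentially. sq (ip M) (fst (s j) - v) < e / 4 \<and>
       sq (bil b) (fst (s j)) < bil b v v + e / 2"
      by (rule eventually_conj)
    then obtain j where j: "sq (ip M) (fst (s j) - v) < e / 4"
       "sq (bil b) (fst (s j)) < bil b v v + e / 2"
      unfolding eventually_sequentially by blast
    obtain x f where xf: "s j = (x, f)" by (cases "s j")
    have g: "(x, f) \<in> res_graph M b" using s[of j] xf by simp
    define z where "z n = resolvent1 M (a n) f" for n
    note G = graph_limits[OF g, folded z_def]
    have "\<forall>\<^sub>F n in sequentially. sq (ip M) (z n - x) < e / 4"
      using order_tendstoD(2)[OF G(6), of "e/4"] e by auto
    moreover have "\<forall>\<^sub>F n in sequentially. bil (a n) (z n) (z n) < bil b x x + e / 2"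
      using order_tendstoD(2)[OF G(8), of "bil b x x + e / 2"] e by auto
    ultimately show "\<forall>\<^sub>F n in sequentially. \<exists>u. P k n u"
    proof eventually_elim
      case (elim n)
      have "sq (ip M) (z n - v) \<le> 2 * sq (ip M) (z n - x) + 2 * ip M (x - v) (x - v)"
        using G vL by (intro L.sq_triangle) auto
      also have "\<dots> \<le> e" using elim(1) j(1) xf by simp
      finally have 1: "sq (ip M) (z n - v) \<le> e" .
      have "ext_form (a n) (z n) = ereal (bil (a n) (z n) (z n))"
        using G(1) by (simp add: ext_form_def)
      also have "\<dots> \<le> ereal (bil b v v + e)"
        using elim(2) j(2) xf by simp
      finally have "P k n (z n)"
        using 1 G(2) unfolding P_def e_def by blast
      then show ?case by blast
    qed
  next
    fix k k' n u assume "k \<le> (k'::nat)" "P k' n u"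
    moreover from this have "1 / real (Suc k') \<le> 1 / real (Suc k)" by (intro divide_left_mono) auto
    ultimately show "P k n u"
      unfolding P_def by (meson add_left_mono ereal_less_eq(3) order_trans)
  qed blast
  define u' where "u' n = (if u n \<in> L2 M then u n else v)" for n
  have "\<forall>\<^sub>F n in sequentially. u n \<in> L2 M"
    using u[of 0] by eventually_elim (simp add: P_def)
  then have u': "\<forall>\<^sub>F n in sequentially. P k n (u' n)" for k
    using u[of k] by eventually_elim (simp add: u'_def)
  have u'L: "u' n \<in> L2 M" for n using vL by (simp add: u'_def)
  have "(\<lambda>n. sq (ip M) (u' n - v)) \<longlonglongrightarrow> 0"
  proof (rule order_tendstoI)
    fix c :: real assume "c < 0"
    then show "\<forall>\<^sub>F n in sequentially. c < sq (ip M) (u' n - v)"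
      using L.nonneg[OF L.diff_mem[OF u'L vL]] by (intro eventuallyI) (meson less_le_trans)
  next
    fix c :: real assume "c > 0"
    then obtain k where k: "1 / real (Suc k) < c" using nat_approx_posE by blast
    show "\<forall>\<^sub>F n in sequentially. sq (ip M) (u' n - v) < c"
      using u'[of k] by eventually_elim (use k in \<open>auto simp: P_def\<close>)
  qed
  then have 1: "strong_conv M u' v sequentially"
    using u'L vL by (simp add: strong_conv_iff)
  have 2: "limsup (\<lambda>n. ext_form (a n) (u' n)) \<le> ereal (bil b v v)"
  proof (rule limsup_le_of_eventually_le)
    show "\<forall>\<^sub>F n in sequentially. ext_form (a n) (u' n) \<le> ereal (bil b v v + 1 / real (Suc k))" for k
      using u'[of k] by eventually_elim (simp add: P_def)
  qed
  show ?thesis using that[OF u'L 1 2] .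
qed

lemma lower_bound:
  assumes u: "\<And>n. u n \<in> L2 M" and v: "v \<in> L2 M" and weak: "weak_conv M u v"
  shows "ext_form b v \<le> liminf (\<lambda>n. ext_form (a n) (u n))"
proof (cases "liminf (\<lambda>n. ext_form (a n) (u n)) = \<infinity>")
  case False
  interpret L: semi_hilbert "L2 M" "ip M" by (rule L2_semi_hilbert)
  interpret B: semi_inner "fdom b" "bil b" using pos(2) by (rule positive_form_semi_inner)
  interpret H: semi_hilbert "fdom b" "form1 M b"
    using closed_b by (rule closed_form_semi_hilbert)
  have "0 \<le> ext_form (a n) x" for n x
    using semi_inner.nonneg[OF positive_form_semi_inner[OF pos(1)[of n]], of x] by (simp add: ext_form_def)
  then have "0 \<le> liminf (\<lambda>n. ext_form (a n) (u n))"
    by (intro Liminf_bounded eventuallyI)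
  then obtain c where c: "liminf (\<lambda>n. ext_form (a n) (u n)) = ereal c" "c \<ge> 0"
    using False by (cases "liminf (\<lambda>n. ext_form (a n) (u n))") auto
  have key: "2 * ip M v (f - x) - bil b x x \<le> c" if g: "(x, f) \<in> res_graph M b" for x f
  proof -
    define z where "z n = resolvent1 M (a n) f" for n
    note G = graph_limits[OF g, folded z_def]
    have fz: "(\<lambda>n. sq (ip M) ((f - z n) - (f - x))) \<longlonglongrightarrow> 0"
      using G(6) L.sq_diff_commute[OF G(2) G(3)] by (simp add: algebra_simps)
    have "(\<lambda>n. 2 * ip M (u n) (f - z n) - bil (a n) (z n) (z n)) \<longlonglongrightarrow> 2 * ip M v (f - x) - bil b x x"
      by (intro tendsto_intros tendsto_weak_strong G(8) fz weak)
        (use u v G in auto)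
    then have lim: "(\<lambda>n. ereal (2 * ip M (u n) (f - z n) - bil (a n) (z n) (z n)))
        \<longlonglongrightarrow> ereal (2 * ip M v (f - x) - bil b x x)"
      by (rule tendsto_ereal)
    have le: "ereal (2 * ip M (u n) (f - z n) - bil (a n) (z n) (z n)) \<le> ext_form (a n) (u n)" for n
    proof (cases "u n \<in> fdom (a n)")
      case True
      interpret A: semi_inner "fdom (a n)" "bil (a n)" using pos(1) by (rule positive_form_semi_inner)
      have "bil (a n) (z n) (u n) = ip M (u n) (f - z n)"
        using G(7)[OF True] G(2,4) u L.sym[of "f - z n" "u n"] by auto
      then have "2 * ip M (u n) (f - z n) - bil (a n) (z n) (z n) \<le> bil (a n) (u n) (u n)"
        using A.young[OF G(1) True] by simp
      then show ?thesis using True by (simp add: ext_form_def)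
    qed (simp add: ext_form_def)
    have "ereal (2 * ip M v (f - x) - bil b x x) = liminf (\<lambda>n. ereal (2 * ip M (u n) (f - z n) - bil (a n) (z n) (z n)))"
      using lim_imp_Liminf[OF trivial_limit_sequentially lim] by simp
    also have "\<dots> \<le> ereal c"
      unfolding c(1)[symmetric] by (intro Liminf_mono eventuallyI le)
    finally show ?thesis by simp
  qed
  \<comment> \<open>Replacing \<open>(x, f)\<close> by its multiples makes the inequality homogeneous.\<close>
  have sq: "(ip M v (f - x))\<^sup>2 \<le> c * bil b x x" if g: "(x, f) \<in> res_graph M b" for x f
  proof -
    define p q where "p = ip M v (f - x)" and "q = bil b x x"
    have xf: "x \<in> L2 M" "f \<in> L2 M" "x \<in> fdom b" using graph_limits(3,4,5)[OF g] by auto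
    have q0: "q \<ge> 0" unfolding q_def using xf by (intro B.nonneg)
    have k: "2 * t * p - t\<^sup>2 * q \<le> c" for t
    proof -
      have "t *\<^sub>R (x, f) \<in> res_graph M b"
        using g res_graph_subspace[OF pos(2)] subspace_scale by blast
      then have "(t *\<^sub>R x, t *\<^sub>R f) \<in> res_graph M b" by simp
      from key[OF this] show ?thesis
        using xf v by (simp add: p_def q_def B.sq_scale L.expand algebra_simps)
    qed
    have "p\<^sup>2 \<le> c * q"
    proof (cases "q = 0")
      case True
      have "p = 0"
      proof (rule ccontr)
        assume p: "p \<noteq> 0"
        have "2 * ((c + 1) / (2 * p)) * p \<le> c" using k[of "(c + 1) / (2 * p)"] True by simp
        then show False using p by simp
      qed
      then show ?thesis using True by simp
    next
      case False
      then have "q > 0" using q0 by simp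
      moreover have "2 * (p / q) * p - (p / q)\<^sup>2 * q = p\<^sup>2 / q"
        using False by (simp add: power2_eq_square)
      ultimately have "p\<^sup>2 / q \<le> c" using k[of "p / q"] by simp
      then show ?thesis using \<open>q > 0\<close> by (simp add: field_simps)
    qed
    then show ?thesis by (simp add: p_def q_def)
  qed
  have bd: "(ip M v (snd s))\<^sup>2 \<le> (2 * c + 2 * ip M v v) * form1 M b (fst s) (fst s)"
    if g: "s \<in> res_graph M b" for s
  proof -
    obtain x f where s: "s = (x, f)" by (cases s)
    have g: "(x, f) \<in> res_graph M b" using g s by simp
    have xf: "x \<in> L2 M" "f \<in> L2 M" "x \<in> fdom b" using graph_limits(3,4,5)[OF g] by auto
    have "(ip M v f)\<^sup>2 = (ip M v (f - x) + ip M v x)\<^sup>2"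
      using xf v by (simp add: L.diff_right)
    also have "\<dots> \<le> 2 * (ip M v (f - x))\<^sup>2 + 2 * (ip M v x)\<^sup>2"
      using sum_squares_bound[of "ip M v (f - x)" "ip M v x"] by (simp add: power2_sum)
    also have "\<dots> \<le> 2 * (c * bil b x x) + 2 * (ip M v v * ip M x x)"
      using sq[OF g] L.cauchy_schwarz[OF v xf(1)] by simp
    also have "\<dots> \<le> (2 * c + 2 * ip M v v) * (bil b x x + ip M x x)"
      using c(2) L.nonneg[OF v] L.nonneg[OF xf(1)] B.nonneg[OF xf(3)] by (simp add: algebra_simps)
    finally show ?thesis by (simp add: s)
  qed
  have gr: "fst s \<in> fdom b" "snd s \<in> L2 M" if "s \<in> res_graph M b" for s
    using that by (auto simp: res_graph_def)
  \<comment> \<open>Represent \<open>f \<mapsto> \<langle>v, f\<rangle>\<close> in the form domain; the representing element is \<open>v\<close> itself.\<close>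
  obtain w where w: "w \<in> fdom b"
    and wg: "\<And>s. s \<in> res_graph M b \<Longrightarrow> form1 M b w (fst s) = ip M v (snd s)"
    by (rule H.riesz_image[OF res_graph_subspace[OF pos(2)], of fst "\<lambda>s. ip M v (snd s)"
          "2 * c + 2 * ip M v v"])
      (use gr v bd in \<open>auto simp: L.expand\<close>)
  have wL: "w \<in> L2 M" using positive_form_L2[OF pos(2) w] .
  have "ip M (w - v) (w - v) = 0"
  proof -
    obtain g where g: "(g, w - v) \<in> res_graph M b"
      using res_graph_exists[OF closed_b L.diff_mem[OF wL v]] .
    have "ip M v (w - v) = form1 M b w g" using wg[OF g] by simp
    also have "\<dots> = form1 M b g w" using H.sym[OF w] gr(1)[OF g] by simp
    also have "\<dots> = ip M (w - v) w" using g w by (simp add: res_graph_def)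
    finally show ?thesis using wL v by (simp add: L.diff_left L.diff_right L.sym[of v w])
  qed
  then have "AE x in M. v x = w x" using ip_diff_null_iff[OF wL v] by auto
  then have vb: "v \<in> fdom b"
    by (intro positive_form_AE_mem[OF pos(2) w] L2_measurable v)
  \<comment> \<open>Now \<open>v\<close> is a limit of operator domain elements \<open>x\<close>, for which \<open>key\<close> reads \<open>2 b(x, v) - b[x] \<le> c\<close>.\<close>
  obtain s where s: "\<And>n::nat. s n \<in> res_graph M b"
    and sv: "(\<lambda>n. sq (form1 M b) (fst (s n) - v)) \<longlonglongrightarrow> 0"
    using operator_domain_core[OF closed_b vb] by blast
  have sv1: "(\<lambda>n. sq (bil b) (fst (s n) - v)) \<longlonglongrightarrow> 0"
    by (rule Lim_null_comparison[OF eventuallyI sv])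
      (use B.nonneg[OF B.diff_mem[OF gr(1)[OF s] vb]] L.nonneg[OF L.diff_mem[OF positive_form_L2[OF pos(2) gr(1)[OF s]] v]] in auto)
  have "(\<lambda>n. 2 * bil b (fst (s n)) v - sq (bil b) (fst (s n))) \<longlonglongrightarrow> 2 * bil b v v - bil b v v"
    by (intro tendsto_intros B.tendsto_left B.tendsto_sq) (use gr s vb sv1 in \<open>auto simp: B.conv_def\<close>)
  moreover have "2 * bil b (fst (s n)) v - sq (bil b) (fst (s n)) \<le> c" for n
  proof -
    obtain x f where xf: "s n = (x, f)" by (cases "s n")
    have g: "(x, f) \<in> res_graph M b" using s[of n] xf by simp
    have "bil b x v = ip M v (f - x)"
      using graph_limits(9)[OF g vb] graph_limits(3,4)[OF g] v L.sym[of "f - x" v] by auto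
    then show ?thesis using key[OF g] xf by simp
  qed
  ultimately have "bil b v v \<le> c"
    using LIMSEQ_le_const2[of "\<lambda>n. 2 * bil b (fst (s n)) v - sq (bil b) (fst (s n))" "2 * bil b v v - bil b v v" c]
    by auto
  then show ?thesis using vb c(1) by (simp add: ext_form_def)
qed simp

lemma Mosco: "Mosco_conv M a b"
  unfolding Mosco_conv_def
proof (intro conjI allI impI ballI)
  fix u v assume "range u \<subseteq> L2 M \<and> v \<in> L2 M \<and> weak_conv M u v"
  then show "ext_form b v \<le> liminf (\<lambda>n. ext_form (a n) (u n))"
    by (intro lower_bound) auto
next
  fix v assume v: "v \<in> L2 M"
  show "\<exists>u. range u \<subseteq> L2 M \<and> strong_conv M u v sequentially \<and>
      limsup (\<lambda>n. ext_form (a n) (u n)) \<le> ext_form b v"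
  proof (cases "v \<in> fdom b")
    case True
    obtain u where "\<And>n. u n \<in> L2 M" "strong_conv M u v sequentially"
      "limsup (\<lambda>n. ext_form (a n) (u n)) \<le> ereal (bil b v v)"
      using recovery[OF True] by blast
    then show ?thesis using True by (intro exI[of _ u]) (auto simp: ext_form_def)
  next
    case False
    have "strong_conv M (\<lambda>n. v) v sequentially"
      by (simp add: strong_conv_def l2norm_def ip_def)
    then show ?thesis using False v
      by (intro exI[of _ "\<lambda>n. v"]) (auto simp: ext_form_def)
  qed
qed

end

text \<open>
  From the forms to the resolvents.  The resolvents \<open>x\<^sub>n\<close> of \<open>f\<close> minimise \<open>a\<^sub>n[x] + \<langle>x, x\<rangle> - 2 \<langle>f, x\<rangle>\<close>.  By the lower bound,
  the minimal values \<open>- \<langle>f, x\<^sub>n\<rangle>\<close> along a weakly convergent subsequence do not tend to less than the minimal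
  value of the limit functional.  The values at a recovery sequence \<open>w\<^sub>n\<close> for the minimiser of the latter
  exceed the minimal ones by the squared distance of \<open>w\<^sub>n\<close> to \<open>x\<^sub>n\<close> in the form norm; so \<open>w\<^sub>n - x\<^sub>n\<close> tends to
  zero.
\<close>

lemma Mosco_imp_strong_resolvent:
  assumes closed_a: "\<And>n. closed_form M (a n)" and closed_b: "closed_form M b"
    and mosco: "Mosco_conv M a b" and f: "f \<in> L2 M"
  shows "strong_conv M (\<lambda>n. resolvent1 M (a n) f) (resolvent1 M b f) sequentially"
proof -
  interpret L: semi_hilbert "L2 M" "ip M" by (rule L2_semi_hilbert)
  have pos: "positive_form M (a n)" "positive_form M b" for n
    using closed_a closed_b by (auto simp: closed_form_def)
  interpret B: semi_inner "fdom b" "bil b" using pos(2) by (rule positive_form_semi_inner)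
  interpret B1: semi_inner "fdom b" "form1 M b"
    using positive_form_semi_inner[OF positive_form_shift[OF pos(2), of 1]] by simp
  define x where "x n = resolvent1 M (a n) f" for n
  define x' where "x' = resolvent1 M b f"
  have x: "x n \<in> fdom (a n)" "x n \<in> L2 M" for n
    unfolding x_def using resolvent1_mem[OF closed_a f] by auto
  have x': "x' \<in> fdom b" "x' \<in> L2 M"
    unfolding x'_def using resolvent1_mem[OF closed_b f] by auto
  have xe: "bil (a n) (x n) v + ip M (x n) v = ip M f v" if "v \<in> fdom (a n)" for n v
    using resolvent1_graph[OF closed_a f, of n] that by (auto simp: res_graph_def x_def)
  have x'e: "bil b x' v + ip M x' v = ip M f v" if "v \<in> fdom b" for v
    using resolvent1_graph[OF closed_b f] that by (auto simp: res_graph_def x'_def)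
  have bd: "ip M (x n) (x n) \<le> ip M f f" for n
    using res_graph_contraction[OF pos(1) resolvent1_graph[OF closed_a f]] by (simp add: x_def)
  obtain w where w: "range w \<subseteq> L2 M" "strong_conv M w x' sequentially"
    and wlim: "limsup (\<lambda>n. ext_form (a n) (w n)) \<le> ext_form b x'"
    using mosco x' unfolding Mosco_conv_def by blast
  have wL: "w n \<in> L2 M" for n using w by auto
  have wx': "(\<lambda>n. sq (ip M) (w n - x')) \<longlonglongrightarrow> 0"
    using w(2) wL x' by (simp add: strong_conv_iff)
  have w_ev: "\<forall>\<^sub>F n in sequentially. w n \<in> fdom (a n) \<and> bil (a n) (w n) (w n) < bil b x' x' + e" if "e > 0" for e
  proof -
    have "limsup (\<lambda>n. ext_form (a n) (w n)) < ereal (bil b x' x' + e)"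
      using wlim x' that by (auto simp: ext_form_def intro: le_less_trans)
    then have "\<forall>\<^sub>F n in sequentially. ext_form (a n) (w n) < ereal (bil b x' x' + e)"
      by (rule Limsup_lessD)
    then show ?thesis
      by eventually_elim (auto simp: ext_form_def split: if_splits)
  qed
  have main: "\<exists>t. strict_mono (t::nat \<Rightarrow> nat) \<and> (\<lambda>j. sq (ip M) (x (r (t j)) - x')) \<longlonglongrightarrow> 0"
    if r: "strict_mono (r :: nat \<Rightarrow> nat)" for r
  proof -
    obtain t y where t: "strict_mono (t::nat \<Rightarrow> nat)" and y: "y \<in> L2 M"
      and ty: "\<And>g. g \<in> L2 M \<Longrightarrow> (\<lambda>n. ip M (x (r (t n))) g) \<longlonglongrightarrow> ip M y g"
      using L.weak_compactness[of "\<lambda>n. x (r n)" "ip M f f"] x(2) bd by blast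
    \<comment> \<open>The lower bound, applied to the sequence filled up by its weak limit \<open>y\<close>.\<close>
    define q where "q = r \<circ> t"
    have q: "strict_mono q" unfolding q_def using r t by (rule strict_mono_o)
    have qy: "(\<lambda>n. ip M (x (q n)) g) \<longlonglongrightarrow> ip M y g" if "g \<in> L2 M" for g
      using ty[OF that] by (simp add: q_def)
    define u where "u n = (if n \<in> range q then x n else y)" for n
    have "weak_conv M u y"
      unfolding u_def using q qy by (intro weak_conv_subsequence_fill) (auto simp: weak_conv_def)
    moreover have "range u \<subseteq> L2 M" using x y by (auto simp: u_def)
    ultimately have "ext_form b y \<le> liminf (\<lambda>n. ext_form (a n) (u n))"
      using mosco y unfolding Mosco_conv_def by blast
    also have "\<dots> \<le> liminf ((\<lambda>n. ext_form (a n) (u n)) \<circ> q)"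
      by (rule liminf_subseq_mono[OF q])
    also have "\<dots> = liminf (\<lambda>j. ereal (sq (bil (a (q j))) (x (q j))))"
      using x by (simp add: o_def u_def ext_form_def)
    also have "\<dots> \<le> liminf (\<lambda>j. ereal (ip M (x (q j)) f - 2 * ip M (x (q j)) y + ip M y y))"
    proof (intro Liminf_mono eventuallyI)
      fix j
      have "sq (bil (a (q j))) (x (q j)) = ip M f (x (q j)) - sq (ip M) (x (q j))"
        using xe[OF x(1), of "q j"] by simp
      moreover have "2 * ip M (x (q j)) y \<le> sq (ip M) (x (q j)) + ip M y y"
        using x y by (intro L.young)
      ultimately show "ereal (sq (bil (a (q j))) (x (q j)))
          \<le> ereal (ip M (x (q j)) f - 2 * ip M (x (q j)) y + ip M y y)"
        using L.sym[OF f x(2)] by simp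
    qed
    also have "\<dots> = ereal (ip M y f - 2 * ip M y y + ip M y y)"
      by (intro lim_imp_Liminf tendsto_ereal tendsto_intros qy f y) simp
    finally have ey: "ext_form b y \<le> ereal (ip M y f - ip M y y)" by simp
    then have yb: "y \<in> fdom b" by (auto simp: ext_form_def split: if_splits)
    \<comment> \<open>In the form norm \<open>y - x'\<close> has square at most \<open>\<langle>f, x' - y\<rangle>\<close>, so \<open>\<langle>f, y\<rangle> \<le> \<langle>f, x'\<rangle>\<close>.\<close>
    have "bil b y y + ip M y y \<le> ip M f y"
      using ey yb f y by (simp add: ext_form_def L.sym[of f y])
    moreover have "sq (form1 M b) (x' - y)
        = ip M f x' - 2 * ip M f y + (bil b y y + ip M y y)"
      using B1.sq_diff[OF x'(1) yb] x'e[OF x'(1)] x'e[OF yb] by simp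
    ultimately have le: "ip M f y \<le> ip M f x'"
      using B1.nonneg[OF B1.diff_mem[OF x'(1) yb]] by simp
    have sub: "\<forall>\<^sub>F j in sequentially. P (q j)" if "\<forall>\<^sub>F n in sequentially. P n" for P
      using that q by (metis eventually_subseq)
    have wq: "(\<lambda>j. sq (ip M) (w (q j) - x')) \<longlonglongrightarrow> 0"
      using LIMSEQ_subseq_LIMSEQ[OF wx' q] by (simp add: o_def)
    have "(\<lambda>j. sq (ip M) (w (q j) - x (q j))) \<longlonglongrightarrow> 0"
    proof (rule order_tendstoI)
      fix c :: real assume "c < 0"
      then show "\<forall>\<^sub>F j in sequentially. c < sq (ip M) (w (q j) - x (q j))"
        using L.nonneg[OF L.diff_mem[OF wL x(2)]] by (intro eventuallyI) (meson less_le_trans)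
    next
      fix c :: real assume c: "c > 0"
      \<comment> \<open>\<open>J\<close> collects what remains of the excess over the minimum besides \<open>a\<^sub>n[w\<^sub>n]\<close>; it converges.\<close>
      define J where "J j = sq (ip M) (w (q j)) - 2 * ip M (w (q j)) f + ip M (x (q j)) f" for j
      have "J \<longlonglongrightarrow> ip M x' x' - 2 * ip M x' f + ip M y f"
        unfolding J_def
        by (intro tendsto_intros L.tendsto_sq L.tendsto_left qy f)
          (use wL x' f wq in \<open>auto simp: L.conv_def\<close>)
      moreover have "ip M x' x' - 2 * ip M x' f + ip M y f < - bil b x' x' + c / 2"
        using le x'e[OF x'(1)] c L.sym[OF f x'(2)] L.sym[OF f y] by simp
      ultimately have "\<forall>\<^sub>F j in sequentially. J j < - bil b x' x' + c / 2"
        by (rule order_tendstoD)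
      moreover have "\<forall>\<^sub>F j in sequentially. w (q j) \<in> fdom (a (q j)) \<and>
          sq (bil (a (q j))) (w (q j)) < bil b x' x' + c / 2"
        using w_ev[of "c / 2"] c by (intro sub[of "\<lambda>n. w n \<in> fdom (a n) \<and> bil (a n) (w n) (w n) < bil b x' x' + c / 2"]) auto
      ultimately show "\<forall>\<^sub>F j in sequentially. sq (ip M) (w (q j) - x (q j)) < c"
      proof eventually_elim
        case (elim j)
        interpret A: semi_inner "fdom (a (q j))" "bil (a (q j))"
          using pos(1) by (rule positive_form_semi_inner)
        have wa: "w (q j) \<in> fdom (a (q j))" using elim by simp
        have "sq (ip M) (w (q j) - x (q j))
            \<le> sq (bil (a (q j))) (w (q j) - x (q j)) + sq (ip M) (w (q j) - x (q j))"
          using A.nonneg[OF A.diff_mem[OF wa x(1)]] by simp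
        also have "\<dots> = sq (bil (a (q j))) (w (q j)) + J j"
          using xe[OF wa] xe[OF x(1), of "q j"] wL[of "q j"] x(2)[of "q j"] f
          by (simp add: A.sq_diff[OF wa x(1)] L.sq_diff J_def L.sym[of f] A.sym[OF wa x(1)]
              L.sym[of "w (q j)" "x (q j)"])
        also have "\<dots> < c" using elim by simp
        finally show ?case .
      qed
    qed
    note wx = this
    have "(\<lambda>j. sq (ip M) (x (q j) - x')) \<longlonglongrightarrow> 0"
    proof (rule tendsto_null_squeeze[OF _ _ wx wq])
      fix j
      show "sq (ip M) (x (q j) - x') \<le> 2 * sq (ip M) (w (q j) - x (q j)) + 2 * sq (ip M) (w (q j) - x')"
        using L.sq_triangle[OF x(2) wL x'(2), of "q j" "q j"] L.sq_diff_commute[OF wL x(2), of "q j" "q j"]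
        by simp
      show "0 \<le> sq (ip M) (x (q j) - x')" by (intro L.nonneg L.diff_mem x x')
    qed
    then show ?thesis using t by (auto simp: q_def)
  qed
  have "(\<lambda>n. sq (ip M) (x n - x')) \<longlonglongrightarrow> 0"
  proof (rule ccontr)
    assume "\<not> (\<lambda>n. sq (ip M) (x n - x')) \<longlonglongrightarrow> 0"
    then obtain e where e: "e > 0" "\<not> (\<forall>\<^sub>F n in sequentially. dist (sq (ip M) (x n - x')) 0 < e)"
      unfolding tendsto_iff by blast
    have "dist (sq (ip M) (x n - x')) 0 = sq (ip M) (x n - x')" for n
      using L.nonneg[OF L.diff_mem[OF x(2) x'(2)], of n] by simp
    with e(2) have "\<not> (\<forall>\<^sub>F n in sequentially. sq (ip M) (x n - x') < e)"
      by simp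
    then have "\<exists>\<^sub>F n in cofinite. sq (ip M) (x n - x') \<ge> e"
      by (simp add: not_eventually not_less cofinite_eq_sequentially)
    then have "infinite {n. sq (ip M) (x n - x') \<ge> e}"
      by (simp add: frequently_cofinite)
    then obtain r :: "nat \<Rightarrow> nat" where r: "strict_mono r" "\<And>n. sq (ip M) (x (r n) - x') \<ge> e"
      using infinite_enumerate[of "{n. sq (ip M) (x n - x') \<ge> e}"] by blast
    obtain t where "(\<lambda>j. sq (ip M) (x (r (t j)) - x')) \<longlonglongrightarrow> 0"
      using main[OF r(1)] by blast
    then have "e \<le> 0" using r(2) by (intro LIMSEQ_le_const) auto
    with e show False by simp
  qed
  then show ?thesis
    using x x' by (subst strong_conv_iff) (auto simp: x_def x'_def)
qed

section \<open>Forms induced on the range of a linear map\<close>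

text \<open>
  The common pattern of the traces for \<open>\<lambda> > 0\<close> and of the trace for \<open>\<lambda> = 0\<close>: a space \<open>C\<close> with a form
  \<open>b\<close> and a linear map \<open>T\<close> into \<open>L\<^sup>2\<close> for which \<open>C\<close> is complete in the graph norm.  On the range of \<open>T\<close>
  the induced form takes the value of \<open>b\<close> at the preimages orthogonal to the kernel, which are the
  preimages of minimal energy.
\<close>

locale graph_complete_map =
  fixes C :: "'v::real_vector set" and b :: "'v \<Rightarrow> 'v \<Rightarrow> real"
    and T :: "'v \<Rightarrow> 'a \<Rightarrow> real" and M :: "'a measure"
  assumes b_semi_inner: "semi_inner C b"
    and T_add: "\<And>x y. x \<in> C \<Longrightarrow> y \<in> C \<Longrightarrow> T (x + y) = T x + T y"
    and T_scale: "\<And>x c. x \<in> C \<Longrightarrow> T (c *\<^sub>R x) = c *\<^sub>R T x"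
    and T_L2: "\<And>x. x \<in> C \<Longrightarrow> T x \<in> L2 M"
    and graph_complete: "semi_hilbert C (\<lambda>x y. b x y + ip M (T x) (T y))"
begin

sublocale b: semi_inner C b by (rule b_semi_inner)
sublocale g: semi_hilbert C "\<lambda>x y. b x y + ip M (T x) (T y)" by (rule graph_complete)
sublocale L: semi_hilbert "L2 M" "ip M" by (rule L2_semi_hilbert)

lemma T_diff: "x \<in> C \<Longrightarrow> y \<in> C \<Longrightarrow> T (x - y) = T x - T y"
  using T_add[of x "(-1) *\<^sub>R y"] T_scale[of y "-1"] b.scale_mem[of y "-1"] by simp

definition kernel :: "'v set" where
  "kernel = {z \<in> C. AE t in M. T z t = 0}"

definition is_lift :: "'v \<Rightarrow> ('a \<Rightarrow> real) \<Rightarrow> bool" where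
  "is_lift p v \<longleftrightarrow> p \<in> C \<and> (AE t in M. v t = T p t) \<and> (\<forall>z\<in>kernel. b p z = 0)"

lemma kernel_subspace: "subspace kernel"
  unfolding subspace_def kernel_def
proof (intro conjI ballI allI; clarify)
  have "T 0 = 0" using T_scale[of 0 0] by simp
  then show "0 \<in> C \<and> (AE t in M. T 0 t = 0)" by simp
next
  fix x y assume "x \<in> C" "y \<in> C" and 1: "AE t in M. T x t = 0" and 2: "AE t in M. T y t = 0"
  then show "x + y \<in> C \<and> (AE t in M. T (x + y) t = 0)"
    by (auto simp: T_add b.add_mem)
next
  fix x c assume "x \<in> C" and 1: "AE t in M. T x t = 0"
  then show "c *\<^sub>R x \<in> C \<and> (AE t in M. T (c *\<^sub>R x) t = 0)"
    by (auto simp: T_scale b.scale_mem)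
qed

lemma kernel_ip_null: "z \<in> kernel \<Longrightarrow> v \<in> L2 M \<Longrightarrow> ip M v (T z) = 0"
  using ip_null_iff[OF T_L2[of z]] L.null_left[of "T z" v] L.sym[of v "T z"] T_L2[of z]
  by (auto simp: kernel_def)

text \<open>
  The projection of \<open>x\<close> to the closure of the kernel is again in the kernel, since \<open>T\<close> is continuous for
  the graph norm; orthogonality to the kernel is the same for the graph norm and for \<open>b\<close>.
\<close>

lemma lift_exists:
  assumes x: "x \<in> C"
  obtains p where "is_lift p (T x)" "x - p \<in> kernel"
proof -
  obtain s v where s: "\<And>n. s n \<in> kernel" and v: "v \<in> C" and sv: "g.conv s v"
    and orth: "\<And>z. z \<in> kernel \<Longrightarrow> b (x - v) z + ip M (T (x - v)) (T z) = 0"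
    by (rule g.projection[OF kernel_subspace, of "\<lambda>x. x" x])
      (use x in \<open>auto simp: kernel_def\<close>)
  have sC: "s n \<in> C" for n using s by (auto simp: kernel_def)
  have "(\<lambda>n. 2 * (sq b (s n - v) + sq (ip M) (T (s n - v)))) \<longlonglongrightarrow> 2 * 0"
    using sv unfolding g.conv_def by (intro tendsto_intros)
  moreover have "ip M (T v) (T v) \<le> 2 * (sq b (s n - v) + sq (ip M) (T (s n - v)))" for n
  proof -
    have "sq (ip M) (T (s n) - T v) = ip M (T v) (T v)"
      using kernel_ip_null[OF s[of n]] T_L2 sC v by (simp add: L.sq_diff L.sym[of "T (s n)" "T v"])
    then show ?thesis
      using b.nonneg[OF b.diff_mem[OF sC v]] L.nonneg[OF T_L2[OF v]] sC v by (simp add: T_diff)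
  qed
  ultimately have "ip M (T v) (T v) \<le> 2 * 0"
    by (intro LIMSEQ_le_const) auto
  then have "ip M (T v) (T v) = 0"
    using L.nonneg[OF T_L2[OF v]] by simp
  then have vk: "v \<in> kernel"
    using ip_null_iff[OF T_L2[OF v]] v by (simp add: kernel_def)
  have "b (x - v) z = 0" if "z \<in> kernel" for z
    using orth[OF that] kernel_ip_null[OF that T_L2[of "x - v"]] x v by simp
  moreover have "AE t in M. T x t = T (x - v) t"
    using vk x v by (auto simp: T_diff kernel_def)
  ultimately have "is_lift (x - v) (T x)"
    using x v by (simp add: is_lift_def)
  with vk show ?thesis using that[of "x - v"] by simp
qed

end

locale induced_form = graph_complete_map +
  fixes F :: "'b form" and P :: "('b \<Rightarrow> real) \<Rightarrow> 'a"
  assumes dom: "fdom F = {v \<in> L2 M. \<exists>x\<in>C. AE t in M. v t = T x t}"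
    and lift: "\<And>v. v \<in> fdom F \<Longrightarrow> is_lift (P v) v"
    and bil: "\<And>v w. v \<in> fdom F \<Longrightarrow> w \<in> fdom F \<Longrightarrow> bil F v w = b (P v) (P w)"
begin

lemma P: "v \<in> fdom F \<Longrightarrow> P v \<in> C"
    "v \<in> fdom F \<Longrightarrow> AE t in M. v t = T (P v) t"
    "v \<in> fdom F \<Longrightarrow> z \<in> kernel \<Longrightarrow> b (P v) z = 0"
  using lift by (auto simp: is_lift_def)

lemma preimages_differ_by_kernel:
  assumes "x \<in> C" "y \<in> C" "AE t in M. v t = T x t" "AE t in M. v t = T y t"
  shows "x - y \<in> kernel"
  using assms by (auto simp: kernel_def T_diff)

text \<open>
  A lift is orthogonal to the kernel, so in the other argument any preimage may be used; this makes the
  induced form bilinear although the lifts are chosen.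
\<close>

lemma bil_preimage:
  assumes v: "v \<in> fdom F" and w: "w \<in> fdom F" and x: "x \<in> C" "AE t in M. v t = T x t"
  shows "b x (P w) = bil F v w"
proof -
  have "b (P w) (x - P v) = 0"
    using P v w x by (intro P(3) preimages_differ_by_kernel[of _ _ v]) auto
  then show ?thesis
    using x P(1)[OF v] P(1)[OF w] bil[OF v w] b.sym[of "P w" x] b.sym[of "P w" "P v"]
    by (simp add: b.diff_right)
qed

lemma bil_lift:
  assumes v: "v \<in> fdom F" and w: "w \<in> fdom F" and x: "is_lift x v"
    and y: "y \<in> C" "AE t in M. w t = T y t"
  shows "b x y = bil F v w"
proof -
  have x': "x \<in> C" "AE t in M. v t = T x t" using x by (auto simp: is_lift_def)
  have "b x (y - P w) = 0"
    using x preimages_differ_by_kernel[OF y(1) P(1)[OF w] y(2) P(2)[OF w]] by (auto simp: is_lift_def)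
  then show ?thesis
    using bil_preimage[OF v w x'] x' y P(1)[OF w] by (simp add: b.diff_right)
qed

lemma positive: "positive_form M F"
  unfolding positive_form_def fun_lincomb_eq
proof (intro conjI ballI allI impI)
  show "fdom F \<subseteq> L2 M" using dom by auto
  have "T 0 = 0" using T_scale[of 0 0] by simp
  then show "(\<lambda>x. 0) \<in> fdom F"
    using L.zero_mem b.zero_mem unfolding dom by (force simp: zero_fun_def)
next
  fix u v a c assume u: "u \<in> fdom F" and v: "v \<in> fdom F"
  have "AE t in M. (a *\<^sub>R u + c *\<^sub>R v) t = T (a *\<^sub>R P u + c *\<^sub>R P v) t"
    using P(2)[OF u] P(2)[OF v] by eventually_elim (simp add: T_add T_scale P(1)[OF u] P(1)[OF v])
  moreover have "a *\<^sub>R u + c *\<^sub>R v \<in> L2 M" using u v dom by auto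
  moreover have lin: "a *\<^sub>R P u + c *\<^sub>R P v \<in> C" using P(1)[OF u] P(1)[OF v] by auto
  ultimately show mem: "a *\<^sub>R u + c *\<^sub>R v \<in> fdom F" unfolding dom by blast
  fix w assume w: "w \<in> fdom F"
  have "bil F (a *\<^sub>R u + c *\<^sub>R v) w = b (a *\<^sub>R P u + c *\<^sub>R P v) (P w)"
    using \<open>AE t in M. (a *\<^sub>R u + c *\<^sub>R v) t = _ t\<close> lin by (intro bil_preimage[symmetric] mem w)
  then show "bil F (a *\<^sub>R u + c *\<^sub>R v) w = a * bil F u w + c * bil F v w"
    using P(1)[OF u] P(1)[OF v] P(1)[OF w] by (simp add: b.expand bil u v w)
next
  fix u v assume u: "u \<in> fdom F" and v: "v \<in> borel_measurable M" "AE x in M. v x = u x"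
  have "v \<in> L2 M" using u v dom by (intro L2_AE_cong[OF v]) auto
  moreover have "AE t in M. v t = T (P u) t" using v(2) P(2)[OF u] by eventually_elim simp
  ultimately show "v \<in> fdom F" using P(1)[OF u] unfolding dom by blast
next
  fix u u' v assume u: "u \<in> fdom F" "u' \<in> fdom F" and v: "v \<in> fdom F" and ae: "AE x in M. u x = u' x"
  have "AE t in M. u t = T (P u') t" using ae P(2)[OF u(2)] by eventually_elim simp
  then show "bil F u v = bil F u' v"
    using bil_preimage[OF u(1) v P(1)[OF u(2)]] bil[OF u(2) v] by simp
next
  fix u v assume "u \<in> fdom F" "v \<in> fdom F"
  then show "bil F u v = bil F v u" using bil b.sym P(1) by auto
next
  fix u assume "u \<in> fdom F"
  then show "0 \<le> bil F u u" using bil b.nonneg P(1) by auto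
qed

lemma resolvent_graph:
  assumes f: "f \<in> L2 M" and x: "x \<in> C"
    and eq: "\<And>y. y \<in> C \<Longrightarrow> b x y + ip M (T x) (T y) = ip M f (T y)"
  shows "(T x, f) \<in> res_graph M F"
proof -
  have Tx: "T x \<in> fdom F" unfolding dom using x T_L2 by auto
  have "b x z = 0" if "z \<in> kernel" for z
    using eq[of z] kernel_ip_null[OF that] that T_L2[OF x] f by (simp add: kernel_def)
  then have lift_x: "is_lift x (T x)" using x by (simp add: is_lift_def)
  have "form1 M F (T x) w = ip M f w" if w: "w \<in> fdom F" for w
  proof -
    have wL: "w \<in> L2 M" using w dom by auto
    have "bil F (T x) w = b x (P w)"
      using bil_lift[OF Tx w lift_x P(1,2)[OF w]] by simp
    moreover have "ip M (T x) w = ip M (T x) (T (P w))" "ip M f w = ip M f (T (P w))"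
      using P(1,2)[OF w] wL f T_L2 x by (auto intro!: ip_AE_cong L2_measurable)
    ultimately show ?thesis using eq[OF P(1)[OF w]] by simp
  qed
  then show ?thesis using Tx f by (simp add: res_graph_def)
qed

lemma closed: "closed_form M F"
proof (rule closed_formI[OF positive])
  interpret F: semi_inner "fdom F" "bil F" using positive by (rule positive_form_semi_inner)
  interpret S: semi_inner "fdom F" "form1 M F"
    using positive_form_semi_inner[OF positive_form_shift[OF positive, of 1]] by simp
  have FL: "v \<in> L2 M" if "v \<in> fdom F" for v using that dom by auto
  show "semi_hilbert (fdom F) (form1 M F)"
  proof
    fix s :: "nat \<Rightarrow> 'b \<Rightarrow> real"
    assume s: "\<And>n. s n \<in> fdom F"
      and cau: "\<And>e. e > 0 \<Longrightarrow> \<exists>N. \<forall>i\<ge>N. \<forall>j\<ge>N. sq (form1 M F) (s i - s j) < e"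
    have ip_eq: "sq (ip M) (s i - v) = sq (ip M) (T (P (s i) - x))"
      if "v \<in> fdom F" "x \<in> C" and ae: "AE t in M. v t = T x t" for i v x
    proof (rule ip_AE_cong)
      show "AE t in M. (s i - v) t = T (P (s i) - x) t"
        using P(2)[OF s[of i]] ae by eventually_elim (simp add: T_diff P(1)[OF s] that)
      then show "AE t in M. (s i - v) t = T (P (s i) - x) t" .
    qed (use s that FL P(1)[OF s] T_L2 in \<open>auto intro!: L2_measurable L.diff_mem simp del: minus_apply\<close>)
    have eq: "sq b (P (s i) - P (s j))
        + sq (ip M) (T (P (s i) - P (s j))) = sq (form1 M F) (s i - s j)" for i j
      using ip_eq[OF s P(1)[OF s] P(2)[OF s], of i j]
      unfolding shift_form_simps F.sq_diff[OF s s] bil[OF s s] b.sq_diff[OF P(1)[OF s] P(1)[OF s]]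
      by simp
    have "\<exists>x\<in>C. g.conv (\<lambda>n. P (s n)) x"
      by (rule g.complete[OF P(1)[OF s]]) (unfold eq, rule cau)
    then obtain x where x: "x \<in> C" and lim: "g.conv (\<lambda>n. P (s n)) x" by blast
    have Tx: "T x \<in> fdom F" unfolding dom using x T_L2 by auto
    have "S.conv s (T x)"
      unfolding S.conv_def
    proof (rule Lim_null_comparison[OF eventuallyI lim[unfolded g.conv_def]])
      fix n
      have d: "s n - T x \<in> fdom F" using s Tx by (rule F.diff_mem)
      have Pn: "P (s n) - x \<in> C" using P(1)[OF s] x by (rule b.diff_mem)
      have ae: "AE t in M. (s n - T x) t = T (P (s n) - x) t"
        using P(2)[OF s[of n]] by eventually_elim (simp add: T_diff P(1)[OF s] x)
      have "b (P (s n - T x)) (P (s n) - x) = sq (bil F) (s n - T x)"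
        by (rule bil_lift[OF d d lift[OF d] Pn ae])
      then have "sq (bil F) (s n - T x) \<le> sq b (P (s n) - x)"
        using b.young[OF P(1)[OF d] Pn] bil[OF d d] by simp
      then show "norm (sq (form1 M F) (s n - T x))
          \<le> sq b (P (s n) - x) + sq (ip M) (T (P (s n) - x))"
        using ip_eq[OF Tx x, of n] S.nonneg[OF d] by simp
    qed
    with Tx show "\<exists>v\<in>fdom F. S.conv s v" by blast
  qed
qed

end

lemma (in graph_complete_map) induced_form_exists:
  obtains F P where "induced_form C b T M F P"
proof -
  define D where "D = {v \<in> L2 M. \<exists>x\<in>C. AE t in M. v t = T x t}"
  define P where "P v = (SOME p. is_lift p v)" for v
  have "is_lift (P v) v" if v: "v \<in> D" for v
  proof -
    obtain x where x: "x \<in> C" "AE t in M. v t = T x t" using v by (auto simp: D_def)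
    obtain p where "is_lift p (T x)" using lift_exists[OF x(1)] .
    then have "is_lift p v"
      using x(2) by (auto simp: is_lift_def elim: AE_mp)
    then show ?thesis unfolding P_def by (rule someI)
  qed
  then have "induced_form C b T M (Form D (\<lambda>v w. b (P v) (P w))) P"
    by unfold_locales (auto simp: D_def)
  then show ?thesis using that by blast
qed

section \<open>The limit of vanishing shift\<close>

context semi_inner
begin

definition cauchy :: "(nat \<Rightarrow> 'v) \<Rightarrow> bool" where
  "cauchy s \<longleftrightarrow> (\<forall>e>0. \<exists>N. \<forall>i\<ge>N. \<forall>j\<ge>N. sq b (s i - s j) < e)"

lemma cauchy_const: "cauchy (\<lambda>n. x)"
  by (auto simp: cauchy_def)

lemma cauchy_add:
  assumes s: "\<And>n. s n \<in> V" "cauchy s" and t: "\<And>n. t n \<in> V" "cauchy t"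
  shows "cauchy (s + t)"
  unfolding cauchy_def
proof (intro allI impI)
  fix e :: real assume e: "e > 0"
  obtain N where N: "\<And>i j. i \<ge> N \<Longrightarrow> j \<ge> N \<Longrightarrow> sq b (s i - s j) < e / 4"
    using s(2) e unfolding cauchy_def by (metis divide_pos_pos zero_less_numeral)
  obtain N' where N': "\<And>i j. i \<ge> N' \<Longrightarrow> j \<ge> N' \<Longrightarrow> sq b (t i - t j) < e / 4"
    using t(2) e unfolding cauchy_def by (metis divide_pos_pos zero_less_numeral)
  have "sq b ((s + t) i - (s + t) j) < e" if "i \<ge> max N N'" "j \<ge> max N N'" for i j
  proof -
    have eq: "(s + t) i - (s + t) j = (s i - s j) + (t i - t j)" by simp
    have "sq b ((s + t) i - (s + t) j)
        \<le> 2 * sq b (s i - s j) + 2 * sq b (t i - t j)"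
      unfolding eq using s(1) t(1) by (intro sq_add_le diff_mem)
    then show ?thesis using N[of i j] N'[of i j] that by simp
  qed
  then show "\<exists>N. \<forall>i\<ge>N. \<forall>j\<ge>N. sq b ((s + t) i - (s + t) j) < e" by blast
qed

lemma cauchy_scale:
  assumes s: "\<And>n. s n \<in> V" "cauchy s"
  shows "cauchy (c *\<^sub>R s)"
  unfolding cauchy_def
proof (intro allI impI)
  fix e :: real assume e: "e > 0"
  have p: "c\<^sup>2 + 1 > 0" by (simp add: add_nonneg_pos)
  then have "e / (c\<^sup>2 + 1) > 0" using e by simp
  then obtain N where N: "\<And>i j. i \<ge> N \<Longrightarrow> j \<ge> N \<Longrightarrow> sq b (s i - s j) < e / (c\<^sup>2 + 1)"
    using s(2) unfolding cauchy_def by metis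
  have "sq b ((c *\<^sub>R s) i - (c *\<^sub>R s) j) < e" if "i \<ge> N" "j \<ge> N" for i j
  proof -
    have "sq b ((c *\<^sub>R s) i - (c *\<^sub>R s) j) = c\<^sup>2 * sq b (s i - s j)"
      using sq_scale[OF diff_mem[OF s(1) s(1)], of c i j] by (simp add: scaleR_diff_right)
    also have "\<dots> \<le> (c\<^sup>2 + 1) * sq b (s i - s j)"
      using nonneg[OF diff_mem[OF s(1) s(1)], of i j] by (intro mult_right_mono) auto
    also have "\<dots> < e" using N[OF that] p by (simp add: field_simps)
    finally show ?thesis .
  qed
  then show "\<exists>N. \<forall>i\<ge>N. \<forall>j\<ge>N. sq b ((c *\<^sub>R s) i - (c *\<^sub>R s) j) < e" by blast
qed

lemma cauchy_convergent_sq: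
  assumes s: "\<And>n. s n \<in> V" "cauchy s"
  shows "convergent (\<lambda>n. b (s n) (s n))"
proof -
  have "Cauchy (\<lambda>n. sqrt (b (s n) (s n)))"
    unfolding Cauchy_def
  proof (intro allI impI)
    fix e :: real assume e: "e > 0"
    then have "e\<^sup>2 > 0" by simp
    then obtain N where N: "\<And>i j. i \<ge> N \<Longrightarrow> j \<ge> N \<Longrightarrow> sq b (s i - s j) < e\<^sup>2"
      using s(2) unfolding cauchy_def by metis
    have "dist (sqrt (b (s i) (s i))) (sqrt (b (s j) (s j))) < e" if "i \<ge> N" "j \<ge> N" for i j
    proof -
      have "sqrt (sq b (s i - s j)) < e"
        using N[OF that] e by (simp add: real_less_lsqrt)
      moreover have "sqrt (sq b (s j - s i)) = sqrt (sq b (s i - s j))"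
        using sq_diff_commute[OF s(1) s(1)] by simp
      ultimately show ?thesis
        using norm_triangle[OF diff_mem[OF s(1) s(1)] s(1), of i j j]
          norm_triangle[OF diff_mem[OF s(1) s(1)] s(1), of j i i]
        by (simp add: dist_real_def abs_if)
    qed
    then show "\<exists>N. \<forall>i\<ge>N. \<forall>j\<ge>N. dist (sqrt (b (s i) (s i))) (sqrt (b (s j) (s j))) < e" by blast
  qed
  then obtain l where "(\<lambda>n. sqrt (b (s n) (s n))) \<longlonglongrightarrow> l"
    using Cauchy_convergent by (auto simp: convergent_def)
  then have "(\<lambda>n. (sqrt (b (s n) (s n)))\<^sup>2) \<longlonglongrightarrow> l\<^sup>2"
    by (rule tendsto_power)
  then show ?thesis
    using nonneg[OF s(1)] by (auto simp: convergent_def)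
qed

lemma cauchy_tendsto_lim:
  assumes s: "\<And>n. s n \<in> V" "cauchy s" and t: "\<And>n. t n \<in> V" "cauchy t"
  shows "(\<lambda>n. b (s n) (t n)) \<longlonglongrightarrow> lim (\<lambda>n. b (s n) (t n))"
proof -
  have "convergent (\<lambda>n. (1/2) * (sq b ((s + t) n) + (- 1) * b (s n) (s n) + (- 1) * b (t n) (t n)))"
    using s t by (intro convergent_mult convergent_add convergent_const cauchy_convergent_sq cauchy_add) auto
  moreover have "(1/2) * (sq b ((s + t) n) + (- 1) * b (s n) (s n) + (- 1) * b (t n) (t n)) = b (s n) (t n)" for n
    using s t by (simp add: sq_add)
  ultimately show ?thesis by (simp add: convergent_LIMSEQ_iff)
qed

end

text \<open>
  The completion of a form \<open>e\<close> on a subspace \<open>V\<close> of \<open>L\<^sup>2\<close> in its graph norm.  If \<open>e\<close>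
  is not closable, there are Cauchy sequences that tend to zero in \<open>L\<^sup>2\<close> while their forms do not; they
  are in the kernel of the second projection, and dividing it out yields the regular part of \<open>e\<close>.
\<close>

locale form_completion = e: semi_inner V e for V :: "('a \<Rightarrow> real) set" and e +
  fixes M :: "'a measure"
  assumes V_L2: "V \<subseteq> L2 M"
begin

sublocale L: semi_hilbert "L2 M" "ip M" by (rule L2_semi_hilbert)

definition C :: "((nat \<Rightarrow> 'a \<Rightarrow> real) \<times> ('a \<Rightarrow> real)) set" where
  "C = {(x, v). (\<forall>n. x n \<in> V) \<and> e.cauchy x \<and> v \<in> L2 M \<and> L.conv x v}"

definition e' :: "(nat \<Rightarrow> 'a \<Rightarrow> real) \<times> ('a \<Rightarrow> real) \<Rightarrow> (nat \<Rightarrow> 'a \<Rightarrow> real) \<times> ('a \<Rightarrow> real) \<Rightarrow> real" where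
  "e' X Y = lim (\<lambda>n. e (fst X n) (fst Y n))"

definition embed :: "('a \<Rightarrow> real) \<Rightarrow> (nat \<Rightarrow> 'a \<Rightarrow> real) \<times> ('a \<Rightarrow> real)" where
  "embed w = ((\<lambda>n. w), w)"

lemma C_D: "X \<in> C \<Longrightarrow> fst X n \<in> V" "X \<in> C \<Longrightarrow> e.cauchy (fst X)" "X \<in> C \<Longrightarrow> snd X \<in> L2 M"
    "X \<in> C \<Longrightarrow> L.conv (fst X) (snd X)"
  by (auto simp: C_def)

lemma e'_lim: "X \<in> C \<Longrightarrow> Y \<in> C \<Longrightarrow> (\<lambda>n. e (fst X n) (fst Y n)) \<longlonglongrightarrow> e' X Y"
  unfolding e'_def by (intro e.cauchy_tendsto_lim) (auto dest: C_D)

lemma subspace_C: "subspace C"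
proof (rule subspaceI)
  have "((\<lambda>n. 0), 0) \<in> C"
    using e.cauchy_const[of 0] by (simp add: C_def L.conv_def)
  moreover have "(\<lambda>n::nat. 0 :: 'a \<Rightarrow> real) = 0" by (simp add: fun_eq_iff)
  ultimately show "0 \<in> C" by (simp add: zero_prod_def)
next
  fix X Y assume X: "X \<in> C" and Y: "Y \<in> C"
  have "L.conv (fst X + fst Y) (snd X + snd Y)"
    unfolding L.conv_def
  proof (rule tendsto_null_squeeze)
    fix n
    have eq: "(fst X + fst Y) n - (snd X + snd Y) = (fst X n - snd X) + (fst Y n - snd Y)" by simp
    have L: "fst X n - snd X \<in> L2 M" "fst Y n - snd Y \<in> L2 M"
      by (intro L.diff_mem C_D(3) subsetD[OF V_L2 C_D(1)] X Y)+
    show "sq (ip M) ((fst X + fst Y) n - (snd X + snd Y))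
        \<le> 2 * sq (ip M) (fst X n - snd X) + 2 * sq (ip M) (fst Y n - snd Y)"
      "0 \<le> sq (ip M) ((fst X + fst Y) n - (snd X + snd Y))"
      unfolding eq by (intro L.sq_add_le L.nonneg L.add_mem L)+
  qed (use C_D(4)[OF X] C_D(4)[OF Y] in \<open>simp_all add: L.conv_def\<close>)
  then show "X + Y \<in> C"
    using C_D[OF X] C_D[OF Y] e.cauchy_add[of "fst X" "fst Y"] by (auto simp: C_def plus_prod_def)
next
  fix X c assume X: "X \<in> C"
  have "(\<lambda>n. c\<^sup>2 * sq (ip M) (fst X n - snd X)) \<longlonglongrightarrow> c\<^sup>2 * 0"
    using C_D(4)[OF X] unfolding L.conv_def by (intro tendsto_intros)
  moreover have "c\<^sup>2 * sq (ip M) (fst X n - snd X)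
      = sq (ip M) ((c *\<^sub>R fst X) n - c *\<^sub>R snd X)" for n
    using L.sq_scale[OF L.diff_mem[OF subsetD[OF V_L2 C_D(1)[OF X]] C_D(3)[OF X]], of c n]
    by (simp add: scaleR_diff_right)
  ultimately have "L.conv (c *\<^sub>R fst X) (c *\<^sub>R snd X)"
    by (simp add: L.conv_def)
  then show "c *\<^sub>R X \<in> C"
    using C_D[OF X] e.cauchy_scale[of "fst X" c] by (auto simp: C_def scaleR_prod_def)
qed

lemma e'_semi_inner: "semi_inner C e'"
proof
  note add = subspace_C[THEN subspace_add] and scale = subspace_C[THEN subspace_scale]
  fix X Y Z c assume X: "X \<in> C" and Z: "Z \<in> C"
  show "e' (X + Y) Z = e' X Z + e' Y Z" if Y: "Y \<in> C"
  proof (rule LIMSEQ_unique[OF e'_lim[OF add[OF X Y] Z]])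
    show "(\<lambda>n. e (fst (X + Y) n) (fst Z n)) \<longlonglongrightarrow> e' X Z + e' Y Z"
      using tendsto_add[OF e'_lim[OF X Z] e'_lim[OF Y Z]] C_D(1)[OF X] C_D(1)[OF Y] C_D(1)[OF Z]
      by (simp add: e.add_left)
  qed
  show "e' (c *\<^sub>R X) Z = c * e' X Z"
  proof (rule LIMSEQ_unique[OF e'_lim[OF scale[OF X] Z]])
    show "(\<lambda>n. e (fst (c *\<^sub>R X) n) (fst Z n)) \<longlonglongrightarrow> c * e' X Z"
      using tendsto_mult[OF tendsto_const e'_lim[OF X Z], of c] C_D(1)[OF X] C_D(1)[OF Z]
      by (simp add: e.scale_left)
  qed
  show "e' X Z = e' Z X"
    unfolding e'_def using C_D(1)[OF X] C_D(1)[OF Z] by (simp add: e.sym)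
  show "0 \<le> e' X X"
    using e'_lim[OF X X] e.nonneg[OF C_D(1)[OF X]] by (intro LIMSEQ_le_const) auto
qed (rule subspace_C)

sublocale e': semi_inner C e' by (rule e'_semi_inner)

lemma embed_C: "w \<in> V \<Longrightarrow> embed w \<in> C"
  using V_L2 e.cauchy_const by (auto simp: embed_def C_def L.conv_def subset_iff)

lemma embed_diff: "embed (v - w) = embed v - embed w"
  by (simp add: embed_def fun_eq_iff)

lemma e'_embed: "e' (embed v) (embed w) = e v w"
  by (simp add: e'_def embed_def)

lemma e'_embed_approx:
  assumes X: "X \<in> C" and N: "\<And>i. i \<ge> N \<Longrightarrow> sq e (w - fst X i) \<le> c" and w: "w \<in> V"
  shows "sq e' (embed w - X) \<le> c"
proof (rule LIMSEQ_le_const2)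
  show "(\<lambda>n. sq e (fst (embed w - X) n)) \<longlonglongrightarrow> sq e' (embed w - X)"
    using embed_C[OF w] X by (intro e'_lim) auto
  show "\<exists>N. \<forall>n\<ge>N. sq e (fst (embed w - X) n) \<le> c"
    using N by (auto simp: embed_def)
qed

lemma embed_dense:
  assumes X: "X \<in> C" and c: "c > 0"
  obtains N where "sq e' (embed (fst X N) - X) \<le> c"
    "sq (ip M) (fst X N - snd X) \<le> c"
proof -
  obtain N where N: "\<And>i j. i \<ge> N \<Longrightarrow> j \<ge> N \<Longrightarrow> sq e (fst X i - fst X j) < c"
    using C_D(2)[OF X] c unfolding e.cauchy_def by metis
  obtain N' where N': "\<And>i. i \<ge> N' \<Longrightarrow> norm (sq (ip M) (fst X i - snd X) - 0) < c"
    using LIMSEQ_D[OF C_D(4)[OF X, unfolded L.conv_def] c] by blast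
  define K where "K = max N N'"
  have "sq e' (embed (fst X K) - X) \<le> c"
    using N[of K] C_D(1)[OF X]
    by (intro e'_embed_approx[OF X, of N]) (auto simp: K_def intro: less_imp_le)
  moreover have "sq (ip M) (fst X K - snd X) \<le> c"
    using N'[of K] by (simp add: K_def)
  ultimately show ?thesis using that by blast
qed

lemma snd_semi_inner: "semi_inner C (\<lambda>X Y. ip M (snd X) (snd Y))"
  using C_D(3) subspace_C by unfold_locales (auto simp: L.expand L.sym L.nonneg)

lemma graph_semi_inner: "semi_inner C (\<lambda>X Y. e' X Y + ip M (snd X) (snd Y))"
  using semi_inner_plus[OF e'_semi_inner snd_semi_inner subset_refl, of 1] by simp

text \<open>
  A Cauchy sequence of pairs is replaced by embedded elements of \<open>V\<close> that approximate its terms; these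
  elements form the first component of the limit.
\<close>

lemma graph_semi_hilbert: "semi_hilbert C (\<lambda>X Y. e' X Y + ip M (snd X) (snd Y))"
proof -
  interpret g: semi_inner C "\<lambda>X Y. e' X Y + ip M (snd X) (snd Y)" by (rule graph_semi_inner)
  show ?thesis
  proof
    fix S assume S: "\<And>n::nat. S n \<in> C"
      and cau: "\<And>c. c > 0 \<Longrightarrow> \<exists>N. \<forall>i\<ge>N. \<forall>j\<ge>N.
        sq e' (S i - S j) + sq (ip M) (snd (S i - S j)) < c"
    have Ln: "0 \<le> sq (ip M) (snd (S i - S j))" for i j
      using C_D(3)[OF S] by (intro L.nonneg) auto
    have En: "0 \<le> sq e' (S i - S j)" for i j
      using S by (intro e'.nonneg) auto
    have "\<exists>v\<in>L2 M. L.conv (\<lambda>n. snd (S n)) v"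
    proof (rule L.complete)
      fix c :: real assume "c > 0"
      then obtain N where "\<forall>i\<ge>N. \<forall>j\<ge>N.
          sq e' (S i - S j) + sq (ip M) (snd (S i - S j)) < c"
        using cau by blast
      then show "\<exists>N. \<forall>i\<ge>N. \<forall>j\<ge>N. sq (ip M) (snd (S i) - snd (S j)) < c"
        using En by (intro exI[of _ N]) (smt (verit) snd_diff)
    qed (use C_D(3)[OF S] in auto)
    then obtain v where v: "v \<in> L2 M" and Sv: "L.conv (\<lambda>n. snd (S n)) v" by blast
    have "\<exists>K. sq e' (embed (fst (S j) K) - S j) \<le> 1 / real (Suc j)
        \<and> sq (ip M) (fst (S j) K - snd (S j)) \<le> 1 / real (Suc j)" for j
      by (rule embed_dense[OF S, of "1 / real (Suc j)" j]) auto
    then obtain K where K: "\<And>j. sq e' (embed (fst (S j) (K j)) - S j) \<le> 1 / real (Suc j)"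
        "\<And>j. sq (ip M) (fst (S j) (K j) - snd (S j)) \<le> 1 / real (Suc j)"
      by metis
    define y where "y j = fst (S j) (K j)" for j
    have yV: "y j \<in> V" for j unfolding y_def using S C_D(1) by blast
    have yL: "y j \<in> L2 M" for j using yV V_L2 by blast
    note eC = embed_C[OF yV]
    have Ky: "sq e' (embed (y j) - S j) \<le> 1 / real (Suc j)"
        "sq (ip M) (y j - snd (S j)) \<le> 1 / real (Suc j)" for j
      unfolding y_def by (rule K)+
    have inv: "(\<lambda>j. 1 / real (Suc j)) \<longlonglongrightarrow> 0" by (rule LIMSEQ_Suc[OF lim_1_over_n])
    have yc: "e.cauchy y"
      unfolding e.cauchy_def
    proof (intro allI impI)
      fix c :: real assume c: "c > 0"
      obtain N where N: "\<And>i j. i \<ge> N \<Longrightarrow> j \<ge> N \<Longrightarrow>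
          sq e' (S i - S j) + sq (ip M) (snd (S i - S j)) < c / 16"
        using cau[of "c / 16"] c by auto
      obtain N' where N': "1 / real (Suc N') < c / 16" using nat_approx_posE[of "c / 16"] c by auto
      have "sq e (y i - y j) < c" if ij: "i \<ge> max N N'" "j \<ge> max N N'" for i j
      proof -
        have sm: "1 / real (Suc k) < c / 16" if "k \<ge> max N N'" for k
        proof -
          have "1 / real (Suc k) \<le> 1 / real (Suc N')" using that by (intro divide_left_mono) auto
          then show ?thesis using N' by linarith
        qed
        have "sq e (y i - y j) = sq e' (embed (y i) - embed (y j))"
          by (simp add: e'_embed flip: embed_diff)
        moreover have "sq e' (embed (y i) - embed (y j))
            \<le> 2 * sq e' (embed (y i) - S i) + 2 * sq e' (S i - embed (y j))"
          by (intro e'.sq_triangle eC S)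
        moreover have "sq e' (S i - embed (y j))
            \<le> 2 * sq e' (S i - S j) + 2 * sq e' (S j - embed (y j))"
          by (intro e'.sq_triangle eC S)
        moreover have "sq e' (S j - embed (y j)) = sq e' (embed (y j) - S j)"
          by (intro e'.sq_diff_commute eC S)
        moreover have "sq e' (S i - S j) + sq (ip M) (snd (S i - S j)) < c / 16"
          using ij by (intro N) auto
        moreover have "sq e' (embed (y k) - S k) < c / 16" if "k \<ge> max N N'" for k
          using Ky(1) sm[OF that] by (rule le_less_trans)
        note this[OF ij(1)] this[OF ij(2)]
        ultimately show ?thesis
          using Ln[of i j] c by linarith
      qed
      then show "\<exists>N. \<forall>i\<ge>N. \<forall>j\<ge>N. sq e (y i - y j) < c" by blast
    qed
    have yv: "L.conv y v"
      unfolding L.conv_def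
    proof (rule tendsto_null_squeeze[OF _ _ inv Sv[unfolded L.conv_def]])
      fix j
      have "sq (ip M) (y j - v) \<le> 2 * sq (ip M) (y j - snd (S j)) + 2 * sq (ip M) (snd (S j) - v)"
        using C_D(3)[OF S] by (intro L.sq_triangle yL v) auto
      then show "sq (ip M) (y j - v) \<le> 2 * (1 / real (Suc j)) + 2 * sq (ip M) (snd (S j) - v)"
        using Ky(2)[of j] by simp
      show "0 \<le> sq (ip M) (y j - v)" by (intro L.nonneg L.diff_mem yL v)
    qed
    have YC: "(y, v) \<in> C" using yV yc v yv by (simp add: C_def)
    have eyY: "(\<lambda>j. sq e' (embed (y j) - (y, v))) \<longlonglongrightarrow> 0"
    proof (rule LIMSEQ_I)
      fix c :: real assume c: "c > 0"
      obtain N where N: "\<And>i j. i \<ge> N \<Longrightarrow> j \<ge> N \<Longrightarrow> sq e (y i - y j) < c / 2"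
        using yc c unfolding e.cauchy_def by (metis half_gt_zero)
      have "norm (sq e' (embed (y j) - (y, v)) - 0) < c" if "j \<ge> N" for j
      proof -
        have "sq e' (embed (y j) - (y, v)) \<le> c / 2"
          using N[OF that] by (intro e'_embed_approx[OF YC, of N] yV) (auto intro: less_imp_le)
        then show ?thesis
          using e'.nonneg[OF e'.diff_mem[OF eC YC]] c by simp
      qed
      then show "\<exists>N. \<forall>j\<ge>N. norm (sq e' (embed (y j) - (y, v)) - 0) < c" by blast
    qed
    have "g.conv S (y, v)"
      unfolding g.conv_def
    proof (rule Lim_null_comparison[OF eventuallyI])
      fix j
      have "sq e' (S j - (y, v)) \<le> 2 * sq e' (S j - embed (y j))
          + 2 * sq e' (embed (y j) - (y, v))"
        by (intro e'.sq_triangle eC S YC)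
      also have "sq e' (S j - embed (y j)) = sq e' (embed (y j) - S j)"
        by (intro e'.sq_diff_commute eC S)
      finally show "norm (sq e' (S j - (y, v)) + sq (ip M) (snd (S j - (y, v))))
          \<le> 2 * (1 / real (Suc j)) + 2 * sq e' (embed (y j) - (y, v))
            + sq (ip M) (snd (S j) - v)"
        using Ky(1)[of j] g.nonneg[OF g.diff_mem[OF S YC], of j] by simp
      have "(\<lambda>j. 2 * (1 / real (Suc j)) + 2 * sq e' (embed (y j) - (y, v))
          + sq (ip M) (snd (S j) - v)) \<longlonglongrightarrow> 2 * 0 + 2 * 0 + 0"
        using Sv unfolding L.conv_def by (intro tendsto_intros inv eyY)
      then show "(\<lambda>j. 2 * (1 / real (Suc j)) + 2 * sq e' (embed (y j) - (y, v))
          + sq (ip M) (snd (S j) - v)) \<longlonglongrightarrow> 0" by simp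
    qed
    with YC show "\<exists>Y\<in>C. g.conv S Y" by blast
  qed
qed

text \<open>
  Let \<open>x\<close> solve the resolvent equation in the completion.  Then \<open>u\<^sub>l - x\<close> pairs with \<open>w \<in> V\<close> to
  \<open>- l h(u\<^sub>l, w)\<close>, and testing with \<open>u\<^sub>l - w\<close> for \<open>w\<close> close to \<open>x\<close> bounds the norm of \<open>u\<^sub>l - x\<close> by
  \<open>l h(w, w)\<close> plus the distance of \<open>w\<close> to \<open>x\<close>, since \<open>h(u\<^sub>l, u\<^sub>l)\<close> enters with a favourable sign.
\<close>

lemma vanishing_shift:
  assumes h: "semi_inner V h"
  obtains G where "closed_form M G" "V \<subseteq> fdom G"
    "\<And>f u. f \<in> L2 M \<Longrightarrow>
      (\<And>l. l > 0 \<Longrightarrow> u l \<in> V \<and> (\<forall>w\<in>V. e (u l) w + l * h (u l) w + ip M (u l) w = ip M f w)) \<Longrightarrow>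
      ((\<lambda>l. sq (ip M) (u l - resolvent1 M G f)) \<longlongrightarrow> 0) (at_right 0)"
proof -
  interpret h: semi_inner V h by fact
  interpret g: semi_hilbert C "\<lambda>X Y. e' X Y + ip M (snd X) (snd Y)" by (rule graph_semi_hilbert)
  interpret graph_complete_map C e' snd M
    by unfold_locales (auto simp: C_D(3))
  obtain G P where "induced_form C e' snd M G P" using induced_form_exists .
  then interpret G: induced_form C e' snd M G P .
  show ?thesis
  proof (rule that[of G])
    show "closed_form M G" by (rule G.closed)
    show "V \<subseteq> fdom G"
      unfolding G.dom
    proof
      fix v assume v: "v \<in> V"
      then show "v \<in> {v \<in> L2 M. \<exists>x\<in>C. AE t in M. v t = snd x t}"
        using V_L2 embed_C[OF v] by (auto intro!: bexI[of _ "embed v"] simp: embed_def)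
    qed
    fix f u assume f: "f \<in> L2 M"
      and u: "\<And>l. l > 0 \<Longrightarrow> u l \<in> V \<and> (\<forall>w\<in>V. e (u l) w + l * h (u l) w + ip M (u l) w = ip M f w)"
    obtain X where X: "X \<in> C"
      and Xe: "\<And>Y. Y \<in> C \<Longrightarrow> e' X Y + ip M (snd X) (snd Y) = ip M f (snd Y)"
    proof (rule g.riesz[of "\<lambda>Y. ip M f (snd Y)" "ip M f f"])
      fix Y assume Y: "Y \<in> C"
      have "(ip M f (snd Y))\<^sup>2 \<le> ip M f f * ip M (snd Y) (snd Y)"
        using f C_D(3)[OF Y] by (rule L.cauchy_schwarz)
      also have "\<dots> \<le> ip M f f * (e' Y Y + ip M (snd Y) (snd Y))"
        using e'.nonneg[OF Y] L.nonneg[OF f] by (intro mult_left_mono) auto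
      finally show "(ip M f (snd Y))\<^sup>2 \<le> ip M f f * (e' Y Y + ip M (snd Y) (snd Y))" .
    qed (use f C_D(3) in \<open>auto simp: L.expand\<close>)
    have res: "(snd X, f) \<in> res_graph M G"
      using f X Xe by (rule G.resolvent_graph)
    have sX: "snd X \<in> L2 M" and RL: "resolvent1 M G f \<in> L2 M"
      using C_D(3)[OF X] resolvent1_mem[OF G.closed f] by auto
    have Q: "sq (ip M) (u l - snd X) \<le> l * h w w
        + (sq e' (embed w - X) + sq (ip M) (w - snd X))"
      if l: "l > 0" and w: "w \<in> V" for l w
    proof -
      define B where "B = (\<lambda>X Y. e' X Y + ip M (snd X) (snd Y))"
      interpret B: semi_inner C B unfolding B_def by (rule graph_semi_inner)
      have uV: "u l \<in> V" using u[OF l] by simp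
      note UC = embed_C[OF uV] and wC = embed_C[OF w]
      define D where "D = embed (u l) - X"
      have D: "D \<in> C" unfolding D_def using UC X by (rule B.diff_mem)
      have Bw: "B D (embed v) = - (l * h (u l) v)" if v: "v \<in> V" for v
      proof -
        have "B (embed (u l)) (embed v) = e (u l) v + ip M (u l) v"
          unfolding B_def e'_embed by (simp add: embed_def)
        moreover have "B X (embed v) = ip M f v"
          using Xe[OF embed_C[OF v]] unfolding B_def by (simp add: embed_def)
        moreover have "e (u l) v + l * h (u l) v + ip M (u l) v = ip M f v"
          using u[OF l] v by blast
        ultimately show ?thesis
          using UC X embed_C[OF v] unfolding D_def by (simp add: B.diff_left)
      qed
      \<comment> \<open>Split \<open>D = embed (u l - w) + (embed w - X)\<close>: the first part lies in \<open>V\<close>, the second is small.\<close>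
      have "B D D = B D (embed (u l - w)) + B D (embed w - X)"
        using D UC wC X unfolding embed_diff by (simp add: D_def B.diff_right)
      also have "B D (embed (u l - w)) = l * (h (u l) w - h (u l) (u l))"
        using Bw[OF e.diff_mem[OF uV w]] uV w by (simp add: h.diff_right algebra_simps)
      also have "\<dots> \<le> l * (h w w / 2)"
        using h.young[OF uV w] h.nonneg[OF uV] l by (intro mult_left_mono) auto
      also have "B D (embed w - X) \<le> B D D / 2 + sq B (embed w - X) / 2"
        using B.young[OF D B.diff_mem[OF wC X]] by simp
      finally have "B D D \<le> l * h w w + sq B (embed w - X)" by simp
      moreover have "sq (ip M) (u l - snd X) \<le> B D D"
        using e'.nonneg[OF D] unfolding B_def by (simp add: D_def embed_def)
      ultimately show ?thesis unfolding B_def by (simp add: embed_def)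
    qed
    have "((\<lambda>l. sq (ip M) (u l - snd X)) \<longlongrightarrow> 0) (at_right 0)"
    proof (rule tendstoI)
      fix c :: real assume c: "c > 0"
      obtain N where N: "sq e' (embed (fst X N) - X) \<le> c / 4"
        "sq (ip M) (fst X N - snd X) \<le> c / 4"
        using embed_dense[OF X, of "c / 4"] c by auto
      define w where "w = fst X N"
      have w: "w \<in> V" unfolding w_def using C_D(1)[OF X] .
      have hw: "h w w + 1 > 0" using h.nonneg[OF w] by simp
      have "\<forall>\<^sub>F l in at_right 0. l < c / (2 * (h w w + 1))"
        using c hw by (intro eventually_at_right_less[THEN eventually_mono]
            order_tendstoD(2)[OF tendsto_ident_at]) auto
      moreover have "\<forall>\<^sub>F l in at_right (0::real). l > 0"
        by (rule eventually_at_right_less)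
      ultimately show "\<forall>\<^sub>F l in at_right 0. dist (sq (ip M) (u l - snd X)) 0 < c"
      proof eventually_elim
        case (elim l)
        have "l * h w w \<le> l * (h w w + 1)" using elim by simp
        also have "\<dots> < c / 2" using elim hw by (simp add: field_simps)
        finally have "sq (ip M) (u l - snd X) < c"
          using Q[OF elim(2) w] N unfolding w_def by simp
        moreover have "0 \<le> sq (ip M) (u l - snd X)"
          using u[OF elim(2)] V_L2 sX by (intro L.nonneg) auto
        ultimately show ?case by simp
      qed
    qed
    moreover have "\<forall>\<^sub>F l in at_right 0. sq (ip M) (u l - snd X)
        = sq (ip M) (u l - resolvent1 M G f)"
      using eventually_at_right_less[of "0::real"]
    proof eventually_elim
      case (elim l)
      have "u l \<in> L2 M" using u[OF elim] V_L2 by blast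
      then show ?case
        by (intro ip_AE_cong L2_measurable L.diff_mem sX RL)
          (use resolvent1_AE_eqI[OF G.closed res] in auto)
    qed
    ultimately show "((\<lambda>l. sq (ip M) (u l - resolvent1 M G f)) \<longlongrightarrow> 0) (at_right 0)"
      by (rule Lim_transform_eventually)
  qed
qed

end

section \<open>Total and dense sets for Radon measures\<close>

text \<open>
  The finite intersections of the relatively compact members of a countable base.
\<close>

lemma relatively_compact_pi_basis:
  assumes lc: "locally_compact_space (euclidean :: 'a::{metric_space, second_countable_topology} topology)"
  obtains \<U> :: "'a::{metric_space, second_countable_topology} set set"
  where "countable \<U>" "\<U> \<noteq> {}" "\<Union>\<U> = UNIV" "Int_stable \<U>" "\<And>U. U \<in> \<U> \<Longrightarrow> open U" "\<And>U. U \<in> \<U> \<Longrightarrow> compact (closure U)" "sets borel = sigma_sets UNIV \<U>"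
proof -
  obtain B :: "'a set set" where B: "countable B" "topological_basis B"
    using ex_countable_basis by auto
  define B' where "B' = {b \<in> B. compact (closure b)}"
  define \<U> where "\<U> = Inter ` {S. finite S \<and> S \<subseteq> B' \<and> S \<noteq> {}}"
  have B'U: "b \<in> \<U>" if "b \<in> B'" for b
    unfolding \<U>_def using that by (intro image_eqI[of _ _ "{b}"]) auto
  have opn: "open U" if "U \<in> \<U>" for U
    using that topological_basis_open[OF B(2)] by (auto simp: \<U>_def B'_def intro!: open_Inter)
  have cpt: "compact (closure U)" if U: "U \<in> \<U>" for U
  proof -
    obtain S b where S: "U = \<Inter>S" "b \<in> S" "S \<subseteq> B'" using U by (auto simp: \<U>_def)
    then have "closure U \<subseteq> closure b" by (intro closure_mono) auto
    moreover have "compact (closure b)" using S by (auto simp: B'_def)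
    ultimately show ?thesis using closed_closure by (metis Int_absorb1 compact_Int_closed)
  qed
  have cnt: "countable \<U>"
  proof -
    have "countable {S. finite S \<and> S \<subseteq> B'}"
      using B(1) by (intro countable_Collect_finite_subset) (auto simp: B'_def)
    then show ?thesis unfolding \<U>_def by (auto intro: countable_image countable_subset[rotated])
  qed
  have ex: "\<exists>b\<in>\<U>. x \<in> b \<and> b \<subseteq> O'" if O': "open O'" "x \<in> O'" for x O'
  proof -
    obtain U K where UK: "open U" "compact K" "x \<in> U" "U \<subseteq> K"
      using lc unfolding locally_compact_space_def by simp blast
    obtain b where b: "b \<in> B" "x \<in> b" "b \<subseteq> O' \<inter> U"
      using topological_basisE[OF B(2), of "O' \<inter> U" x] O' UK by auto
    have "closure b \<subseteq> K"
      using b UK by (intro closure_minimal compact_imp_closed) auto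
    then have "compact (closure b)"
      using UK(2) closed_closure by (metis Int_absorb1 compact_Int_closed)
    then have "b \<in> B'" using b by (simp add: B'_def)
    then show ?thesis using B'U b by blast
  qed
  have basis: "topological_basis \<U>"
    using opn ex by (intro topological_basisI) auto
  have Un: "\<Union>\<U> = UNIV"
    using ex[of UNIV] by auto
  have stable: "Int_stable \<U>"
    unfolding Int_stable_def
  proof (intro ballI)
    fix a b assume "a \<in> \<U>" "b \<in> \<U>"
    then obtain S S' where "a = \<Inter>S" "b = \<Inter>S'" "finite S" "S \<subseteq> B'" "S \<noteq> {}" "finite S'" "S' \<subseteq> B'"
      by (auto simp: \<U>_def)
    then show "a \<inter> b \<in> \<U>"
      unfolding \<U>_def by (intro image_eqI[of _ _ "S \<union> S'"]) auto
  qed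
  have "sets borel = sigma_sets UNIV \<U>"
    by (subst borel_eq_countable_basis[OF cnt basis]) (simp add: sets_measure_of)
  moreover have "\<U> \<noteq> {}" using Un by auto
  ultimately show ?thesis using that cnt Un stable opn cpt by blast
qed

lemma radon_measurable:
  assumes "radon_measure M" "f \<in> borel_measurable borel"
  shows "f \<in> borel_measurable M"
  using assms measurable_cong_sets[of M borel borel borel] by (auto simp: radon_measure_def)

lemma indicator_L2:
  assumes "A \<in> sets M" "emeasure M A < \<infinity>"
  shows "(indicator A :: 'a \<Rightarrow> real) \<in> L2 M"
proof -
  have "(\<lambda>x. (indicator A x :: real)\<^sup>2) = indicator A"
    by (auto simp: fun_eq_iff indicator_def)
  then show ?thesis using assms by (auto simp: L2_def)
qed

lemma relatively_compact_finite:
  assumes "radon_measure M" "open U" "compact (closure U)"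
  shows "U \<in> sets M" "emeasure M U < \<infinity>"
proof -
  show U: "U \<in> sets M" using assms by (simp add: radon_measure_def)
  have "emeasure M U \<le> emeasure M (closure U)"
    using assms by (intro emeasure_mono closure_subset) (auto simp: radon_measure_def)
  also have "\<dots> < \<infinity>" using assms by (auto simp: radon_measure_def)
  finally show "emeasure M U < \<infinity>" .
qed

text \<open>
  The measures with densities \<open>f\<^sup>+\<close> and \<open>f\<^sup>-\<close> agree on a generator that is stable under intersections,
  hence they are equal.
\<close>

lemma L2_orthogonal_to_indicators:
  fixes M :: "'a::{metric_space, second_countable_topology} measure"
  assumes M: "radon_measure M" and f: "f \<in> L2 M"
    and \<U>: "countable \<U>" "\<Union>\<U> = UNIV" "Int_stable \<U>" "sets borel = sigma_sets UNIV \<U>"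
      "\<And>U. U \<in> \<U> \<Longrightarrow> open U" "\<And>U. U \<in> \<U> \<Longrightarrow> compact (closure U)"
    and orth: "\<And>U. U \<in> \<U> \<Longrightarrow> ip M f (indicator U) = 0"
  shows "AE x in M. f x = 0"
proof -
  have sM: "sets M = sets borel" using M by (simp add: radon_measure_def)
  then have spM: "space M = UNIV" using sets_eq_imp_space_eq[of M borel] by simp
  note fin = relatively_compact_finite[OF M \<U>(5,6)]
  interpret sigma_finite_measure M
  proof
    show "\<exists>A. countable A \<and> A \<subseteq> sets M \<and> \<Union> A = space M \<and> (\<forall>a\<in>A. emeasure M a \<noteq> \<infinity>)"
      using \<U>(1,2) fin spM by (intro exI[of _ \<U>]) (auto dest: less_imp_neq)
  qed
  have fm [measurable]: "f \<in> borel_measurable M" using f by (rule L2_measurable)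
  have int: "integrable M (\<lambda>x. f x * indicator U x)" if "U \<in> \<U>" for U
    by (rule L2_integrable_mult[OF f indicator_L2[OF fin[OF that that]]])
  have ipm: "integrable M (\<lambda>x. max 0 (s * f x) * indicator U x)" if U: "U \<in> \<U>" for U and s :: real
  proof -
    have "integrable M (\<lambda>x. max 0 (s * (f x * indicator U x)))"
      by (intro integrable_max integrable_zero integrable_mult_right int U)
    then show ?thesis
      by (rule Bochner_Integration.integrable_cong[THEN iffD1, rotated -1]) (auto simp: indicator_def)
  qed
  have pm: "emeasure (density M (\<lambda>x. ennreal (s * f x))) U = ennreal (\<integral>x. max 0 (s * f x) * indicator U x \<partial>M)"
    if U: "U \<in> \<U>" for U and s :: real
  proof -
    have "integrable M (\<lambda>x. max 0 (s * f x) * indicator U x)" using U by (rule ipm)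
    then have "(\<integral>\<^sup>+x. ennreal (max 0 (s * f x) * indicator U x) \<partial>M) = ennreal (\<integral>x. max 0 (s * f x) * indicator U x \<partial>M)"
      by (intro nn_integral_eq_integral) auto
    moreover have "emeasure (density M (\<lambda>x. ennreal (s * f x))) U = (\<integral>\<^sup>+x. ennreal (s * f x) * indicator U x \<partial>M)"
      using fin[OF U U] by (intro emeasure_density) auto
    moreover have "\<dots> = (\<integral>\<^sup>+x. ennreal (max 0 (s * f x) * indicator U x) \<partial>M)"
      by (intro nn_integral_cong) (auto simp: indicator_def max_def ennreal_neg)
    ultimately show ?thesis by simp
  qed
  have "density M (\<lambda>x. ennreal (1 * f x)) = density M (\<lambda>x. ennreal (-1 * f x))"
  proof (rule measure_eqI_generator_eq_countable[of \<U> UNIV _ _ \<U>])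
    fix U assume U: "U \<in> \<U>"
    have "(\<integral>x. max 0 (1 * f x) * indicator U x \<partial>M) - (\<integral>x. max 0 (-1 * f x) * indicator U x \<partial>M)
        = (\<integral>x. max 0 (1 * f x) * indicator U x - max 0 (-1 * f x) * indicator U x \<partial>M)"
      by (intro Bochner_Integration.integral_diff[symmetric] ipm U)
    also have "\<dots> = (\<integral>x. f x * indicator U x \<partial>M)"
      by (intro Bochner_Integration.integral_cong) (auto simp: max_def indicator_def)
    also have "\<dots> = 0" using orth[OF U] by (simp add: ip_def)
    finally show "emeasure (density M (\<lambda>x. ennreal (1 * f x))) U = emeasure (density M (\<lambda>x. ennreal (-1 * f x))) U"
      unfolding pm[OF U] by simp
  next
    show "emeasure (density M (\<lambda>x. ennreal (1 * f x))) U \<noteq> \<infinity>" if "U \<in> \<U>" for U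
      unfolding pm[OF that] by simp
  qed (use \<U> sM in auto)
  then have "AE x in M. ennreal (1 * f x) = ennreal (-1 * f x)"
    by (intro density_unique) auto
  then show ?thesis
  proof eventually_elim
    case (elim x)
    show ?case
    proof (rule ccontr)
      assume "f x \<noteq> 0"
      then consider "f x > 0" | "f x < 0" by linarith
      then show False using elim by cases (auto simp: ennreal_neg)
    qed
  qed
qed

lemma Cc_L2:
  fixes M :: "'a::metric_space measure"
  assumes M: "radon_measure M" and f: "f \<in> Cc"
  shows "f \<in> L2 M"
proof -
  define K where "K = closure {x. f x \<noteq> 0}"
  have K: "compact K" and cont: "continuous_on UNIV f" using f by (auto simp: Cc_def K_def)
  have fK: "f x = 0" if "x \<notin> K" for x
    using that closure_subset[of "{x. f x \<noteq> 0}"] by (auto simp: K_def)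
  have Kset: "K \<in> sets M" using M K by (auto simp: radon_measure_def compact_imp_closed)
  have Kfin: "emeasure M K < \<infinity>" using M K by (auto simp: radon_measure_def)
  have "f \<in> borel_measurable borel" using cont by (rule borel_measurable_continuous_onI)
  then have fm [measurable]: "f \<in> borel_measurable M" by (rule radon_measurable[OF M])
  have "compact (f ` K)"
    by (rule compact_continuous_image[OF continuous_on_subset[OF cont subset_UNIV] K])
  then have "bounded (f ` K)" by (rule compact_imp_bounded)
  then obtain B where B: "\<And>x. x \<in> K \<Longrightarrow> \<bar>f x\<bar> \<le> B"
    by (auto simp: bounded_iff)
  have "integrable M (\<lambda>x. (f x)\<^sup>2)"
  proof (rule Bochner_Integration.integrable_bound)
    show "integrable M (\<lambda>x. B\<^sup>2 * indicator K x)"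
      using Kset Kfin by (intro integrable_mult_right) simp
    show "AE x in M. norm ((f x)\<^sup>2) \<le> norm (B\<^sup>2 * indicator K x)"
    proof (rule AE_I2)
      fix x
      show "norm ((f x)\<^sup>2) \<le> norm (B\<^sup>2 * indicator K x)"
      proof (cases "x \<in> K")
        case True
        have "\<bar>f x\<bar>\<^sup>2 \<le> B\<^sup>2" using B[OF True] by (intro power_mono) auto
        then show ?thesis using True by simp
      qed (simp add: fK)
    qed
  qed measurable
  then show ?thesis using fm by (simp add: L2_def)
qed

lemma Cc_approx_indicator:
  fixes U :: "'a::metric_space set"
  assumes U: "open U" "compact (closure U)"
  obtains g :: "nat \<Rightarrow> 'a \<Rightarrow> real" where "\<And>n. g n \<in> Cc" "\<And>n x. \<bar>g n x\<bar> \<le> indicator U x"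
    "\<And>x. (\<lambda>n. g n x) \<longlonglongrightarrow> indicator U x"
proof (cases "U = UNIV")
  case True
  then show ?thesis
    using U that[of "\<lambda>n x. 1"] by (auto simp: Cc_def)
next
  case False
  define g where "g n x = min 1 (real n * infdist x (- U))" for n x
  have z: "infdist x (- U) = 0 \<longleftrightarrow> x \<notin> U" for x
    using in_closed_iff_infdist_zero[of "- U" x] U False by auto
  have supp: "{x. g n x \<noteq> 0} \<subseteq> U" for n
  proof
    fix x assume "x \<in> {x. g n x \<noteq> 0}"
    then have "infdist x (- U) \<noteq> 0" by (auto simp: g_def)
    then show "x \<in> U" by (simp add: z)
  qed
  have g0: "0 \<le> g n x" for n x by (simp add: g_def infdist_nonneg)
  have "g n \<in> Cc" for n
  proof -
    have "continuous_on UNIV (g n)"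
      unfolding g_def by (intro continuous_intros)
    moreover have "compact (closure {x. g n x \<noteq> 0})"
      using U closure_mono[OF supp] closed_closure by (metis Int_absorb1 compact_Int_closed)
    ultimately show ?thesis by (simp add: Cc_def)
  qed
  moreover have "\<bar>g n x\<bar> \<le> indicator U x" for n x
    using supp[of n] g0[of n x] by (auto simp: indicator_def g_def)
  moreover have "(\<lambda>n. g n x) \<longlonglongrightarrow> indicator U x" for x
  proof (cases "x \<in> U")
    case True
    then have p: "infdist x (- U) > 0" using z[of x] infdist_nonneg[of x "- U"] by linarith
    obtain N :: nat where N: "1 / infdist x (- U) < real N" using reals_Archimedean2 by blast
    have "\<forall>\<^sub>F n in sequentially. g n x = 1"
      using eventually_ge_at_top[of N]
    proof eventually_elim
      case (elim n)
      then have "1 / infdist x (- U) < real n" using N by linarith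
      then have "1 < real n * infdist x (- U)" using p by (simp add: field_simps)
      then show ?case by (simp add: g_def)
    qed
    then show ?thesis using True by (simp add: tendsto_eventually)
  next
    case False
    then show ?thesis using z[of x] by (simp add: g_def)
  qed
  ultimately show ?thesis using that by blast
qed

text \<open>
  Dominated convergence is available because \<open>f\<close> is integrable over the relatively compact set.
\<close>

lemma orthogonal_Cc_imp_orthogonal_indicator:
  fixes M :: "'a::metric_space measure"
  assumes M: "radon_measure M" and f: "f \<in> L2 M" and orth: "\<And>g. g \<in> Cc \<Longrightarrow> ip M f g = 0"
    and U: "open U" "compact (closure U)"
  shows "ip M f (indicator U) = 0"
proof -
  obtain g :: "nat \<Rightarrow> 'a \<Rightarrow> real" where g: "\<And>n. g n \<in> Cc" "\<And>n x. \<bar>g n x\<bar> \<le> indicator U x"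
    "\<And>x. (\<lambda>n. g n x) \<longlonglongrightarrow> indicator U x"
    using Cc_approx_indicator[OF U] by metis
  note fin = relatively_compact_finite[OF M U]
  note [measurable] = L2_measurable[OF f] L2_measurable[OF Cc_L2[OF M g(1)]] fin(1)
  have "(\<lambda>n. \<integral>x. f x * g n x \<partial>M) \<longlonglongrightarrow> (\<integral>x. f x * indicator U x \<partial>M)"
  proof (rule integral_dominated_convergence)
    show "integrable M (\<lambda>x. \<bar>f x * indicator U x\<bar>)"
      using L2_integrable_mult[OF f indicator_L2[OF fin]] by (rule integrable_abs)
    show "AE x in M. (\<lambda>n. f x * g n x) \<longlonglongrightarrow> f x * indicator U x"
      by (intro AE_I2 tendsto_mult tendsto_const g(3))
    show "AE x in M. norm (f x * g n x) \<le> \<bar>f x * indicator U x\<bar>" for n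
    proof (rule AE_I2)
      fix x
      have "\<bar>f x\<bar> * \<bar>g n x\<bar> \<le> \<bar>f x\<bar> * indicator U x" using g(2) by (intro mult_left_mono) auto
      then show "norm (f x * g n x) \<le> \<bar>f x * indicator U x\<bar>" by (simp add: abs_mult)
    qed
  qed measurable
  then have "(\<lambda>n. 0) \<longlonglongrightarrow> ip M f (indicator U)"
    using orth[OF g(1)] by (simp add: ip_def)
  then show ?thesis by (simp add: LIMSEQ_const_iff)
qed

lemma Cc_total:
  fixes M :: "'a::{metric_space, second_countable_topology} measure"
  assumes "locally_compact_space (euclidean :: 'a topology)"
    and M: "radon_measure M" and f: "f \<in> L2 M" and orth: "\<And>g. g \<in> Cc \<Longrightarrow> ip M f g = 0"
  shows "AE x in M. f x = 0"
proof -
  obtain \<U> :: "'a set set" where "countable \<U>" "\<U> \<noteq> {}" "\<Union>\<U> = UNIV" "Int_stable \<U>"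
    "\<And>U. U \<in> \<U> \<Longrightarrow> open U" "\<And>U. U \<in> \<U> \<Longrightarrow> compact (closure U)" "sets borel = sigma_sets UNIV \<U>"
    using relatively_compact_pi_basis[OF assms(1)] by metis
  then show ?thesis
    using orthogonal_Cc_imp_orthogonal_indicator[OF M f orth]
    by (intro L2_orthogonal_to_indicators[OF M f, of \<U>]) auto
qed

text \<open>
  A uniform approximation \<open>g\<close> of \<open>f \<in> C\<^sub>c\<close> may have a large support.  Subtracting from it the truncation
  at height \<open>\<epsilon>\<close> on both sides, which is a combination of unit contractions, moves it by at most \<open>\<epsilon>\<close> and
  makes it vanish where \<open>\<bar>g\<bar> \<le> \<epsilon>\<close>, in particular outside the support of \<open>f\<close>.
\<close>

lemma regular_approx_L2:
  fixes m \<mu> :: "'a::metric_space measure"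
  assumes E: "regular_dirichlet_form m E" and \<mu>: "radon_measure \<mu>" and f: "f \<in> Cc" and e: "e > 0"
  obtains u where "u \<in> fdom E" "u \<in> Cc" "ip \<mu> (f - u) (f - u) < e"
proof -
  have D: "dirichlet_form m E" using E by (simp add: regular_dirichlet_form_def)
  then have pos: "positive_form m E" by (simp add: dirichlet_form_def closed_form_def)
  interpret E: semi_inner "fdom E" "bil E" using pos by (rule positive_form_semi_inner)
  define K where "K = closure {x. f x \<noteq> 0}"
  have K: "compact K" using f by (auto simp: Cc_def K_def)
  have fK: "f x = 0" if "x \<notin> K" for x
    using that closure_subset[of "{x. f x \<noteq> 0}"] by (auto simp: K_def)
  have Kset: "K \<in> sets \<mu>" using \<mu> K by (auto simp: radon_measure_def compact_imp_closed)
  have Kfin: "emeasure \<mu> K < \<infinity>" using \<mu> K by (auto simp: radon_measure_def)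
  define c where "c = measure \<mu> K + 1"
  have c: "c > 0" by (simp add: c_def add_nonneg_pos)
  define d where "d = sqrt (e / (4 * c)) / 2"
  have d: "d > 0" using e c by (simp add: d_def)
  have d2: "4 * d\<^sup>2 * c < e" using e c by (simp add: d_def power_divide)
  obtain g where g: "g \<in> fdom E" "g \<in> Cc" "\<And>x. \<bar>f x - g x\<bar> < d"
    using E f d unfolding regular_dirichlet_form_def by blast
  define h where "h s x = min (max ((s / d) * g x) 0) 1" for s x
  define u where "u = g - d *\<^sub>R h 1 + d *\<^sub>R h (-1)"
  have hE: "h s \<in> fdom E" for s
  proof -
    have "(s / d) *\<^sub>R g \<in> fdom E" using g by auto
    then have "(\<lambda>x. min (max (((s / d) *\<^sub>R g) x) 0) 1) \<in> fdom E"
      using D unfolding dirichlet_form_def by blast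
    moreover have "(\<lambda>x. min (max (((s / d) *\<^sub>R g) x) 0) 1) = h s"
      by (simp add: h_def fun_eq_iff)
    ultimately show ?thesis by simp
  qed
  have uE: "u \<in> fdom E" unfolding u_def using g hE by auto
  have ux: "u x = g x - d * min (max (g x / d) 0) 1 + d * min (max (- (g x / d)) 0) 1" for x
    by (simp add: u_def h_def)
  have ug: "\<bar>u x - g x\<bar> \<le> d" for x
  proof (cases "g x \<ge> 0")
    case True
    then have "u x = g x - d * min (g x / d) 1" using d by (simp add: ux)
    moreover have "0 \<le> d * min (g x / d) 1" "d * min (g x / d) 1 \<le> d * 1"
      using True d by (auto intro!: mult_left_mono)
    ultimately show ?thesis by simp
  next
    case False
    then have "g x / d < 0" using d by (simp add: field_simps)
    then have "u x = g x + d * min (- (g x / d)) 1" by (simp add: ux)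
    moreover have "0 \<le> d * min (- (g x / d)) 1" "d * min (- (g x / d)) 1 \<le> d * 1"
      using \<open>g x / d < 0\<close> d by (intro mult_nonneg_nonneg mult_left_mono; simp)+
    ultimately show ?thesis by simp
  qed
  have u0: "u x = 0" if "f x = 0" for x
  proof -
    have "\<bar>g x\<bar> < d" using g(3)[of x] that by simp
    then have "- 1 < g x / d" "g x / d < 1" using d by (auto simp: field_simps abs_less_iff)
    then show ?thesis using d by (cases "g x / d \<ge> 0") (auto simp: ux min_def max_def)
  qed
  have "continuous_on UNIV g" using g by (simp add: Cc_def)
  then have "continuous_on UNIV u"
    unfolding u_def h_def fun_diff_def plus_fun_def scaleR_fun_def by (intro continuous_intros)
  moreover have "compact (closure {x. u x \<noteq> 0})"
  proof -
    have "closure {x. u x \<noteq> 0} \<subseteq> K"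
      unfolding K_def using u0 by (intro closure_mono) auto
    then show ?thesis using K closed_closure by (metis Int_absorb1 compact_Int_closed)
  qed
  ultimately have uC: "u \<in> Cc" by (simp add: Cc_def)
  have fuL: "f - u \<in> L2 \<mu>"
    using Cc_L2[OF \<mu> f] Cc_L2[OF \<mu> uC] L2_subspace subspace_diff by blast
  have i: "integrable \<mu> (\<lambda>x. (2 * d)\<^sup>2 * indicator K x)"
    using Kset Kfin by (intro integrable_mult_right) simp
  have "ip \<mu> (f - u) (f - u) = (\<integral>x. ((f - u) x)\<^sup>2 \<partial>\<mu>)" by (simp add: ip_def power2_eq_square)
  also have "\<dots> \<le> (\<integral>x. (2 * d)\<^sup>2 * indicator K x \<partial>\<mu>)"
  proof (rule integral_mono[OF L2_integrable_square[OF fuL] i])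
    fix x
    show "((f - u) x)\<^sup>2 \<le> (2 * d)\<^sup>2 * indicator K x"
    proof (cases "x \<in> K")
      case True
      have "\<bar>f x - u x\<bar> \<le> 2 * d" using g(3)[of x] ug[of x] by linarith
      then have "\<bar>f x - u x\<bar>\<^sup>2 \<le> (2 * d)\<^sup>2" by (intro power_mono) auto
      then show ?thesis using True by simp
    qed (simp add: fK u0)
  qed
  also have "\<dots> = 4 * d\<^sup>2 * measure \<mu> K" using Kset by (simp add: power_mult_distrib)
  also have "\<dots> \<le> 4 * d\<^sup>2 * c" unfolding c_def by (intro mult_left_mono) auto
  also have "\<dots> < e" by (rule d2)
  finally show ?thesis using that uE uC by blast
qed

section \<open>Capacity and quasi-continuous functions\<close>

(* From here on the shifted forms are treated as inner products in their own right. *)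
declare shift_form_simps(2) [simp del]

lemma (in semi_inner) norm_sum:
  assumes "finite I" "\<And>i. i \<in> I \<Longrightarrow> x i \<in> V"
  shows "(\<Sum>i\<in>I. x i) \<in> V \<and> sqrt (sq b (\<Sum>i\<in>I. x i)) \<le> (\<Sum>i\<in>I. sqrt (b (x i) (x i)))"
  using assms
proof (induction I rule: finite_induct)
  case (insert i I)
  then show ?case
    using norm_triangle[of "x i" "\<Sum>i\<in>I. x i"] by auto
qed simp

definition clip :: "('a \<Rightarrow> real) \<Rightarrow> 'a \<Rightarrow> real" where
  "clip u x = min (max (u x) 0) 1"

lemma clip_range: "0 \<le> clip u x" "clip u x \<le> 1" "1 \<le> u x \<Longrightarrow> clip u x = 1"
  by (auto simp: clip_def)

locale dirichlet_form_space =
  fixes m :: "'a::topological_space measure" and E :: "'a form"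
  assumes dirichlet: "dirichlet_form m E"
begin

abbreviation "E1 \<equiv> form1 m E"

lemma closed: "closed_form m E" and pos: "positive_form m E"
  using dirichlet by (auto simp: dirichlet_form_def closed_form_def)

sublocale H: semi_hilbert "fdom E" E1
  using closed by (rule closed_form_semi_hilbert)

sublocale Lm: semi_hilbert "L2 m" "ip m" by (rule L2_semi_hilbert)

lemma dom_L2: "u \<in> fdom E \<Longrightarrow> u \<in> L2 m"
  using pos by (rule positive_form_L2)

lemma form_nonneg: "u \<in> fdom E \<Longrightarrow> 0 \<le> bil E u u"
  using semi_inner.nonneg[OF positive_form_semi_inner[OF pos]] .

lemma ip_le_E1: "u \<in> fdom E \<Longrightarrow> ip m u u \<le> E1 u u"
  using form_nonneg by (simp add: shift_form_simps)

lemma clip_mem: "u \<in> fdom E \<Longrightarrow> clip u \<in> fdom E"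
  and clip_form_le: "u \<in> fdom E \<Longrightarrow> sq (bil E) (clip u) \<le> bil E u u"
  using dirichlet by (auto simp: dirichlet_form_def clip_def[abs_def])

lemma clip_E1_le:
  assumes u: "u \<in> fdom E"
  shows "sq E1 (clip u) \<le> E1 u u"
proof -
  have "sq (ip m) (clip u) \<le> ip m u u"
    unfolding ip_def
  proof (rule integral_mono)
    show "integrable m (\<lambda>x. clip u x * clip u x)" "integrable m (\<lambda>x. u x * u x)"
      using L2_integrable_mult dom_L2 clip_mem u by blast+
    fix x
    have "\<bar>clip u x\<bar> \<le> \<bar>u x\<bar>" by (auto simp: clip_def)
    then have "\<bar>clip u x\<bar> * \<bar>clip u x\<bar> \<le> \<bar>u x\<bar> * \<bar>u x\<bar>" by (intro mult_mono) auto
    then show "clip u x * clip u x \<le> u x * u x" by simp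
  qed
  then show ?thesis using clip_form_le[OF u] by (simp add: shift_form_simps)
qed

lemma capacity_le_open_capacity: "open U \<Longrightarrow> A \<subseteq> U \<Longrightarrow> capacity m E A \<le> open_capacity m E U"
  unfolding capacity_def by (intro Inf_lower) auto

text \<open>
  Test functions for the capacity may be taken nonnegative everywhere, by the unit contraction.
\<close>

lemma capacity_witness:
  assumes "capacity m E A < ennreal e"
  obtains w where "w \<in> fdom E" "\<And>x. 0 \<le> w x" "AE x in m. x \<in> A \<longrightarrow> 1 \<le> w x" "E1 w w < e"
proof -
  obtain U where U: "A \<subseteq> U" "open_capacity m E U < ennreal e"
    using assms unfolding capacity_def Inf_less_iff by auto
  then obtain u where u: "u \<in> fdom E" "AE x in m. x \<in> U \<longrightarrow> 1 \<le> u x" "ennreal (E1 u u) < ennreal e"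
    unfolding open_capacity_def Inf_less_iff by auto
  have "E1 u u < e"
    using u(3) H.nonneg[OF u(1)] by (simp add: ennreal_less_iff)
  then have "sq E1 (clip u) < e" using clip_E1_le[OF u(1)] by linarith
  moreover have "AE x in m. x \<in> A \<longrightarrow> 1 \<le> clip u x"
    using u(2) by eventually_elim (use U clip_range(3) in fastforce)
  ultimately show ?thesis using that[OF clip_mem[OF u(1)] clip_range(1)] by simp
qed

text \<open>
  The square root of the capacity is countably subadditive, up to the choice of the test functions:
  the sum of nonnegative test functions is a test function for the union, and norms add up.
\<close>

lemma open_capacity_Union_le:
  fixes w :: "nat \<Rightarrow> 'a \<Rightarrow> real"
  assumes w: "\<And>n. w n \<in> fdom E" "\<And>n x. 0 \<le> w n x"
    and U: "\<And>n. AE x in m. x \<in> U n \<longrightarrow> 1 \<le> w n x"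
    and sm: "summable (\<lambda>n. sqrt (E1 (w n) (w n)))" and r: "(\<Sum>n. sqrt (E1 (w n) (w n))) \<le> r"
  shows "open_capacity m E (\<Union>n. U n) \<le> ennreal (r\<^sup>2)"
proof -
  define a where "a n = sqrt (E1 (w n) (w n))" for n
  define s where "s n = (\<Sum>i<n. w i)" for n
  have a0: "0 \<le> a n" for n using H.nonneg[OF w(1)] by (simp add: a_def)
  have sE: "s n \<in> fdom E" for n
    unfolding s_def using H.norm_sum[of "{..<n}" w] w(1) by auto
  have sx: "s n x = (\<Sum>i<n. w i x)" for n x
    unfolding s_def by (induction n) auto
  have nrm: "sqrt (E1 (s n) (s n)) \<le> (\<Sum>i<n. a i)" for n
    unfolding s_def a_def using H.norm_sum[of "{..<n}" w] w(1) by auto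
  have dif: "sqrt (sq E1 (s j - s i)) \<le> (\<Sum>k\<in>{i..<j}. a k)" if "i \<le> j" for i j
  proof -
    have "s j - s i = (\<Sum>k\<in>{i..<j}. w k)"
      unfolding s_def using that by (simp add: lessThan_atLeast0 sum_diff_nat_ivl)
    then show ?thesis
      unfolding a_def using H.norm_sum[of "{i..<j}" w] w(1) by auto
  qed
  have "\<exists>v\<in>fdom E. H.conv s v"
  proof (rule H.complete[OF sE])
    fix e :: real assume e: "e > 0"
    obtain N where N: "\<And>i j. i \<ge> N \<Longrightarrow> norm (sum a {i..<j}) < sqrt e"
      using sm e unfolding a_def[symmetric] summable_Cauchy by (meson real_sqrt_gt_zero)
    have *: "sq E1 (s j - s i) < e" if "i \<ge> N" "i \<le> j" for i j
    proof -
      have "sqrt (sq E1 (s j - s i)) < sqrt e"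
        using dif[OF that(2)] N[OF that(1), of j] unfolding real_norm_def by linarith
      then show ?thesis by simp
    qed
    have "sq E1 (s i - s j) < e" if "i \<ge> N" "j \<ge> N" for i j
      using *[of i j] *[of j i] that H.sq_diff_commute[OF sE sE, of i j] by (cases "i \<le> j") auto
    then show "\<exists>N. \<forall>i\<ge>N. \<forall>j\<ge>N. sq E1 (s i - s j) < e" by blast
  qed
  then obtain v where v: "v \<in> fdom E" and sv: "H.conv s v" by blast
  have "(\<lambda>n. E1 (s n) (s n)) \<longlonglongrightarrow> E1 v v"
    using sE v sv by (rule H.tendsto_sq)
  moreover have "E1 (s n) (s n) \<le> r\<^sup>2" for n
  proof -
    have "(\<Sum>i<n. a i) \<le> r"
      using sum_le_suminf[of a "{..<n}"] sm r a0 unfolding a_def[symmetric] by auto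
    then have "sqrt (E1 (s n) (s n)) \<le> r" using nrm[of n] by linarith
    then show ?thesis by (rule sqrt_le_D)
  qed
  ultimately have vr: "E1 v v \<le> r\<^sup>2" by (intro LIMSEQ_le_const2) auto
  have "(\<lambda>n. sq (ip m) (s n - v)) \<longlonglongrightarrow> 0"
  proof (rule Lim_null_comparison[OF eventuallyI sv[unfolded H.conv_def]])
    fix n
    have "s n - v \<in> fdom E" using sE v by (rule H.diff_mem)
    then show "norm (sq (ip m) (s n - v)) \<le> sq E1 (s n - v)"
      using ip_le_E1[of "s n - v"] Lm.nonneg[OF dom_L2] by simp
  qed
  then obtain q where q: "strict_mono (q :: nat \<Rightarrow> nat)" "AE x in m. (\<lambda>n. s (q n) x) \<longlonglongrightarrow> v x"
    using L2_AE_subsequence[of s m v, OF dom_L2[OF sE] dom_L2[OF v]] by blast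
  have "AE x in m. \<forall>n. x \<in> U n \<longrightarrow> 1 \<le> w n x"
    using U by (simp add: AE_all_countable)
  with q(2) have "AE x in m. x \<in> (\<Union>n. U n) \<longrightarrow> 1 \<le> v x"
  proof eventually_elim
    case (elim x)
    show ?case
    proof
      assume "x \<in> (\<Union>n. U n)"
      then obtain i where i: "x \<in> U i" by auto
      have "1 \<le> s (q n) x" if n: "n \<ge> Suc i" for n
      proof -
        have "i < q n" using seq_suble[OF q(1), of n] n by linarith
        have "1 \<le> w i x" using elim(2) i by blast
        also have "\<dots> \<le> (\<Sum>k<q n. w k x)"
          using \<open>i < q n\<close> w(2) by (intro member_le_sum) auto
        also have "\<dots> = s (q n) x"
          by (simp add: sx)
        finally show ?thesis .
      qed
      then show "1 \<le> v x" using elim(1) by (intro LIMSEQ_le_const) auto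
    qed
  qed
  then have "open_capacity m E (\<Union>n. U n) \<le> ennreal (E1 v v)"
    unfolding open_capacity_def using v by (intro Inf_lower) auto
  also have "\<dots> \<le> ennreal (r\<^sup>2)" using vr by (rule ennreal_leI)
  finally show ?thesis .
qed

lemma quasi_continuous_continuous:
  assumes "continuous_on UNIV u"
  shows "quasi_continuous m E u"
  unfolding quasi_continuous_def
proof (intro allI impI)
  fix e :: real assume e: "e > 0"
  have "open_capacity m E {} \<le> ennreal (E1 0 0)"
    unfolding open_capacity_def by (intro Inf_lower CollectI exI[of _ 0]) auto
  moreover have "E1 0 0 = 0" by (rule H.zero_left) simp
  ultimately have "capacity m E {} \<le> 0"
    using capacity_le_open_capacity[of "{}" "{}"] by (simp add: order_trans)
  then show "\<exists>U. open U \<and> capacity m E U < ennreal e \<and> continuous_on (- U) u"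
    using assms e by (intro exI[of _ "{}"]) auto
qed

text \<open>
  The two exceptional sets have a union of small capacity: with norms below \<open>\<surd>(e/9)\<close> the sum of the two
  test functions has square norm at most \<open>4 e / 9\<close>.
\<close>

lemma quasi_continuous_lincomb:
  assumes u: "quasi_continuous m E u" and v: "quasi_continuous m E v"
  shows "quasi_continuous m E (a *\<^sub>R u + c *\<^sub>R v)"
  unfolding quasi_continuous_def
proof (intro allI impI)
  fix e :: real assume e: "e > 0"
  define d where "d = e / 9"
  have d: "d > 0" using e by (simp add: d_def)
  obtain U1 where U1: "open U1" "capacity m E U1 < ennreal d" "continuous_on (- U1) u"
    using u d unfolding quasi_continuous_def by blast
  obtain U2 where U2: "open U2" "capacity m E U2 < ennreal d" "continuous_on (- U2) v"
    using v d unfolding quasi_continuous_def by blast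
  obtain w1 where w1: "w1 \<in> fdom E" "\<And>x. 0 \<le> w1 x" "AE x in m. x \<in> U1 \<longrightarrow> 1 \<le> w1 x" "E1 w1 w1 < d"
    using capacity_witness[OF U1(2)] by blast
  obtain w2 where w2: "w2 \<in> fdom E" "\<And>x. 0 \<le> w2 x" "AE x in m. x \<in> U2 \<longrightarrow> 1 \<le> w2 x" "E1 w2 w2 < d"
    using capacity_witness[OF U2(2)] by blast
  define w where "w n = (if n = 0 then w1 else if n = 1 then w2 else 0)" for n :: nat
  define U where "U n = (if n = 0 then U1 else if n = 1 then U2 else {})" for n :: nat
  have E0: "E1 0 0 = 0" by (rule H.zero_left) simp
  have wn: "sqrt (E1 (w n) (w n)) = (if n \<in> {0, 1} then sqrt (E1 (w n) (w n)) else 0)" for n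
    using E0 by (auto simp: w_def)
  have "(\<lambda>n. sqrt (E1 (w n) (w n))) sums (\<Sum>n\<in>{0, 1}. sqrt (E1 (w n) (w n)))"
    by (subst wn) (rule sums_If_finite_set, simp)
  then have sums: "(\<lambda>n. sqrt (E1 (w n) (w n))) sums (sqrt (E1 w1 w1) + sqrt (E1 w2 w2))"
    by (simp add: w_def)
  have "open_capacity m E (\<Union>n. U n) \<le> ennreal ((2 * sqrt d)\<^sup>2)"
  proof (rule open_capacity_Union_le)
    show "summable (\<lambda>n. sqrt (E1 (w n) (w n)))" using sums by (rule sums_summable)
    have "sqrt (E1 w1 w1) \<le> sqrt d" "sqrt (E1 w2 w2) \<le> sqrt d"
      using w1(4) w2(4) by auto
    then show "(\<Sum>n. sqrt (E1 (w n) (w n))) \<le> 2 * sqrt d"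
      unfolding sums_unique[OF sums, symmetric] by linarith
  qed (use w1 w2 in \<open>auto simp: w_def U_def\<close>)
  also have "(\<Union>n. U n) = U1 \<union> U2"
    by (auto simp: U_def split: if_splits)
  also have "(2 * sqrt d)\<^sup>2 = 4 * d" using d by (simp add: power_mult_distrib)
  finally have "capacity m E (U1 \<union> U2) \<le> ennreal (4 * d)"
    using capacity_le_open_capacity[of "U1 \<union> U2" "U1 \<union> U2"] U1 U2 by (meson open_Un order_trans order_refl)
  also have "\<dots> < ennreal e" using e by (intro ennreal_lessI) (auto simp: d_def)
  finally have cap: "capacity m E (U1 \<union> U2) < ennreal e" .
  have "continuous_on (- (U1 \<union> U2)) (\<lambda>x. a * u x + c * v x)"
    by (intro continuous_intros continuous_on_subset[OF U1(3)] continuous_on_subset[OF U2(3)]) auto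
  then have "continuous_on (- (U1 \<union> U2)) (a *\<^sub>R u + c *\<^sub>R v)"
    by (simp add: fun_lincomb_eq)
  then show "\<exists>U. open U \<and> capacity m E U < ennreal e \<and> continuous_on (- U) (a *\<^sub>R u + c *\<^sub>R v)"
    using cap U1(1) U2(1) by (intro exI[of _ "U1 \<union> U2"]) auto
qed

text \<open>
  The increments of a rapidly convergent sequence of continuous functions exceed \<open>2\<^sup>-\<^sup>n\<close> only on open
  sets of summable capacity norm; away from the tails of their unions the convergence is uniform.
\<close>

lemma quasi_uniform_limit:
  fixes f :: "nat \<Rightarrow> 'a \<Rightarrow> real"
  assumes f: "\<And>n. f n \<in> fdom E" "\<And>n. continuous_on UNIV (f n)"
    and fast: "\<And>n. sq E1 (f n - f (Suc n)) \<le> (1/64) ^ n"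
  defines "g \<equiv> \<lambda>x. lim (\<lambda>n. f n x)"
  shows "quasi_continuous m E g"
    and "\<exists>N\<in>sets borel. capacity m E N = 0 \<and> (\<forall>x. x \<notin> N \<longrightarrow> (\<lambda>n. f n x) \<longlonglongrightarrow> g x)"
proof -
  define d where "d n = 2 ^ n *\<^sub>R (f n - f (Suc n))" for n
  define w where "w n = clip (d n) + clip (- d n)" for n
  define U where "U n = {x. 1 < \<bar>d n x\<bar>}" for n
  define V where "V k = (\<Union>n. U (n + k))" for k
  have dE: "d n \<in> fdom E" "- d n \<in> fdom E" for n
    using f(1) H.scale_mem[of "d n" "-1"] by (auto simp: d_def)
  have ddiff: "d n x = 2 ^ n * (f n x - f (Suc n) x)" for n x by (simp add: d_def)
  have Uo: "open (U n)" for n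
    unfolding U_def ddiff by (intro open_Collect_less continuous_intros f(2))
  have Vo: "open (V k)" for k unfolding V_def using Uo by auto
  have nd: "sqrt (E1 (d n) (d n)) \<le> (1/4) ^ n" for n
  proof -
    have "E1 (d n) (d n) = (2 ^ n)\<^sup>2 * sq E1 (f n - f (Suc n))"
      unfolding d_def using f(1) by (intro H.sq_scale H.diff_mem)
    also have "\<dots> \<le> (2 ^ n)\<^sup>2 * (1/64) ^ n" by (intro mult_left_mono fast) auto
    also have "\<dots> = ((1/4) ^ n)\<^sup>2"
      by (simp add: power2_eq_square flip: power_mult_distrib)
    finally show ?thesis by (rule real_le_lsqrt[rotated]) auto
  qed
  have wE: "w n \<in> fdom E" for n unfolding w_def using dE clip_mem by blast
  have w0: "0 \<le> w n x" for n x unfolding w_def plus_fun_apply by (intro add_nonneg_nonneg clip_range(1))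
  have wU: "1 \<le> w n x" if "x \<in> U n" for n x
  proof -
    have "1 \<le> d n x \<or> 1 \<le> (- d n) x" using that by (auto simp: U_def)
    then show ?thesis
      using clip_range(1)[of "d n" x] clip_range(1)[of "- d n" x] clip_range(3)[of "d n" x] clip_range(3)[of "- d n" x]
      unfolding w_def by auto
  qed
  have nw: "sqrt (E1 (w n) (w n)) \<le> 2 * (1/4) ^ n" for n
  proof -
    have eq: "E1 (- d n) (- d n) = E1 (d n) (d n)"
      using H.sq_scale[OF dE(1), of "-1"] by simp
    have "sqrt (E1 (w n) (w n)) \<le> sqrt (sq E1 (clip (d n))) + sqrt (sq E1 (clip (- d n)))"
      unfolding w_def by (intro H.norm_triangle clip_mem dE)
    also have "\<dots> \<le> sqrt (E1 (d n) (d n)) + sqrt (E1 (- d n) (- d n))"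
      by (intro add_mono real_sqrt_le_mono clip_E1_le dE)
    finally show ?thesis using nd[of n] eq by simp
  qed
  have capV: "open_capacity m E (V k) \<le> ennreal ((3 * (1/4) ^ k)\<^sup>2)" for k
    unfolding V_def
  proof (rule open_capacity_Union_le[where w = "\<lambda>n. w (n + k)"])
    have geo: "(\<lambda>n. 2 * (1/4) ^ k * (1/4 :: real) ^ n) sums (2 * (1/4) ^ k * (1 / (1 - 1/4)))"
      by (intro sums_mult geometric_sums) auto
    have le: "sqrt (sq E1 (w (n + k))) \<le> 2 * (1/4) ^ k * (1/4) ^ n" for n
      using nw[of "n + k"] by (simp add: power_add mult_ac)
    show sm: "summable (\<lambda>n. sqrt (sq E1 (w (n + k))))"
    proof (rule summable_comparison_test')
      show "summable (\<lambda>n. 2 * (1/4) ^ k * (1/4 :: real) ^ n)" using geo by (rule sums_summable)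
      show "norm (sqrt (sq E1 (w (n + k)))) \<le> 2 * (1/4) ^ k * (1/4) ^ n" for n
        using le[of n] H.nonneg[OF wE] by simp
    qed
    have "(\<Sum>n. sqrt (sq E1 (w (n + k)))) \<le> (\<Sum>n. 2 * (1/4) ^ k * (1/4) ^ n)"
      using le sm geo by (intro suminf_le sums_summable[OF geo])
    also have "\<dots> = 2 * (1/4) ^ k * (1 / (1 - 1/4))" using geo by (rule sums_unique[symmetric])
    also have "\<dots> \<le> 3 * (1/4) ^ k" by simp
    finally show "(\<Sum>n. sqrt (sq E1 (w (n + k)))) \<le> 3 * (1/4) ^ k" .
  qed (use wE w0 wU in auto)
  have small: "\<exists>k. (3 * (1/4) ^ k)\<^sup>2 < e" if "e > 0" for e :: real
  proof -
    have "(\<lambda>k. (3 * (1/4 :: real) ^ k)\<^sup>2) \<longlonglongrightarrow> (3 * 0)\<^sup>2"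
      by (intro tendsto_intros LIMSEQ_power_zero) simp
    then have "\<forall>\<^sub>F k in sequentially. (3 * (1/4 :: real) ^ k)\<^sup>2 < e"
      using that by (intro order_tendstoD(2)) auto
    then show ?thesis by (auto simp: eventually_sequentially)
  qed
  have unif: "uniform_limit (- V k) f g sequentially" for k
  proof -
    have "uniformly_Cauchy_on (- V k) f"
    proof (rule uniformly_Cauchy_onI')
      fix e :: real assume e: "e > 0"
      obtain N where N: "2 * (1/2 :: real) ^ N < e" "k \<le> N"
      proof -
        have "(\<lambda>n. 2 * (1/2 :: real) ^ n) \<longlonglongrightarrow> 2 * 0"
          by (intro tendsto_intros LIMSEQ_power_zero) simp
        then have "\<forall>\<^sub>F n in sequentially. 2 * (1/2 :: real) ^ n < e"
          using e by (intro order_tendstoD(2)) auto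
        then have "\<forall>\<^sub>F n in sequentially. 2 * (1/2 :: real) ^ n < e \<and> k \<le> n"
          using eventually_ge_at_top by (rule eventually_conj)
        then show ?thesis using that by (auto simp: eventually_sequentially)
      qed
      have inc: "\<bar>f n x - f (Suc n) x\<bar> \<le> (1/2) ^ n" if "n \<ge> k" "x \<in> - V k" for n x
      proof -
        have "x \<notin> U n"
          using that by (auto simp: V_def dest!: spec[of _ "n - k"])
        then have "2 ^ n * \<bar>f n x - f (Suc n) x\<bar> \<le> 1"
          by (simp add: U_def ddiff abs_mult)
        then show ?thesis by (simp add: field_simps power_one_over)
      qed
      have tele: "\<bar>f i x - f (i + j) x\<bar> \<le> 2 * (1/2) ^ i * (1 - (1/2) ^ j)" if "i \<ge> k" "x \<in> - V k" for i j x
      proof (induction j)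
        case (Suc j)
        have "\<bar>f i x - f (i + Suc j) x\<bar> \<le> \<bar>f i x - f (i + j) x\<bar> + \<bar>f (i + j) x - f (Suc (i + j)) x\<bar>"
          by simp
        also have "\<dots> \<le> 2 * (1/2) ^ i * (1 - (1/2) ^ j) + (1/2) ^ (i + j)"
          using Suc inc[of "i + j" x] that by simp
        also have "\<dots> = 2 * (1/2) ^ i * (1 - (1/2) ^ Suc j)"
          by (simp add: power_add algebra_simps)
        finally show ?case .
      qed simp
      have "dist (f i x) (f j x) < e" if "x \<in> - V k" "i \<ge> N" "j > i" for x i j
      proof -
        have "\<bar>f i x - f j x\<bar> \<le> 2 * (1/2) ^ i * (1 - (1/2) ^ (j - i))"
          using tele[of i x "j - i"] that N by simp
        also have "\<dots> \<le> 2 * (1/2) ^ i * 1" by (intro mult_left_mono) auto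
        also have "\<dots> \<le> 2 * (1/2) ^ N" using that by (simp add: power_decreasing)
        finally show ?thesis using N by (simp add: dist_real_def)
      qed
      then show "\<exists>M. \<forall>x\<in>- V k. \<forall>i\<ge>M. \<forall>j>i. dist (f i x) (f j x) < e" by blast
    qed
    then have "uniformly_convergent_on (- V k) f" by (rule Cauchy_uniformly_convergent)
    then show ?thesis by (simp add: uniformly_convergent_uniform_limit_iff g_def)
  qed
  show "quasi_continuous m E g"
    unfolding quasi_continuous_def
  proof (intro allI impI)
    fix e :: real assume e: "e > 0"
    obtain k where k: "(3 * (1/4) ^ k)\<^sup>2 < e" using small[OF e] by blast
    have "capacity m E (V k) \<le> ennreal ((3 * (1/4) ^ k)\<^sup>2)"
      using capacity_le_open_capacity[OF Vo subset_refl] capV by (rule order_trans)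
    also have "\<dots> < ennreal e" using k e by (simp add: ennreal_lessI)
    finally have "capacity m E (V k) < ennreal e" .
    moreover have "continuous_on (- V k) g"
      by (rule uniform_limit_theorem[OF always_eventually unif trivial_limit_sequentially])
        (intro allI continuous_on_subset[OF f(2) subset_UNIV])
    ultimately show "\<exists>U. open U \<and> capacity m E U < ennreal e \<and> continuous_on (- U) g"
      using Vo by blast
  qed
  define N where "N = (\<Inter>k. V k)"
  have "capacity m E N = 0"
  proof (rule ccontr)
    assume "capacity m E N \<noteq> 0"
    then have "0 < capacity m E N" by (simp add: zero_less_iff_neq_zero)
    then obtain e where e: "0 < e" "e < capacity m E N" using dense by blast
    then obtain r where r: "e = ennreal r" "r \<ge> 0" by (cases e) auto
    then have "r > 0" using e(1) by (simp add: less_le)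
    obtain k where k: "(3 * (1/4) ^ k)\<^sup>2 < r" using small[OF \<open>r > 0\<close>] by blast
    have "capacity m E N \<le> ennreal ((3 * (1/4) ^ k)\<^sup>2)"
      using capacity_le_open_capacity[OF Vo, of N k] capV[of k] by (auto simp: N_def intro: order_trans)
    also have "\<dots> < ennreal r" using k by (simp add: ennreal_lessI \<open>r > 0\<close>)
    finally show False using e(2) r(1) by simp
  qed
  moreover have "N \<in> sets borel"
    unfolding N_def using Vo by (intro sets.countable_INT') auto
  moreover have "(\<lambda>n. f n x) \<longlonglongrightarrow> g x" if x: "x \<notin> N" for x
  proof -
    obtain k where "x \<in> - V k" using x unfolding N_def by blast
    then show ?thesis by (rule tendsto_uniform_limitI[OF unif])
  qed
  ultimately show "\<exists>N\<in>sets borel. capacity m E N = 0 \<and> (\<forall>x. x \<notin> N \<longrightarrow> (\<lambda>n. f n x) \<longlonglongrightarrow> g x)"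
    by blast
qed

end

section \<open>The domain of the trace map\<close>

locale trace_setting = dirichlet_form_space m E
  for m :: "'a::{metric_space, second_countable_topology} measure" and E :: "'a form" +
  fixes \<mu> :: "'a measure"
  assumes locally_compact: "locally_compact_space (euclidean :: 'a topology)"
    and radon_m: "radon_measure m" and radon_\<mu>: "radon_measure \<mu>"
    and regular: "regular_dirichlet_form m E"
    and charges: "charges_no_zero_capacity m E \<mu>"
    and J1_cont: "J1_continuous m \<mu> E E"
begin

abbreviation "D \<equiv> domJ m \<mu> E"

sublocale L\<mu>: semi_hilbert "L2 \<mu>" "ip \<mu>" by (rule L2_semi_hilbert)

lemma D_mem: "u \<in> D \<Longrightarrow> u \<in> fdom E" "u \<in> D \<Longrightarrow> u \<in> L2 \<mu>" "u \<in> D \<Longrightarrow> u \<in> L2 m"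
  using dom_L2 by (auto simp: domJ_def)

lemma D_subspace: "subspace D"
proof -
  have lin: "a *\<^sub>R u + c *\<^sub>R v \<in> D" if "u \<in> D" "v \<in> D" for u v a c
    using that quasi_continuous_lincomb[of u v a c] unfolding domJ_def by auto
  have "0 \<in> D"
  proof -
    have "quasi_continuous m E 0"
      unfolding zero_fun_def by (intro quasi_continuous_continuous continuous_intros)
    then show ?thesis by (auto simp: domJ_def)
  qed
  then show ?thesis
    using lin[of _ _ 1 1] lin[of _ _ _ 0] by (auto simp: subspace_def)
qed

lemma Cc_D: "f \<in> fdom E \<Longrightarrow> f \<in> Cc \<Longrightarrow> f \<in> D"
  using quasi_continuous_continuous[of f] Cc_L2[OF radon_\<mu>] by (auto simp: domJ_def Cc_def)

text \<open>
  By homogeneity, continuity at \<open>0\<close> becomes a bound; elements of vanishing form norm are covered by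
  scaling with arbitrarily large factors.
\<close>

lemma J1_bound:
  obtains K where "K > 0" "\<And>u. u \<in> D \<Longrightarrow> ip \<mu> u u \<le> K * E1 u u"
proof -
  have D0: "0 \<in> D" using D_subspace by (rule subspace_0)
  obtain d where d: "d > 0"
    and dv: "\<And>v. v \<in> D \<Longrightarrow> sqrt (sq E1 (\<lambda>x. v x - 0 x)) < d \<Longrightarrow> l2norm \<mu> (\<lambda>x. v x - 0 x) < 1"
    using J1_cont D0 unfolding J1_continuous_def by (metis zero_less_one)
  have small: "ip \<mu> v v \<le> 1" if v: "v \<in> D" "E1 v v < d\<^sup>2" for v
  proof -
    have "sqrt (E1 v v) < d" using v d by (simp add: real_less_lsqrt)
    then have "l2norm \<mu> v < 1" using dv[OF v(1)] by simp
    then show ?thesis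
      unfolding l2norm_def by (metis less_imp_le real_sqrt_le_1_iff)
  qed
  have "ip \<mu> u u \<le> 1 / d\<^sup>2 * E1 u u" if u: "u \<in> D" for u
  proof -
    have uE: "u \<in> fdom E" "u \<in> L2 \<mu>" using D_mem u by auto
    have *: "ip \<mu> u u \<le> 1 / d\<^sup>2 * s" if s: "s > E1 u u" for s
    proof -
      have s0: "s > 0" using H.nonneg[OF uE(1)] s by linarith
      define t where "t = d / sqrt s"
      have t: "t > 0" "t\<^sup>2 = d\<^sup>2 / s" using s0 d by (auto simp: t_def power_divide)
      have "sq E1 (t *\<^sub>R u) = d\<^sup>2 / s * E1 u u"
        using H.sq_scale[OF uE(1), of t] t by simp
      also have "\<dots> < d\<^sup>2" using s s0 d by (simp add: field_simps)
      finally have "sq (ip \<mu>) (t *\<^sub>R u) \<le> 1"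
        using u D_subspace by (intro small) (auto intro: subspace_scale)
      then have "d\<^sup>2 / s * ip \<mu> u u \<le> 1"
        using L\<mu>.sq_scale[OF uE(2), of t] t by simp
      then show ?thesis using s0 d by (simp add: field_simps)
    qed
    show ?thesis
    proof (rule dense_ge)
      fix y assume y: "1 / d\<^sup>2 * E1 u u < y"
      then have "E1 u u < d\<^sup>2 * y" using d by (simp add: field_simps)
      from *[OF this] show "ip \<mu> u u \<le> y" using d by simp
    qed
  qed
  then show ?thesis using that[of "1 / d\<^sup>2"] d by simp
qed

lemma E1_AE_cong:
  assumes "u \<in> fdom E" "u' \<in> fdom E" "v \<in> fdom E" "v' \<in> fdom E" "AE x in m. u x = u' x" "AE x in m. v x = v' x"
  shows "E1 u v = E1 u' v'"
  by (rule positive_form_AE_cong[OF positive_form_shift[OF pos, of 1]])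
    (simp_all only: assms shift_form_simps zero_le_one)

text \<open>
  By the continuity of \<open>J\<close> an approximating sequence of continuous functions converges in \<open>L\<^sup>2(\<mu>)\<close>, and
  its quasi-everywhere limit agrees with that limit \<open>\<mu>\<close>-almost everywhere.  Hence every element of the
  form domain has a version in the domain of \<open>J\<close>.
\<close>

lemma version_exists:
  assumes u: "u \<in> fdom E"
  obtains u' where "u' \<in> D" "AE x in m. u' x = u x"
proof -
  \<comment> \<open>Squared distances \<open>64\<^sup>-\<^sup>n / 4\<close> to \<open>u\<close> bound those of successive terms by \<open>64\<^sup>-\<^sup>n\<close>, also along subsequences.\<close>
  have "0 < (1/64 :: real) ^ n / 4" for n by simp
  then have "\<exists>f\<in>fdom E \<inter> Cc. sq E1 (\<lambda>x. u x - f x) < (1/64) ^ n / 4" for n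
    using regular u unfolding regular_dirichlet_form_def by blast
  then have "\<forall>n. \<exists>f. f \<in> fdom E \<and> f \<in> Cc \<and> E1 (u - f) (u - f) < (1/64) ^ n / 4"
    unfolding fun_diff_def by blast
  then obtain f where f: "\<And>n. f n \<in> fdom E" "\<And>n. f n \<in> Cc" "\<And>n. sq E1 (u - f n) < (1/64) ^ n / 4"
    by metis
  have null: "(\<lambda>n. (1/64 :: real) ^ n / 4) \<longlonglongrightarrow> 0"
    using tendsto_divide[OF LIMSEQ_power_zero[of "1/64::real"] tendsto_const[of "4::real"]] by simp
  have "(\<lambda>n. sq (ip m) (f n - u)) \<longlonglongrightarrow> 0"
  proof (rule Lim_null_comparison[OF eventuallyI null])
    fix n
    have d: "u - f n \<in> fdom E" using u f(1) by (rule H.diff_mem)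
    have "sq (ip m) (f n - u) = sq (ip m) (u - f n)"
      by (intro Lm.sq_diff_commute dom_L2 u f(1))
    then show "norm (sq (ip m) (f n - u)) \<le> (1/64) ^ n / 4"
      using ip_le_E1[OF d] f(3)[of n] Lm.nonneg[OF dom_L2[OF d]] by simp
  qed
  then obtain r where r: "strict_mono (r :: nat \<Rightarrow> nat)" "AE x in m. (\<lambda>n. f (r n) x) \<longlonglongrightarrow> u x"
    using L2_AE_subsequence[of f m u, OF dom_L2[OF f(1)] dom_L2[OF u]] by blast
  define F where "F n = f (r n)" for n
  have F: "F n \<in> fdom E" "F n \<in> Cc" "F n \<in> D" for n using f Cc_D by (auto simp: F_def)
  have Fu: "sq E1 (u - F n) \<le> (1/64) ^ n / 4" for n
  proof -
    have "sq E1 (u - F n) \<le> (1/64) ^ r n / 4" using f(3)[of "r n"] by (simp add: F_def less_imp_le)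
    also have "\<dots> \<le> (1/64) ^ n / 4"
      using seq_suble[OF r(1), of n] by (intro divide_right_mono power_decreasing) auto
    finally show ?thesis .
  qed
  have FF: "sq E1 (F i - F j) \<le> (1/64) ^ i" if "i \<le> j" for i j
  proof -
    have "sq E1 (F i - F j) \<le> 2 * sq E1 (F i - u) + 2 * sq E1 (u - F j)"
      using F u by (intro H.sq_triangle)
    moreover have "sq E1 (F i - u) = sq E1 (u - F i)"
      using F u by (intro H.sq_diff_commute)
    ultimately show ?thesis
      using Fu[of i] Fu[of j] power_decreasing[OF that, of "1/64 :: real"] by linarith
  qed
  define g where "g x = lim (\<lambda>n. F n x)" for x
  have cont: "continuous_on UNIV (F n)" for n using F(2) by (simp add: Cc_def)
  have qc: "quasi_continuous m E g"
    and ex: "\<exists>N\<in>sets borel. capacity m E N = 0 \<and> (\<forall>x. x \<notin> N \<longrightarrow> (\<lambda>n. F n x) \<longlonglongrightarrow> g x)"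
    unfolding g_def using quasi_uniform_limit[OF F(1) cont FF] by auto
  obtain N where N: "N \<in> sets borel" "capacity m E N = 0" "\<And>x. x \<notin> N \<Longrightarrow> (\<lambda>n. F n x) \<longlonglongrightarrow> g x"
    using ex by blast
  have N\<mu>: "N \<in> null_sets \<mu>"
    using N charges radon_\<mu> by (auto simp: charges_no_zero_capacity_def null_sets_def radon_measure_def)
  have gb: "g \<in> borel_measurable borel"
    unfolding g_def by (rule borel_measurable_lim_metric) (rule borel_measurable_continuous_onI[OF cont])
  have gm: "AE x in m. g x = u x"
    using r(2) by eventually_elim (auto simp: g_def F_def intro: limI)
  have gE: "g \<in> fdom E"
    by (rule positive_form_AE_mem[OF pos u radon_measurable[OF radon_m gb] gm])
  obtain K where K: "K > 0" "\<And>u. u \<in> D \<Longrightarrow> ip \<mu> u u \<le> K * E1 u u" using J1_bound by blast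
  have "\<exists>v\<in>L2 \<mu>. L\<mu>.conv F v"
  proof (rule L\<mu>.complete)
    fix e :: real assume e: "e > 0"
    have "(\<lambda>n. K * (1/64 :: real) ^ n) \<longlonglongrightarrow> K * 0"
      by (intro tendsto_intros LIMSEQ_power_zero) simp
    then have "\<forall>\<^sub>F n in sequentially. K * (1/64 :: real) ^ n < e"
      using e by (intro order_tendstoD(2)) auto
    then obtain M where M: "\<And>n. n \<ge> M \<Longrightarrow> K * (1/64 :: real) ^ n < e"
      by (auto simp: eventually_sequentially)
    have *: "sq (ip \<mu>) (F i - F j) < e" if "i \<ge> M" "i \<le> j" for i j
    proof -
      have "sq (ip \<mu>) (F i - F j) \<le> K * sq E1 (F i - F j)"
        using F(3) D_subspace by (intro K(2)) (auto intro: subspace_diff)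
      also have "\<dots> \<le> K * (1/64) ^ i" using K(1) by (intro mult_left_mono FF that) auto
      finally show ?thesis using M[OF that(1)] by linarith
    qed
    have "sq (ip \<mu>) (F i - F j) < e" if "i \<ge> M" "j \<ge> M" for i j
      using *[of i j] *[of j i] that L\<mu>.sq_diff_commute[OF D_mem(2)[OF F(3)] D_mem(2)[OF F(3)], of i j]
      by (cases "i \<le> j") auto
    then show "\<exists>M. \<forall>i\<ge>M. \<forall>j\<ge>M. sq (ip \<mu>) (F i - F j) < e" by blast
  qed (use D_mem(2)[OF F(3)] in auto)
  then obtain v where v: "v \<in> L2 \<mu>" "L\<mu>.conv F v" by blast
  obtain q where q: "strict_mono (q :: nat \<Rightarrow> nat)" "AE x in \<mu>. (\<lambda>n. F (q n) x) \<longlonglongrightarrow> v x"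
    using L2_AE_subsequence[of F \<mu> v, OF D_mem(2)[OF F(3)] v(1)] v(2) unfolding L\<mu>.conv_def by blast
  have "AE x in \<mu>. g x = v x"
    using q(2) AE_not_in[OF N\<mu>]
  proof eventually_elim
    case (elim x)
    have "(\<lambda>n. F (q n) x) \<longlonglongrightarrow> g x"
      using LIMSEQ_subseq_LIMSEQ[OF N(3)[OF elim(2)] q(1)] by (simp add: o_def)
    then show ?case using elim(1) by (rule LIMSEQ_unique)
  qed
  then have "g \<in> L2 \<mu>"
    by (rule L2_AE_cong[OF radon_measurable[OF radon_\<mu> gb] _ v(1)])
  then have "g \<in> D" using gE qc by (simp add: domJ_def)
  with gm show ?thesis using that by blast
qed

lemma D_semi_inner_E1: "semi_inner D E1"
  using D_subspace D_mem(1)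
  by unfold_locales (auto simp del: shift_form_simps(2) simp: H.expand H.nonneg intro: H.sym)

lemma D_semi_hilbert: "semi_hilbert D E1"
proof -
  interpret V: semi_inner D E1 by (rule D_semi_inner_E1)
  show ?thesis
  proof
    fix s :: "nat \<Rightarrow> 'a \<Rightarrow> real" assume s: "\<And>n. s n \<in> D"
      and cau: "\<And>e. e > 0 \<Longrightarrow> \<exists>N. \<forall>i\<ge>N. \<forall>j\<ge>N. sq E1 (s i - s j) < e"
    obtain v where v: "v \<in> fdom E" "H.conv s v" using H.complete[OF D_mem(1)[OF s] cau] by blast
    obtain v' where v': "v' \<in> D" "AE x in m. v' x = v x" using version_exists[OF v(1)] .
    have "sq E1 (s n - v') = sq E1 (s n - v)" for n
      using v'(2) by (intro E1_AE_cong H.diff_mem D_mem(1) s v v') auto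
    then have "V.conv s v'" using v(2) by (simp add: V.conv_def H.conv_def)
    then show "\<exists>v\<in>D. V.conv s v" using v'(1) by blast
  qed
qed

text \<open>
  What is orthogonal to \<open>D\<close> is orthogonal to \<open>C\<^sub>c\<close>, by regularity, and hence null.
\<close>

lemma D_dense:
  assumes f: "f \<in> L2 \<mu>" and e: "e > 0"
  obtains u where "u \<in> D" "ip \<mu> (f - u) (f - u) < e"
proof (rule L\<mu>.dense_image[OF D_subspace, of "\<lambda>x. x" f e])
  fix z assume z: "z \<in> L2 \<mu>" and orth: "\<And>x. x \<in> D \<Longrightarrow> ip \<mu> z x = 0"
  have "ip \<mu> z g = 0" if g: "g \<in> Cc" for g
  proof (rule ccontr)
    assume n: "ip \<mu> z g \<noteq> 0"
    have gL: "g \<in> L2 \<mu>" using Cc_L2[OF radon_\<mu> g] .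
    define c where "c = (ip \<mu> z g)\<^sup>2 / (ip \<mu> z z + 1)"
    have p: "ip \<mu> z z + 1 > 0" using L\<mu>.nonneg[OF z] by simp
    have c: "c > 0" using n p by (simp add: c_def)
    obtain u where u: "u \<in> fdom E" "u \<in> Cc" "ip \<mu> (g - u) (g - u) < c"
      using regular_approx_L2[OF regular radon_\<mu> g c] .
    have uL: "u \<in> L2 \<mu>" using Cc_L2[OF radon_\<mu> u(2)] .
    have "ip \<mu> z g = ip \<mu> z (g - u)"
      using orth[OF Cc_D[OF u(1,2)]] z gL uL by (simp add: L\<mu>.diff_right)
    then have "(ip \<mu> z g)\<^sup>2 \<le> ip \<mu> z z * ip \<mu> (g - u) (g - u)"
      using L\<mu>.cauchy_schwarz[OF z L\<mu>.diff_mem[OF gL uL]] by simp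
    also have "\<dots> \<le> (ip \<mu> z z + 1) * ip \<mu> (g - u) (g - u)"
      using L\<mu>.nonneg[OF L\<mu>.diff_mem[OF gL uL]] by (intro mult_right_mono) auto
    also have "\<dots> < (ip \<mu> z z + 1) * c"
      using u(3) p by (intro mult_strict_left_mono)
    also have "\<dots> = (ip \<mu> z g)\<^sup>2" using p by (simp add: c_def)
    finally show False by simp
  qed
  then have "AE x in \<mu>. z x = 0"
    using Cc_total[OF locally_compact radon_\<mu> z] by blast
  then show "ip \<mu> z z = 0" using ip_null_iff[OF z] by simp
qed (use assms D_mem(2) that in auto)

end

section \<open>Resolvents of the traces\<close>

context trace_setting
begin

abbreviation "energy F l \<equiv> bil (shift_form m F l)"
abbreviation "trace_at F l \<equiv> trace_form m \<mu> E F l"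

end

lemma semi_inner_subspace:
  assumes "semi_inner V b" "subspace W" "W \<subseteq> V"
  shows "semi_inner W b"
proof -
  interpret semi_inner V b by fact
  show ?thesis
    using assms(2,3) by unfold_locales (auto simp: add_left scale_left nonneg subset_iff intro: sym)
qed

locale comparable_form = trace_setting m E \<mu>
  for m :: "'a::{metric_space, second_countable_topology} measure" and E :: "'a form" and \<mu> :: "'a measure" +
  fixes F :: "'a form" and c :: real
  assumes F_closed: "closed_form m F" and F_dom: "fdom F = fdom E" and c_pos: "c > 0"
    and lower: "\<And>u. u \<in> fdom E \<Longrightarrow> inverse c * bil E u u \<le> bil F u u"
    and upper: "\<And>u. u \<in> fdom E \<Longrightarrow> bil F u u \<le> c * bil E u u"
begin

lemma F_pos: "positive_form m F"
  using F_closed by (simp add: closed_form_def)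

sublocale F: semi_inner "fdom E" "bil F"
  using positive_form_semi_inner[OF F_pos] F_dom by simp

lemma Fl_semi_inner: "l \<ge> 0 \<Longrightarrow> semi_inner (fdom E) (energy F l)"
  using positive_form_semi_inner[OF positive_form_shift[OF F_pos]] F_dom by simp

lemma Fl_semi_inner_D: "l \<ge> 0 \<Longrightarrow> semi_inner D (energy F l)"
  by (rule semi_inner_subspace[OF Fl_semi_inner D_subspace]) (auto dest: D_mem(1))

lemma F1_bounds:
  assumes u: "u \<in> fdom E"
  shows "E1 u u \<le> max c 1 * energy F 1 u u" "energy F 1 u u \<le> max c 1 * E1 u u"
proof -
  have h: "0 \<le> ip m u u" using Lm.nonneg[OF dom_L2[OF u]] .
  have "bil E u u \<le> c * bil F u u"
    using lower[OF u] c_pos by (simp add: field_simps)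
  also have "\<dots> \<le> max c 1 * bil F u u" using F.nonneg[OF u] by (intro mult_right_mono) auto
  finally have 1: "bil E u u \<le> max c 1 * bil F u u" .
  have "bil F u u \<le> max c 1 * bil E u u"
    using upper[OF u] form_nonneg[OF u] mult_right_mono[of c "max c 1" "bil E u u"] by simp
  moreover have "ip m u u \<le> max c 1 * ip m u u"
    using mult_right_mono[OF _ h, of 1 "max c 1"] by simp
  ultimately show "E1 u u \<le> max c 1 * energy F 1 u u" "energy F 1 u u \<le> max c 1 * E1 u u"
    using 1 unfolding shift_form_simps distrib_left by linarith+
qed

lemma Fl_hilbert:
  assumes l: "l > 0"
  shows "semi_hilbert D (energy F l)"
proof (rule semi_hilbert_equivalent[OF D_semi_hilbert Fl_semi_inner_D])
  show "0 \<le> l" using l by simp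
  show "0 < min (inverse c) l" using c_pos l by simp
  fix u assume "u \<in> D"
  then have u: "u \<in> fdom E" by (rule D_mem(1))
  have h: "0 \<le> ip m u u" using Lm.nonneg[OF dom_L2[OF u]] .
  note e = form_nonneg[OF u]
  have "min (inverse c) l * bil E u u \<le> inverse c * bil E u u" "min (inverse c) l * ip m u u \<le> l * ip m u u"
    using e h by (auto intro!: mult_right_mono)
  then show "min (inverse c) l * E1 u u \<le> energy F l u u"
    using lower[OF u] by (simp add: shift_form_simps distrib_left)
  have "c * bil E u u \<le> max c l * bil E u u" "l * ip m u u \<le> max c l * ip m u u"
    using e h by (auto intro!: mult_right_mono)
  then show "energy F l u u \<le> max c l * E1 u u"
    using upper[OF u] by (simp add: shift_form_simps distrib_left)
qed

lemma graph_hilbert: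
  assumes l: "l > 0"
  shows "semi_hilbert D (\<lambda>u v. energy F l u v + ip \<mu> u v)"
proof -
  interpret V: semi_hilbert D "energy F l" using l by (rule Fl_hilbert)
  obtain K where K: "K > 0" "\<And>u. u \<in> D \<Longrightarrow> ip \<mu> u u \<le> K * E1 u u" using J1_bound by blast
  define a where "a = min (inverse c) l"
  have a: "a > 0" using c_pos l by (simp add: a_def)
  show ?thesis
  proof (rule semi_hilbert_equivalent[OF Fl_hilbert[OF l]])
    show "semi_inner D (\<lambda>u v. energy F l u v + ip \<mu> u v)"
      using semi_inner_plus[OF V.semi_inner_axioms L2_semi_inner, of \<mu> 1] D_mem(2) by auto
    show "(0::real) < 1" by simp
    fix u assume u: "u \<in> D"
    have uE: "u \<in> fdom E" using u by (rule D_mem(1))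
    have h: "0 \<le> ip m u u" using Lm.nonneg[OF dom_L2[OF uE]] .
    show "1 * energy F l u u \<le> energy F l u u + ip \<mu> u u"
      using L\<mu>.nonneg[OF D_mem(2)[OF u]] by simp
    have "a * bil E u u \<le> inverse c * bil E u u" "a * ip m u u \<le> l * ip m u u"
      using form_nonneg[OF uE] h by (auto intro!: mult_right_mono simp: a_def)
    then have "a * E1 u u \<le> energy F l u u"
      using lower[OF uE] by (simp add: shift_form_simps distrib_left)
    then have "E1 u u \<le> energy F l u u / a"
      using a by (simp add: field_simps)
    then have "K * E1 u u \<le> K * (energy F l u u / a)"
      using K(1) by (intro mult_left_mono) auto
    then show "energy F l u u + ip \<mu> u u \<le> (1 + K / a) * energy F l u u"
      using K(2)[OF u] by (simp add: distrib_right)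
  qed
qed

lemma trace_map:
  assumes l: "l > 0"
  shows "graph_complete_map D (energy F l) (\<lambda>u. u) \<mu>"
  using Fl_semi_inner_D[of l] graph_hilbert[OF l] l D_mem(2)
  by (simp add: graph_complete_map_def)

text \<open>
  The projection in the definition of the trace is a minimal lift in the sense above, since
  \<open>u - p\<close> lies in the kernel of \<open>J\<close> for the lift \<open>p\<close> of \<open>u\<close>; it is determined up to \<open>m\<close>-null sets.
\<close>

lemma trace_induced:
  assumes l: "l > 0"
  obtains P where "induced_form D (energy F l) (\<lambda>u. u) \<mu> (trace_at F l) P"
proof -
  interpret T: graph_complete_map D "energy F l" "\<lambda>u. u" \<mu>
    using l by (rule trace_map)
  interpret Fl: semi_inner "fdom E" "energy F l" using l by (intro Fl_semi_inner) simp
  have ker: "T.kernel = kerJ m \<mu> E"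
    by (simp add: T.kernel_def kerJ_def)
  have ex: "\<exists>p. T.is_lift p u \<and> u - p \<in> T.kernel" if "u \<in> D" for u
    using T.lift_exists[OF that] by blast
  define Q where "Q u = (SOME p. T.is_lift p u \<and> u - p \<in> T.kernel)" for u
  have Q: "T.is_lift (Q u) u" "u - Q u \<in> T.kernel" if "u \<in> D" for u
    using someI_ex[OF ex[OF that]] unfolding Q_def by auto
  define S where "S = orth_compl (shift_form m F l) (kerJ m \<mu> E)"
  have S_iff: "p \<in> S \<longleftrightarrow> p \<in> fdom E \<and> (\<forall>s\<in>T.kernel. energy F l p s = 0)" for p
    by (simp add: S_def orth_compl_def F_dom ker)
  have proj: "P_proj m \<mu> E F l u \<in> fdom E \<and> (AE x in m. P_proj m \<mu> E F l u x = Q u x)" if u: "u \<in> D" for u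
  proof -
    have QD: "Q u \<in> D" using Q(1)[OF u] by (simp add: T.is_lift_def)
    have uE: "u \<in> fdom E" and QE: "Q u \<in> fdom E" using D_mem(1) u QD by auto
    have QS: "Q u \<in> S" using Q(1)[OF u] QE by (simp add: S_iff T.is_lift_def)
    have orth: "energy F l (u - Q u) w = 0" if w: "w \<in> S" for w
      using w Q(2)[OF u] Fl.sym[OF Fl.diff_mem[OF uE QE], of w] by (simp add: S_iff)
    define p where "p = orth_proj (shift_form m F l) S u"
    have "\<exists>p. p \<in> S \<and> (\<forall>w\<in>S. energy F l (\<lambda>x. u x - p x) w = 0)"
      using QS orth by (intro exI[of _ "Q u"]) (simp add: fun_diff_def)
    then have "p \<in> S \<and> (\<forall>w\<in>S. energy F l (\<lambda>x. u x - p x) w = 0)"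
      unfolding p_def orth_proj_def by (rule someI_ex)
    then have p: "p \<in> S" "\<And>w. w \<in> S \<Longrightarrow> energy F l (u - p) w = 0"
      by (auto simp: fun_diff_def)
    have pE: "p \<in> fdom E" using p(1) by (simp add: S_iff)
    have kE: "s \<in> fdom E" if "s \<in> T.kernel" for s using that D_mem(1) by (simp add: T.kernel_def)
    have dS: "p - Q u \<in> S"
      using p(1) QS kE by (simp add: S_iff Fl.diff_mem Fl.diff_left)
    have "sq (energy F l) (p - Q u)
        = energy F l (u - Q u) (p - Q u) - energy F l (u - p) (p - Q u)"
      using uE pE QE by (simp add: Fl.diff_left)
    also have "\<dots> = 0" using orth[OF dS] p(2)[OF dS] by simp
    finally have "sq (energy F l) (p - Q u) = 0" .
    moreover have "p - Q u \<in> fdom F" unfolding F_dom using pE QE by (rule Fl.diff_mem)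
    ultimately have "AE x in m. (p - Q u) x = 0"
      using shift_form_null_AE[OF F_pos _ l] by blast
    then have "AE x in m. p x = Q u x" by simp
    moreover have "P_proj m \<mu> E F l u = p"
      by (simp add: P_proj_def p_def S_def Let_def)
    ultimately show ?thesis using pE by simp
  qed
  have pre: "preimJ m \<mu> E v \<in> D \<and> (AE x in \<mu>. v x = preimJ m \<mu> E v x)" if "v \<in> ranJ m \<mu> E" for v
  proof -
    have "\<exists>u. u \<in> D \<and> (AE x in \<mu>. v x = u x)" using that by (auto simp: ranJ_def)
    from someI_ex[OF this] show ?thesis unfolding preimJ_def .
  qed
  have "induced_form D (energy F l) (\<lambda>u. u) \<mu> (trace_at F l) (\<lambda>v. Q (preimJ m \<mu> E v))"
  proof
    show "fdom (trace_at F l) = {v \<in> L2 \<mu>. \<exists>x\<in>D. AE t in \<mu>. v t = x t}"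
      by (simp add: trace_form_def ranJ_def)
    fix v assume "v \<in> fdom (trace_at F l)"
    then have v: "v \<in> ranJ m \<mu> E" by (simp add: trace_form_def)
    have "AE x in \<mu>. v x = Q (preimJ m \<mu> E v) x"
    proof -
      have "AE x in \<mu>. v x = preimJ m \<mu> E v x" using pre[OF v] by simp
      moreover have "AE x in \<mu>. preimJ m \<mu> E v x = Q (preimJ m \<mu> E v) x"
        using Q(1)[of "preimJ m \<mu> E v"] pre[OF v] by (simp add: T.is_lift_def)
      ultimately show ?thesis by eventually_elim simp
    qed
    then show "T.is_lift (Q (preimJ m \<mu> E v)) v"
      using Q(1)[of "preimJ m \<mu> E v"] pre[OF v] by (simp add: T.is_lift_def)
    fix w assume "w \<in> fdom (trace_at F l)"
    then have w: "w \<in> ranJ m \<mu> E" by (simp add: trace_form_def)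
    have QE: "Q u \<in> fdom F" if "u \<in> D" for u
      unfolding F_dom using Q(1)[OF that] unfolding T.is_lift_def by (blast dest: D_mem(1))
    have "energy F l (P_proj m \<mu> E F l (preimJ m \<mu> E v)) (P_proj m \<mu> E F l (preimJ m \<mu> E w))
        = energy F l (Q (preimJ m \<mu> E v)) (Q (preimJ m \<mu> E w))"
      by (rule positive_form_AE_cong[OF positive_form_shift[OF F_pos, of l]])
        (use pre[OF v] pre[OF w] proj[of "preimJ m \<mu> E v"] proj[of "preimJ m \<mu> E w"] QE F_dom l in simp_all)
    then show "bil (trace_at F l) v w
        = energy F l (Q (preimJ m \<mu> E v)) (Q (preimJ m \<mu> E w))"
      by (simp add: trace_form_def)
  qed
  then show ?thesis using that by blast
qed

lemma trace_closed: "l > 0 \<Longrightarrow> closed_form \<mu> (trace_at F l)"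
  using trace_induced induced_form.closed by metis

text \<open>
  The resolvent equation of the trace, lifted to the domain of \<open>J\<close>: the trace itself no longer occurs.
\<close>

lemma trace_resolvent_graph:
  assumes l: "l > 0" and f: "f \<in> L2 \<mu>" and u: "u \<in> D"
    and eq: "\<And>w. w \<in> D \<Longrightarrow> energy F l u w + ip \<mu> u w = ip \<mu> f w"
  shows "(u, f) \<in> res_graph \<mu> (trace_at F l)"
proof -
  obtain P where "induced_form D (energy F l) (\<lambda>u. u) \<mu> (trace_at F l) P"
    using trace_induced[OF l] .
  then interpret I: induced_form D "energy F l" "\<lambda>u. u" \<mu> "trace_at F l" P .
  show ?thesis by (rule I.resolvent_graph[OF f u]) (rule eq)
qed

lemma trace_resolvent_lift:
  assumes l: "l > 0" and f: "f \<in> L2 \<mu>"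
  obtains u where "u \<in> D" "\<And>w. w \<in> D \<Longrightarrow> energy F l u w + ip \<mu> u w = ip \<mu> f w"
    "AE x in \<mu>. resolvent1 \<mu> (trace_at F l) f x = u x"
proof -
  interpret g: semi_hilbert D "\<lambda>u v. energy F l u v + ip \<mu> u v"
    using l by (rule graph_hilbert)
  interpret V: semi_inner D "energy F l" using l by (intro Fl_semi_inner_D) simp
  obtain u where u: "u \<in> D" "\<And>w. w \<in> D \<Longrightarrow> energy F l u w + ip \<mu> u w = ip \<mu> f w"
  proof (rule g.riesz[of "ip \<mu> f" "ip \<mu> f f"])
    fix x assume x: "x \<in> D"
    have "(ip \<mu> f x)\<^sup>2 \<le> ip \<mu> f f * ip \<mu> x x"
      using f D_mem(2)[OF x] by (rule L\<mu>.cauchy_schwarz)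
    also have "\<dots> \<le> ip \<mu> f f * (energy F l x x + ip \<mu> x x)"
      using V.nonneg[OF x] L\<mu>.nonneg[OF f] by (intro mult_left_mono) auto
    finally show "(ip \<mu> f x)\<^sup>2 \<le> ip \<mu> f f * (energy F l x x + ip \<mu> x x)" .
  qed (use f D_mem(2) in \<open>auto simp: L\<mu>.expand\<close>)
  with resolvent1_AE_eqI[OF trace_closed[OF l] trace_resolvent_graph[OF l f u]]
  show ?thesis using that by blast
qed

text \<open>
  Any sequence in \<open>D\<close> that converges to \<open>u\<close> in the form norm converges to the version \<open>u'\<close> in \<open>L\<^sup>2(\<mu>)\<close>;
  conversely the constant sequence \<open>u'\<close> determines the value of the extension.
\<close>

lemma J1_ext_version:
  assumes u: "u \<in> fdom E" and u': "u' \<in> D" "AE x in m. u' x = u x"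
  shows "J1_ext m \<mu> E F u \<in> L2 \<mu>" "AE x in \<mu>. J1_ext m \<mu> E F u x = u' x"
proof -
  interpret F1: semi_inner "fdom E" "energy F 1" by (rule Fl_semi_inner) simp
  obtain K where K: "K > 0" "\<And>u. u \<in> D \<Longrightarrow> ip \<mu> u u \<le> K * E1 u u" using J1_bound by blast
  define good where "good v \<longleftrightarrow> v \<in> L2 \<mu> \<and> (\<forall>w. range w \<subseteq> domJ m \<mu> E \<and> form_conv (shift_form m F 1) w u \<longrightarrow>
        strong_conv \<mu> w v sequentially)" for v
  have eq: "energy F 1 (w - u) (w - u) = sq (energy F 1) (w - u')" if "w \<in> D" for w
  proof (rule positive_form_AE_cong[OF positive_form_shift[OF F_pos, of 1]])
    show "AE x in m. (w - u) x = (w - u') x" using u'(2) by eventually_elim simp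
    then show "AE x in m. (w - u) x = (w - u') x" .
  qed (simp_all only: zero_le_one shift_form_simps F_dom F.diff_mem u D_mem(1)[OF u'(1)] D_mem(1)[OF that])
  have u'L: "u' \<in> L2 \<mu>" using D_mem(2)[OF u'(1)] .
  have "good u'"
    unfolding good_def
  proof (intro conjI allI impI u'L)
    fix w assume w: "range w \<subseteq> domJ m \<mu> E \<and> form_conv (shift_form m F 1) w u"
    then have wD: "w n \<in> D" for n by auto
    have wu: "w n - u' \<in> D" for n using wD u' D_subspace by (auto intro: subspace_diff)
    have lim: "(\<lambda>n. sq (energy F 1) (w n - u')) \<longlonglongrightarrow> 0"
      using w eq[OF wD] by (simp add: form_conv_iff)
    have "(\<lambda>n. sq (ip \<mu>) (w n - u')) \<longlonglongrightarrow> 0"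
    proof (rule tendsto_null_squeeze[OF _ _ lim lim])
      fix n
      have "sq (ip \<mu>) (w n - u') \<le> K * sq E1 (w n - u')" by (rule K(2)[OF wu])
      also have "\<dots> \<le> K * (max c 1 * sq (energy F 1) (w n - u'))"
        using K(1) by (intro mult_left_mono F1_bounds D_mem(1) wu) auto
      finally show "sq (ip \<mu>) (w n - u') \<le> (K * max c 1) * sq (energy F 1) (w n - u') + 0 * sq (energy F 1) (w n - u')"
        by simp
      show "0 \<le> sq (ip \<mu>) (w n - u')" by (intro L\<mu>.nonneg D_mem(2) wu)
    qed
    then show "strong_conv \<mu> w u' sequentially"
      using strong_conv_iff[of w \<mu> u' sequentially] D_mem(2)[OF wD] u'L by simp
  qed
  moreover have "J1_ext m \<mu> E F u = (SOME v. good v)"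
    by (simp add: J1_ext_def good_def)
  ultimately have "good (J1_ext m \<mu> E F u)"
    using someI[of good u'] by simp
  then have L: "J1_ext m \<mu> E F u \<in> L2 \<mu>"
    and cv: "\<forall>w. range w \<subseteq> domJ m \<mu> E \<and> form_conv (shift_form m F 1) w u \<longrightarrow>
        strong_conv \<mu> w (J1_ext m \<mu> E F u) sequentially"
    unfolding good_def by (rule conjunct1, rule conjunct2)
  show "J1_ext m \<mu> E F u \<in> L2 \<mu>" by (rule L)
  have "form_conv (shift_form m F 1) (\<lambda>n. u') u"
    using F1.zero_left[of 0] unfolding form_conv_iff eq[OF u'(1)] by simp
  then have "(\<lambda>n. sq (ip \<mu>) (u' - J1_ext m \<mu> E F u)) \<longlonglongrightarrow> 0"
    using cv[rule_format, of "\<lambda>n. u'"] u'(1) u'L L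
      strong_conv_iff[of "\<lambda>n. u'" \<mu> "J1_ext m \<mu> E F u" sequentially] by simp
  then have "sq (ip \<mu>) (u' - J1_ext m \<mu> E F u) = 0"
    by (simp add: LIMSEQ_const_iff)
  then have "AE x in \<mu>. u' x = J1_ext m \<mu> E F u x"
    using ip_diff_null_iff[OF u'L L] by simp
  then show "AE x in \<mu>. J1_ext m \<mu> E F u x = u' x" by eventually_elim simp
qed

text \<open>
  The form found for vanishing shift qualifies, and it is densely defined because its domain contains
  \<open>D\<close>; the chosen form is only known through its resolvent.
\<close>

lemma trace_form0_spec:
  shows "closed_form \<mu> (trace_form0 m \<mu> E F)"
    and "f \<in> L2 \<mu> \<Longrightarrow> strong_conv \<mu> (\<lambda>l. resolvent1 \<mu> (trace_at F l) f)
           (resolvent1 \<mu> (trace_form0 m \<mu> E F) f) (at_right 0)"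
proof -
  have F_D: "semi_inner D (bil F)"
    by (rule semi_inner_subspace[OF F.semi_inner_axioms D_subspace]) (auto dest: D_mem(1))
  interpret form_completion D "bil F" \<mu>
    using F_D D_mem(2) by (simp add: form_completion_def form_completion_axioms_def subset_iff)
  have ip_D: "semi_inner D (ip m)"
    using semi_inner_subspace[OF L2_semi_inner D_subspace] D_mem(3) by blast
  obtain G where G: "closed_form \<mu> G" "D \<subseteq> fdom G"
    and lim: "\<And>f u. f \<in> L2 \<mu> \<Longrightarrow>
      (\<And>l. l > 0 \<Longrightarrow> u l \<in> D \<and> (\<forall>w\<in>D. bil F (u l) w + l * ip m (u l) w + ip \<mu> (u l) w = ip \<mu> f w)) \<Longrightarrow>
      ((\<lambda>l. sq (ip \<mu>) (u l - resolvent1 \<mu> G f)) \<longlongrightarrow> 0) (at_right 0)"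
    using vanishing_shift[OF ip_D] by blast
  have dense: "densely_defined \<mu> G"
    unfolding densely_defined_def l2norm_diff
  proof (intro ballI allI impI)
    fix f and e :: real assume f: "f \<in> L2 \<mu>" and e: "e > 0"
    obtain u where "u \<in> D" "ip \<mu> (f - u) (f - u) < e\<^sup>2"
      using D_dense[OF f, of "e\<^sup>2"] e by auto
    then show "\<exists>u\<in>fdom G. sqrt (ip \<mu> (f - u) (f - u)) < e"
      using G(2) e by (intro bexI[of _ u]) (auto intro: real_less_lsqrt)
  qed
  have conv: "strong_conv \<mu> (\<lambda>l. resolvent1 \<mu> (trace_at F l) f) (resolvent1 \<mu> G f) (at_right 0)"
    if f: "f \<in> L2 \<mu>" for f
  proof -
    have "\<forall>l. \<exists>u. l > 0 \<longrightarrow> u \<in> D \<and> (\<forall>w\<in>D. bil F u w + l * ip m u w + ip \<mu> u w = ip \<mu> f w)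
        \<and> (AE x in \<mu>. resolvent1 \<mu> (trace_at F l) f x = u x)"
    proof
      fix l :: real
      show "\<exists>u. l > 0 \<longrightarrow> u \<in> D \<and> (\<forall>w\<in>D. bil F u w + l * ip m u w + ip \<mu> u w = ip \<mu> f w)
        \<and> (AE x in \<mu>. resolvent1 \<mu> (trace_at F l) f x = u x)"
      proof (cases "l > 0")
        case True
        then show ?thesis
          using trace_resolvent_lift[OF True f] by (metis shift_form_simps(2))
      qed simp
    qed
    then obtain u where u: "\<And>l. l > 0 \<Longrightarrow> u l \<in> D \<and> (\<forall>w\<in>D. bil F (u l) w + l * ip m (u l) w + ip \<mu> (u l) w = ip \<mu> f w)"
      and ua: "\<And>l. l > 0 \<Longrightarrow> AE x in \<mu>. resolvent1 \<mu> (trace_at F l) f x = u l x"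
      by metis
    have RG: "resolvent1 \<mu> G f \<in> L2 \<mu>" using resolvent1_mem[OF G(1) f] by simp
    have "((\<lambda>l. sqrt (sq (ip \<mu>) (u l - resolvent1 \<mu> G f))) \<longlongrightarrow> sqrt 0) (at_right 0)"
      by (intro tendsto_real_sqrt lim f u)
    moreover have "\<forall>\<^sub>F l in at_right 0. sqrt (sq (ip \<mu>) (u l - resolvent1 \<mu> G f))
        = l2norm \<mu> (\<lambda>x. resolvent1 \<mu> (trace_at F l) f x - resolvent1 \<mu> G f x)"
      using eventually_at_right_less[of "0::real"]
    proof eventually_elim
      case (elim l)
      have R: "resolvent1 \<mu> (trace_at F l) f \<in> L2 \<mu>"
        using resolvent1_mem[OF trace_closed[OF elim] f] by simp
      have "sq (ip \<mu>) (u l - resolvent1 \<mu> G f)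
          = sq (ip \<mu>) (resolvent1 \<mu> (trace_at F l) f - resolvent1 \<mu> G f)"
        using u[OF elim] R RG D_mem(2)
        by (intro ip_AE_cong L2_measurable L\<mu>.diff_mem) (use ua[OF elim] in auto)
      then show ?case by (simp add: l2norm_diff)
    qed
    ultimately have "((\<lambda>l. l2norm \<mu> (\<lambda>x. resolvent1 \<mu> (trace_at F l) f x - resolvent1 \<mu> G f x)) \<longlongrightarrow> sqrt 0) (at_right 0)"
      by (rule Lim_transform_eventually)
    then show ?thesis by (simp add: strong_conv_def)
  qed
  have "\<exists>G. closed_form \<mu> G \<and> densely_defined \<mu> G \<and>
        (\<forall>f\<in>L2 \<mu>. strong_conv \<mu> (\<lambda>l. resolvent1 \<mu> (trace_at F l) f)
           (resolvent1 \<mu> G f) (at_right 0))"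
    using G(1) dense conv by blast
  note * = someI_ex[OF this, folded trace_form0_def]
  show "closed_form \<mu> (trace_form0 m \<mu> E F)" using * by blast
  show "f \<in> L2 \<mu> \<Longrightarrow> strong_conv \<mu> (\<lambda>l. resolvent1 \<mu> (trace_at F l) f)
           (resolvent1 \<mu> (trace_form0 m \<mu> E F) f) (at_right 0)" using * by blast
qed

end

section \<open>Convergence of the traces\<close>

text \<open>
  Resolvents are contractions, so strong convergence need only be checked on a total set; this
  makes a diagonal choice over a countable set possible.
\<close>

lemma strong_resolvent_total:
  fixes a :: "nat \<Rightarrow> 'a form"
  assumes closed_a: "\<And>n. closed_form M (a n)" and closed_b: "closed_form M b"
    and G: "G \<subseteq> L2 M" and total: "\<And>z. z \<in> L2 M \<Longrightarrow> (\<And>g. g \<in> G \<Longrightarrow> ip M z g = 0) \<Longrightarrow> AE x in M. z x = 0"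
    and conv: "\<And>g. g \<in> G \<Longrightarrow> strong_conv M (\<lambda>n. resolvent1 M (a n) g) (resolvent1 M b g) sequentially"
    and f: "f \<in> L2 M"
  shows "strong_conv M (\<lambda>n. resolvent1 M (a n) f) (resolvent1 M b f) sequentially"
proof -
  interpret L: semi_hilbert "L2 M" "ip M" by (rule L2_semi_hilbert)
  have pos: "positive_form M (a n)" "positive_form M b" for n
    using closed_a closed_b by (auto simp: closed_form_def)
  define R where "R n f = resolvent1 M (a n) f" for n f
  define R' where "R' f = resolvent1 M b f" for f
  have RL: "R n f \<in> L2 M" "R' f \<in> L2 M" if "f \<in> L2 M" for n f
    using resolvent1_mem[OF closed_a that] resolvent1_mem[OF closed_b that] by (auto simp: R_def R'_def)
  have gr: "(R n f, f) \<in> res_graph M (a n)" "(R' f, f) \<in> res_graph M b" if "f \<in> L2 M" for n f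
    using resolvent1_graph[OF closed_a that] resolvent1_graph[OF closed_b that] by (auto simp: R_def R'_def)
  have lin: "AE x in M. R n (s *\<^sub>R f + t *\<^sub>R g) x = (s *\<^sub>R R n f + t *\<^sub>R R n g) x"
    "AE x in M. R' (s *\<^sub>R f + t *\<^sub>R g) x = (s *\<^sub>R R' f + t *\<^sub>R R' g) x"
    if fg: "f \<in> L2 M" "g \<in> L2 M" for n f g s t
  proof -
    have "s *\<^sub>R (R n f, f) + t *\<^sub>R (R n g, g) \<in> res_graph M (a n)"
      using fg by (intro subspace_add subspace_scale res_graph_subspace pos gr)
    then have "(s *\<^sub>R R n f + t *\<^sub>R R n g, s *\<^sub>R f + t *\<^sub>R g) \<in> res_graph M (a n)"
      by simp
    from resolvent1_AE_eqI[OF closed_a this]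
    show "AE x in M. R n (s *\<^sub>R f + t *\<^sub>R g) x = (s *\<^sub>R R n f + t *\<^sub>R R n g) x"
      unfolding R_def .
    have "s *\<^sub>R (R' f, f) + t *\<^sub>R (R' g, g) \<in> res_graph M b"
      using fg by (intro subspace_add subspace_scale res_graph_subspace pos gr)
    then have "(s *\<^sub>R R' f + t *\<^sub>R R' g, s *\<^sub>R f + t *\<^sub>R g) \<in> res_graph M b"
      by simp
    from resolvent1_AE_eqI[OF closed_b this]
    show "AE x in M. R' (s *\<^sub>R f + t *\<^sub>R g) x = (s *\<^sub>R R' f + t *\<^sub>R R' g) x"
      unfolding R'_def .
  qed
  define S where "S = {f \<in> L2 M. (\<lambda>n. sq (ip M) (R n f - R' f)) \<longlonglongrightarrow> 0}"
  have GS: "g \<in> S" if "g \<in> G" for g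
  proof -
    have g: "g \<in> L2 M" using G that by auto
    show ?thesis
      using conv[OF that] strong_conv_iff[of "\<lambda>n. R n g" M "R' g" sequentially] RL[OF g] g
      by (simp add: S_def R_def R'_def)
  qed
  have lc: "s *\<^sub>R f + t *\<^sub>R g \<in> S" if fg: "f \<in> S" "g \<in> S" for f g s t
  proof -
    have L2: "f \<in> L2 M" "g \<in> L2 M" using fg by (auto simp: S_def)
    have sum: "s *\<^sub>R f + t *\<^sub>R g \<in> L2 M" using L2 by auto
    have "(\<lambda>n. sq (ip M) (R n (s *\<^sub>R f + t *\<^sub>R g) - R' (s *\<^sub>R f + t *\<^sub>R g))) \<longlonglongrightarrow> 0"
    proof (rule tendsto_null_squeeze)
      fix n
      have "sq (ip M) (R n (s *\<^sub>R f + t *\<^sub>R g) - R' (s *\<^sub>R f + t *\<^sub>R g))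
          = sq (ip M) (s *\<^sub>R (R n f - R' f) + t *\<^sub>R (R n g - R' g))"
      proof (rule ip_AE_cong)
        show "AE x in M. (R n (s *\<^sub>R f + t *\<^sub>R g) - R' (s *\<^sub>R f + t *\<^sub>R g)) x
            = (s *\<^sub>R (R n f - R' f) + t *\<^sub>R (R n g - R' g)) x"
          using lin(1)[OF L2, of n s t] lin(2)[OF L2, of s t]
          by eventually_elim (simp add: algebra_simps)
        then show "AE x in M. (R n (s *\<^sub>R f + t *\<^sub>R g) - R' (s *\<^sub>R f + t *\<^sub>R g)) x
            = (s *\<^sub>R (R n f - R' f) + t *\<^sub>R (R n g - R' g)) x" .
      qed (intro L2_measurable L.diff_mem L.add_mem L.scale_mem RL L2 sum)+
      also have "\<dots> \<le> 2 * sq (ip M) (s *\<^sub>R (R n f - R' f))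
          + 2 * sq (ip M) (t *\<^sub>R (R n g - R' g))"
        by (intro L.sq_add_le L.scale_mem L.diff_mem RL L2)
      also have "\<dots> = 2 * s\<^sup>2 * sq (ip M) (R n f - R' f) + 2 * t\<^sup>2 * sq (ip M) (R n g - R' g)"
        using L.sq_scale[OF L.diff_mem[OF RL(1)[OF L2(1)] RL(2)[OF L2(1)]], of s n]
          L.sq_scale[OF L.diff_mem[OF RL(1)[OF L2(2)] RL(2)[OF L2(2)]], of t n] by simp
      finally show "sq (ip M) (R n (s *\<^sub>R f + t *\<^sub>R g) - R' (s *\<^sub>R f + t *\<^sub>R g))
          \<le> 2 * s\<^sup>2 * sq (ip M) (R n f - R' f) + 2 * t\<^sup>2 * sq (ip M) (R n g - R' g)" .
      show "0 \<le> sq (ip M) (R n (s *\<^sub>R f + t *\<^sub>R g) - R' (s *\<^sub>R f + t *\<^sub>R g))"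
        by (intro L.nonneg L.diff_mem RL sum)
    qed (use fg in \<open>simp_all add: S_def\<close>)
    with sum show ?thesis by (simp add: S_def)
  qed
  have "0 \<in> S"
  proof -
    have "R n 0 - R' 0 \<in> L2 M \<and> (AE x in M. (R n 0 - R' 0) x = 0)" for n
      using lin(1)[of 0 0 n 0 0] lin(2)[of 0 0 0 0] RL[of 0] by auto
    then have "sq (ip M) (R n 0 - R' 0) = 0" for n
      using ip_null_iff by blast
    then show ?thesis by (simp add: S_def)
  qed
  then have S: "subspace S"
    using lc[of _ _ 1 1] lc[of _ _ _ 0] by (auto simp: subspace_def)
  have contr: "sq (ip M) (R n f - R n g) \<le> ip M (f - g) (f - g)"
    "sq (ip M) (R' f - R' g) \<le> ip M (f - g) (f - g)" if fg: "f \<in> L2 M" "g \<in> L2 M" for n f g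
  proof -
    have "(R n f, f) - (R n g, g) \<in> res_graph M (a n)"
      using fg by (intro subspace_diff res_graph_subspace pos gr)
    moreover have "(R' f, f) - (R' g, g) \<in> res_graph M b"
      using fg by (intro subspace_diff res_graph_subspace pos gr)
    ultimately show "sq (ip M) (R n f - R n g) \<le> ip M (f - g) (f - g)"
      "sq (ip M) (R' f - R' g) \<le> ip M (f - g) (f - g)"
      using res_graph_contraction[OF pos(1), of "R n f - R n g" "f - g" n]
        res_graph_contraction[OF pos(2), of "R' f - R' g" "f - g"] by simp_all
  qed
  have "(\<lambda>n. sq (ip M) (R n f - R' f)) \<longlonglongrightarrow> 0"
  proof (rule LIMSEQ_I)
    fix e :: real assume e: "e > 0"
    obtain g where g: "g \<in> S" "ip M (f - g) (f - g) < e / 12"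
    proof (rule L.dense_image[OF S, of "\<lambda>x. x" f "e / 12"])
      fix z assume "z \<in> L2 M" "\<And>x. x \<in> S \<Longrightarrow> ip M z x = 0"
      then show "ip M z z = 0" using total[of z] GS ip_null_iff by blast
    qed (use f e in \<open>auto simp: S_def\<close>)
    have gL: "g \<in> L2 M" using g by (simp add: S_def)
    obtain N where N: "\<And>n. n \<ge> N \<Longrightarrow> norm (sq (ip M) (R n g - R' g) - 0) < e / 8"
      using g(1) e LIMSEQ_D[of "\<lambda>n. sq (ip M) (R n g - R' g)" 0 "e / 8"] by (auto simp: S_def)
    have "norm (sq (ip M) (R n f - R' f) - 0) < e" if "n \<ge> N" for n
    proof -
      have "sq (ip M) (R n f - R' f) \<le> 2 * sq (ip M) (R n f - R n g) + 2 * sq (ip M) (R n g - R' f)"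
        by (intro L.sq_triangle RL f gL)
      moreover have "sq (ip M) (R n g - R' f) \<le> 2 * sq (ip M) (R n g - R' g) + 2 * sq (ip M) (R' g - R' f)"
        by (intro L.sq_triangle RL f gL)
      moreover have "sq (ip M) (R' g - R' f) = sq (ip M) (R' f - R' g)"
        by (intro L.sq_diff_commute RL f gL)
      moreover have "sq (ip M) (R n g - R' g) < e / 8" using N[OF that] by simp
      ultimately have "sq (ip M) (R n f - R' f) < e"
        using contr(1)[OF f gL, of n] contr(2)[OF f gL] g(2) by linarith
      then show ?thesis using L.nonneg[OF L.diff_mem[OF RL(1)[OF f] RL(2)[OF f]], of n] by simp
    qed
    then show "\<exists>N. \<forall>n\<ge>N. norm (sq (ip M) (R n f - R' f) - 0) < e" by blast
  qed
  then show ?thesis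
    using strong_conv_iff[of "\<lambda>n. R n f" M "R' f" sequentially] RL[OF f] by (simp add: R_def R'_def)
qed

locale trace_sequence = trace_setting m E \<mu>
  for m :: "'a::{metric_space, second_countable_topology} measure" and E :: "'a form" and \<mu> :: "'a measure" +
  fixes Fn :: "nat \<Rightarrow> 'a form" and F :: "'a form" and c :: real
  assumes comp_n: "\<And>n. comparable_form m E \<mu> (Fn n) c"
    and comp: "comparable_form m E \<mu> F c"
    and J_res: "\<And>g. g \<in> L2 m \<Longrightarrow>
      strong_conv \<mu> (\<lambda>n. J1_ext m \<mu> E (Fn n) (resolvent1 m (Fn n) g)) (J1_ext m \<mu> E F (resolvent1 m F g)) sequentially"
    and mosco: "Mosco_conv m Fn F"
begin

sublocale F: comparable_form m E \<mu> F c by (rule comp)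

lemma Fn_closed: "closed_form m (Fn n)" and Fn_dom: "fdom (Fn n) = fdom E"
  using comparable_form.F_closed[OF comp_n] comparable_form.F_dom[OF comp_n] by auto

text \<open>
  Both the Mosco convergence of the forms and the convergence of \<open>J\<^sup>n\<^sub>1 K\<^sup>n\<close> say that solutions of
  \<open>\<E>\<^sup>n\<^sub>1(y\<^sub>n, \<cdot>) = \<langle>g, \<cdot>\<rangle>\<close> converge, in \<open>L\<^sup>2(m)\<close> and in \<open>L\<^sup>2(\<mu>)\<close>.  By density and the uniform equivalence of the
  forms, this extends to all bounded right hand sides, here written as \<open>\<E>\<^sup>\<infinity>\<^sub>1(u, \<cdot>)\<close>.
\<close>

lemma dual_solutions_converge:
  assumes u: "u \<in> D" and y: "\<And>n. y n \<in> D"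
    and eq: "\<And>n w. w \<in> D \<Longrightarrow> energy (Fn n) 1 (y n) w = energy F 1 u w"
  shows "(\<lambda>n. sq (ip \<mu>) (y n - u)) \<longlonglongrightarrow> 0" "(\<lambda>n. sq (ip m) (y n - u)) \<longlonglongrightarrow> 0"
proof -
  interpret F1: semi_inner D "energy F 1" by (rule F.Fl_semi_inner_D) simp
  define C where "C = max c 1"
  have C: "C \<ge> 1" by (simp add: C_def)
  have gen: "(\<lambda>n. sq s (y n - u)) \<longlonglongrightarrow> 0"
    if s: "semi_inner D s" and K: "K > 0" "\<And>u. u \<in> D \<Longrightarrow> s u u \<le> K * E1 u u"
      and res: "\<And>g z x. g \<in> L2 m \<Longrightarrow> (\<And>n. z n \<in> D) \<Longrightarrow> x \<in> D \<Longrightarrow>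
        (\<And>n. AE t in m. z n t = resolvent1 m (Fn n) g t) \<Longrightarrow> (AE t in m. x t = resolvent1 m F g t) \<Longrightarrow>
        (\<lambda>n. sq s (z n - x)) \<longlonglongrightarrow> 0" for s K
  proof (rule LIMSEQ_I)
    interpret s: semi_inner D s by fact
    fix e :: real assume e: "e > 0"
    \<comment> \<open>\<open>d\<close> is chosen such that \<open>2 K C\<^sup>3 d + 4 K C d = e / 2\<close>.\<close>
    define d where "d = e / (4 * K * C ^ 3 + 8 * K * C)"
    have den: "4 * K * C ^ 3 + 8 * K * C > 0" using K(1) C by (simp add: add_pos_pos)
    have d: "d > 0" using e den by (simp add: d_def)
    have "u \<in> fdom F" using D_mem(1)[OF u] F.F_dom by simp
    then obtain t where t: "\<And>n::nat. t n \<in> res_graph m F"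
      "(\<lambda>n. sq (energy F 1) (fst (t n) - u)) \<longlonglongrightarrow> 0"
      using operator_domain_core[OF F.F_closed, of u] by blast
    have "\<forall>\<^sub>F k in sequentially. sq (energy F 1) (fst (t k) - u) < d"
      using t(2) d by (rule order_tendstoD)
    then obtain k where k: "sq (energy F 1) (fst (t k) - u) < d"
      by (auto simp: eventually_sequentially)
    obtain x0 g where xg: "t k = (x0, g)" by (cases "t k")
    have gr: "(x0, g) \<in> res_graph m F" using t(1)[of k] xg by simp
    then have g: "g \<in> L2 m" and x0: "x0 \<in> fdom E" using F.F_dom by (auto simp: res_graph_def)
    obtain x where x: "x \<in> D" "AE s in m. x s = x0 s" using version_exists[OF x0] .
    have xE: "x \<in> fdom E" and uE: "u \<in> fdom E" using D_mem(1) x u by auto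
    have F1x: "energy F 1 x w = ip m g w" if w: "w \<in> D" for w
    proof -
      have "energy F 1 x w = energy F 1 x0 w"
        by (rule positive_form_AE_cong[OF positive_form_shift[OF F.F_pos, of 1]])
          (use x x0 xE D_mem(1)[OF w] F.F_dom in simp_all)
      then show ?thesis using gr D_mem(1)[OF w] F.F_dom by (auto simp: res_graph_def)
    qed
    have xu: "energy F 1 (x - u) (x - u) < d"
    proof -
      have "energy F 1 (x - u) (x - u) = sq (energy F 1) (x0 - u)"
      proof (rule positive_form_AE_cong[OF positive_form_shift[OF F.F_pos, of 1]])
        show "x - u \<in> fdom (shift_form m F 1)" "x0 - u \<in> fdom (shift_form m F 1)"
          unfolding shift_form_simps F.F_dom by (rule H.diff_mem[OF xE uE], rule H.diff_mem[OF x0 uE])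
        then show "x - u \<in> fdom (shift_form m F 1)" "x0 - u \<in> fdom (shift_form m F 1)" .
        show "AE s in m. (x - u) s = (x0 - u) s" using x(2) by eventually_elim simp
        then show "AE s in m. (x - u) s = (x0 - u) s" .
      qed simp
      then show ?thesis using k xg by simp
    qed
    have "\<forall>n. \<exists>z\<in>D. AE s in m. z s = resolvent1 m (Fn n) g s"
    proof
      fix n
      have "resolvent1 m (Fn n) g \<in> fdom E" using resolvent1_mem[OF Fn_closed g] Fn_dom by simp
      then show "\<exists>z\<in>D. AE s in m. z s = resolvent1 m (Fn n) g s" using version_exists by metis
    qed
    then obtain z where z: "\<And>n. z n \<in> D" "\<And>n. AE s in m. z n s = resolvent1 m (Fn n) g s" by metis
    have xres: "AE s in m. x s = resolvent1 m F g s"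
      using x(2) resolvent1_AE_eqI[OF F.F_closed gr] by eventually_elim simp
    have szx: "(\<lambda>n. sq s (z n - x)) \<longlonglongrightarrow> 0"
      by (rule res[OF g z(1) x(1) z(2) xres])
    then obtain N where N: "\<And>n. n \<ge> N \<Longrightarrow> norm (sq s (z n - x) - 0) < e / 8"
      using LIMSEQ_D[OF szx, of "e / 8"] e by auto
    have "norm (sq s (y n - u) - 0) < e" if n: "n \<ge> N" for n
    proof -
      interpret Fn: comparable_form m E \<mu> "Fn n" c by (rule comp_n)
      interpret Fn1: semi_inner D "energy (Fn n) 1" by (rule Fn.Fl_semi_inner_D) simp
      define q where "q = y n - z n"
      have q: "q \<in> D" unfolding q_def by (intro Fn1.diff_mem y z(1))
      have qE: "q \<in> fdom E" using q by (rule D_mem(1))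
      have zn: "energy (Fn n) 1 (z n) w = ip m g w" if w: "w \<in> D" for w
      proof -
        have "energy (Fn n) 1 (z n) w = energy (Fn n) 1 (resolvent1 m (Fn n) g) w"
          by (rule positive_form_AE_cong[OF positive_form_shift[OF Fn.F_pos, of 1]])
            (use z D_mem(1)[OF w] D_mem(1)[OF z(1)] resolvent1_mem[OF Fn_closed g] Fn_dom in simp_all)
        then show ?thesis
          using resolvent1_graph[OF Fn_closed g, of n] D_mem(1)[OF w] Fn_dom by (auto simp: res_graph_def)
      qed
      have "energy (Fn n) 1 q q = energy F 1 (u - x) q"
        using eq[OF q] zn[OF q] F1x[OF q] y z u x q unfolding q_def[symmetric]
        by (simp add: F1.diff_left) (simp add: q_def Fn1.diff_left)
      define A where "A = energy (Fn n) 1 q q"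
      have A0: "A \<ge> 0" unfolding A_def by (rule Fn1.nonneg[OF q])
      have E1q: "E1 q q \<le> C * A" unfolding A_def C_def by (rule Fn.F1_bounds[OF qE])
      have "A\<^sup>2 \<le> energy F 1 (u - x) (u - x) * energy F 1 q q"
        unfolding A_def \<open>energy (Fn n) 1 q q = _\<close>
        by (intro F1.cauchy_schwarz F1.diff_mem u x q)
      also have "energy F 1 (u - x) (u - x) = energy F 1 (x - u) (x - u)"
        by (intro F1.sq_diff_commute u x)
      also have "energy F 1 (x - u) (x - u) * energy F 1 q q \<le> d * (C * (C * A))"
      proof (rule mult_mono)
        have "energy F 1 q q \<le> C * E1 q q" unfolding C_def by (rule F.F1_bounds[OF qE])
        also have "\<dots> \<le> C * (C * A)" using E1q C by (intro mult_left_mono) auto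
        finally show "energy F 1 q q \<le> C * (C * A)" .
      qed (use xu d F1.nonneg[OF q] in auto)
      finally have "A * A \<le> (d * C\<^sup>2) * A" by (simp add: power2_eq_square mult_ac)
      then have Ad: "A \<le> d * C\<^sup>2"
        using A0 d C by (cases "A = 0") auto
      have "s q q \<le> K * E1 q q" using K(2) q .
      also have "\<dots> \<le> K * (C * (d * C\<^sup>2))"
      proof (rule mult_left_mono)
        have "C * A \<le> C * (d * C\<^sup>2)" using Ad C by (intro mult_left_mono) auto
        with E1q show "E1 q q \<le> C * (d * C\<^sup>2)" by linarith
      qed (use K(1) in simp)
      finally have sq: "s q q \<le> K * C ^ 3 * d" by (simp add: power2_eq_square power3_eq_cube mult_ac)
      have xuD: "x - u \<in> D" using x u by (intro F1.diff_mem)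
      have "s (x - u) (x - u) \<le> K * E1 (x - u) (x - u)" using K(2) xuD .
      also have "\<dots> \<le> K * (C * d)"
      proof (intro mult_left_mono)
        have "E1 (x - u) (x - u) \<le> C * energy F 1 (x - u) (x - u)"
          unfolding C_def by (rule F.F1_bounds[OF D_mem(1)[OF xuD]])
        also have "\<dots> \<le> C * d" using xu C by (intro mult_left_mono) auto
        finally show "E1 (x - u) (x - u) \<le> C * d" .
      qed (use K in auto)
      finally have sxu: "s (x - u) (x - u) \<le> K * C * d" by (simp add: mult_ac)
      have "sq s (y n - u) \<le> 2 * sq s (y n - z n) + 2 * sq s (z n - u)"
        by (intro s.sq_triangle y z u)
      moreover have "sq s (z n - u) \<le> 2 * sq s (z n - x) + 2 * s (x - u) (x - u)"
        by (intro s.sq_triangle y z u x)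
      moreover have "sq s (z n - x) < e / 8" using N[OF n] by simp
      moreover have "2 * (K * C ^ 3 * d) + 4 * (K * C * d) = e / 2"
      proof -
        have "2 * (K * C ^ 3 * d) + 4 * (K * C * d) = (4 * K * C ^ 3 + 8 * K * C) * d / 2"
          by (simp add: algebra_simps)
        also have "\<dots> = e / 2" using den by (simp add: d_def)
        finally show ?thesis .
      qed
      ultimately have "sq s (y n - u) < e"
        using sq sxu e unfolding q_def by linarith
      moreover have "0 \<le> sq s (y n - u)" by (intro s.nonneg s.diff_mem y u)
      ultimately show ?thesis by simp
    qed
    then show "\<exists>N. \<forall>n\<ge>N. norm (sq s (y n - u) - 0) < e" by blast
  qed
  obtain K where K: "K > 0" "\<And>u. u \<in> D \<Longrightarrow> ip \<mu> u u \<le> K * E1 u u" using J1_bound by blast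
  show "(\<lambda>n. sq (ip \<mu>) (y n - u)) \<longlonglongrightarrow> 0"
  proof (rule gen[of "ip \<mu>" K])
    show "K > 0" "\<And>u. u \<in> D \<Longrightarrow> ip \<mu> u u \<le> K * E1 u u" by (rule K)+
    show "semi_inner D (ip \<mu>)"
      using semi_inner_subspace[OF L2_semi_inner D_subspace] D_mem(2) by blast
    fix g z x assume g: "g \<in> L2 m" and z: "\<And>n. z n \<in> D" "\<And>n. AE t in m. z n t = resolvent1 m (Fn n) g t"
      and x: "x \<in> D" "AE t in m. x t = resolvent1 m F g t"
    have RE: "resolvent1 m (Fn n) g \<in> fdom E" "resolvent1 m F g \<in> fdom E" for n
      using resolvent1_mem[OF Fn_closed g] resolvent1_mem[OF F.F_closed g] Fn_dom F.F_dom by auto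
    show "(\<lambda>n. sq (ip \<mu>) (z n - x)) \<longlonglongrightarrow> 0"
      by (rule strong_conv_versions[THEN iffD1, rotated -1, OF J_res[OF g]])
        (rule comparable_form.J1_ext_version[OF comp_n RE(1) z] F.J1_ext_version[OF RE(2) x] D_mem(2) z(1) x(1))+
  qed
  show "(\<lambda>n. sq (ip m) (y n - u)) \<longlonglongrightarrow> 0"
  proof (rule gen[of "ip m" 1])
    show "semi_inner D (ip m)"
      using semi_inner_subspace[OF L2_semi_inner D_subspace] D_mem(3) by blast
    show "ip m u u \<le> 1 * E1 u u" if "u \<in> D" for u
      using ip_le_E1[OF D_mem(1)[OF that]] by simp
    fix g z x assume g: "g \<in> L2 m" and z: "\<And>n. z n \<in> D" "\<And>n. AE t in m. z n t = resolvent1 m (Fn n) g t"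
      and x: "x \<in> D" "AE t in m. x t = resolvent1 m F g t"
    have R: "resolvent1 m (Fn n) g \<in> L2 m" "resolvent1 m F g \<in> L2 m" for n
      using resolvent1_mem[OF Fn_closed g] resolvent1_mem[OF F.F_closed g] by auto
    have zR: "AE t in m. resolvent1 m (Fn n) g t = z n t" for n
      using z(2)[of n] by eventually_elim simp
    have xR: "AE t in m. resolvent1 m F g t = x t"
      using x(2) by eventually_elim simp
    show "(\<lambda>n. sq (ip m) (z n - x)) \<longlonglongrightarrow> 0"
      by (rule strong_conv_versions[THEN iffD1, rotated -1,
            OF Mosco_imp_strong_resolvent[OF Fn_closed F.F_closed mosco g]])
        (rule R D_mem(3) z(1) x(1) zR xR)+
  qed simp
qed

text \<open>
  Let \<open>u\<^sub>n\<close> and \<open>u\<close> be the lifted resolvents for a shift \<open>l\<close>, and let \<open>y\<^sub>n\<close> solve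
  \<open>\<E>\<^sup>n\<^sub>1(y\<^sub>n, \<cdot>) = \<E>\<^sup>\<infinity>\<^sub>1(u, \<cdot>)\<close>.  In the equation for \<open>u\<^sub>n - y\<^sub>n\<close> the forms cancel, and the right hand side
  \<open>(l - 1) \<langle>u - y\<^sub>n, \<cdot>\<rangle>\<^sub>m + \<langle>u - y\<^sub>n, \<cdot>\<rangle>\<^sub>\<mu>\<close> is small by the preceding lemma.
\<close>

lemma trace_resolvents_converge:
  assumes l: "l > 0" and f: "f \<in> L2 \<mu>"
  shows "strong_conv \<mu> (\<lambda>n. resolvent1 \<mu> (trace_at (Fn n) l) f)
    (resolvent1 \<mu> (trace_at F l) f) sequentially"
proof -
  interpret km: semi_inner D "ip \<mu>"
    using semi_inner_subspace[OF L2_semi_inner D_subspace] D_mem(2) by blast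
  interpret hm: semi_inner D "ip m"
    using semi_inner_subspace[OF L2_semi_inner D_subspace] D_mem(3) by blast
  interpret F1: semi_inner D "energy F 1" by (rule F.Fl_semi_inner_D) simp
  obtain u where u: "u \<in> D" and ue: "\<And>w. w \<in> D \<Longrightarrow> energy F l u w + ip \<mu> u w = ip \<mu> f w"
    and ua: "AE x in \<mu>. resolvent1 \<mu> (trace_at F l) f x = u x"
    using F.trace_resolvent_lift[OF l f] by blast
  have "\<forall>n. \<exists>v. v \<in> D \<and> (\<forall>w\<in>D. energy (Fn n) l v w + ip \<mu> v w = ip \<mu> f w)
      \<and> (AE x in \<mu>. resolvent1 \<mu> (trace_at (Fn n) l) f x = v x)"
    using comparable_form.trace_resolvent_lift[OF comp_n l f] by metis
  then obtain v where v: "\<And>n. v n \<in> D"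
    and ve: "\<And>n w. w \<in> D \<Longrightarrow> energy (Fn n) l (v n) w + ip \<mu> (v n) w = ip \<mu> f w"
    and va: "\<And>n. AE x in \<mu>. resolvent1 \<mu> (trace_at (Fn n) l) f x = v n x"
    by metis
  have "\<exists>y\<in>D. \<forall>w\<in>D. energy (Fn n) 1 y w = energy F 1 u w" for n
  proof -
    interpret Fn: comparable_form m E \<mu> "Fn n" c by (rule comp_n)
    interpret Fn1: semi_hilbert D "energy (Fn n) 1" by (rule Fn.Fl_hilbert) simp
    define C where "C = energy F 1 u u * (max c 1 * max c 1)"
    obtain y where "y \<in> D" "\<And>w. w \<in> D \<Longrightarrow> energy (Fn n) 1 y w = energy F 1 u w"
    proof (rule Fn1.riesz[of "energy F 1 u" C])
      fix w assume w: "w \<in> D"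
      have "(energy F 1 u w)\<^sup>2 \<le> energy F 1 u u * energy F 1 w w"
        by (rule F1.cauchy_schwarz[OF u w])
      also have "\<dots> \<le> energy F 1 u u * (max c 1 * (max c 1 * energy (Fn n) 1 w w))"
      proof (rule mult_left_mono[OF _ F1.nonneg[OF u]])
        have "energy F 1 w w \<le> max c 1 * E1 w w"
          by (rule F.F1_bounds[OF D_mem(1)[OF w]])
        also have "\<dots> \<le> max c 1 * (max c 1 * energy (Fn n) 1 w w)"
          by (intro mult_left_mono Fn.F1_bounds D_mem(1) w) simp
        finally show "energy F 1 w w \<le> max c 1 * (max c 1 * energy (Fn n) 1 w w)" .
      qed
      finally show "(energy F 1 u w)\<^sup>2 \<le> C * energy (Fn n) 1 w w"
        by (simp add: C_def mult_ac)
    qed (use u in \<open>auto simp: F1.expand\<close>)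
    then show ?thesis by blast
  qed
  then obtain y where y: "\<And>n. y n \<in> D"
    and ye: "\<And>n w. w \<in> D \<Longrightarrow> energy (Fn n) 1 (y n) w = energy F 1 u w"
    by metis
  note yk = dual_solutions_converge(1)[OF u y ye] and yh = dual_solutions_converge(2)[OF u y ye]
  define a where "a = (l - 1)\<^sup>2 / l"
  have bound: "sq (ip \<mu>) (v n - u) \<le> 2 * a * sq (ip m) (y n - u) + 4 * sq (ip \<mu>) (y n - u)" for n
  proof -
    interpret Fn: comparable_form m E \<mu> "Fn n" c by (rule comp_n)
    interpret Fl: semi_inner D "energy (Fn n) l" using l by (intro Fn.Fl_semi_inner_D) simp
    define d where "d = v n - y n"
    define q where "q = u - y n"
    have dD: "d \<in> D" and qD: "q \<in> D" unfolding d_def q_def using v y u by (auto simp del: minus_apply)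
    have e1: "energy (Fn n) l (v n) d = ip \<mu> f d - ip \<mu> (v n) d"
      using ve[OF dD, of n] by simp
    have e2: "energy (Fn n) l (y n) d = energy F 1 u d + (l - 1) * ip m (y n) d"
      using ye[OF dD, of n] by (simp add: shift_form_simps algebra_simps)
    have e3: "ip \<mu> f d = energy F 1 u d + (l - 1) * ip m u d + ip \<mu> u d"
      using ue[OF dD] by (simp add: shift_form_simps algebra_simps)
    have "energy (Fn n) l d d = energy (Fn n) l (v n) d - energy (Fn n) l (y n) d"
      unfolding d_def by (rule Fl.diff_left) (use v y dD in \<open>auto simp: d_def simp del: minus_apply\<close>)
    also have "\<dots> = (l - 1) * (ip m u d - ip m (y n) d) + (ip \<mu> u d - ip \<mu> (v n) d)"
      unfolding e1 e2 e3 by (simp add: algebra_simps)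
    also have "ip m u d - ip m (y n) d = ip m q d"
      unfolding q_def by (rule hm.diff_left[symmetric]) (use u y dD in auto)
    also have "ip \<mu> u d - ip \<mu> (v n) d = ip \<mu> q d - ip \<mu> d d"
      using km.diff_left[OF u y dD, of n] km.diff_left[OF v y dD, of n n] by (simp add: q_def d_def)
    finally have main: "energy (Fn n) l d d = (l - 1) * ip m q d + (ip \<mu> q d - ip \<mu> d d)" .
    \<comment> \<open>The weights let half of \<open>l * ip m d d\<close> absorb the term with \<open>d\<close>.\<close>
    have "2 * ip m (((l - 1) / sqrt l) *\<^sub>R q) (sqrt l *\<^sub>R d)
        \<le> sq (ip m) (((l - 1) / sqrt l) *\<^sub>R q) + sq (ip m) (sqrt l *\<^sub>R d)"
      by (intro hm.young hm.scale_mem qD dD)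
    moreover have "ip m (((l - 1) / sqrt l) *\<^sub>R q) (sqrt l *\<^sub>R d) = (l - 1) * ip m q d"
      using l qD dD by (simp add: hm.scale_left hm.scale_right)
    moreover have "sq (ip m) (((l - 1) / sqrt l) *\<^sub>R q) = a * ip m q q"
      using l unfolding hm.sq_scale[OF qD] by (simp add: power_divide a_def)
    moreover have "sq (ip m) (sqrt l *\<^sub>R d) = l * ip m d d"
      using l unfolding hm.sq_scale[OF dD] by simp
    ultimately have y1: "2 * ((l - 1) * ip m q d) \<le> a * ip m q q + l * ip m d d"
      by simp
    have y2: "2 * ip \<mu> q d \<le> ip \<mu> q q + ip \<mu> d d" by (rule km.young[OF qD dD])
    have "l * ip m d d \<le> energy (Fn n) l d d"
      using Fn.F.nonneg[OF D_mem(1)[OF dD]] by (simp add: shift_form_simps)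
    moreover have "0 \<le> l * ip m d d" using l hm.nonneg[OF dD] by simp
    ultimately have kd: "ip \<mu> d d \<le> a * ip m q q + ip \<mu> q q"
      using main y1 y2 by linarith
    have "sq (ip \<mu>) (v n - u) \<le> 2 * sq (ip \<mu>) (v n - y n) + 2 * sq (ip \<mu>) (y n - u)"
      by (intro km.sq_triangle v y u)
    also have "\<dots> \<le> 2 * (a * ip m q q + ip \<mu> q q) + 2 * sq (ip \<mu>) (y n - u)"
      using kd by (simp add: d_def)
    finally show ?thesis
      using hm.sq_diff_commute[OF u y, of n] km.sq_diff_commute[OF u y, of n] by (simp add: q_def)
  qed
  have vu: "(\<lambda>n. sq (ip \<mu>) (v n - u)) \<longlonglongrightarrow> 0"
    by (rule tendsto_null_squeeze[OF _ bound yh yk]) (intro km.nonneg km.diff_mem v u)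
  have R: "resolvent1 \<mu> (trace_at (Fn n) l) f \<in> L2 \<mu>" "resolvent1 \<mu> (trace_at F l) f \<in> L2 \<mu>" for n
    using resolvent1_mem[OF comparable_form.trace_closed[OF comp_n l] f] resolvent1_mem[OF F.trace_closed[OF l] f] by auto
  show ?thesis
    by (rule strong_conv_versions[THEN iffD2, rotated -1, OF vu]) (rule R D_mem(2) v u va ua)+
qed

lemma trace_Mosco:
  assumes l: "l > 0"
  shows "Mosco_conv \<mu> (\<lambda>n. trace_at (Fn n) l) (trace_at F l)"
proof -
  interpret resolvent_convergence \<mu> "\<lambda>n. trace_at (Fn n) l" "trace_at F l"
    by unfold_locales
      (use comparable_form.trace_closed[OF comp_n l] F.trace_closed[OF l] trace_resolvents_converge[OF l] in auto)
  show ?thesis by (rule Mosco)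
qed

text \<open>
  The functions \<open>g\<^sub>i\<close> are the indicators of a countable total family; \<open>n\<^sub>j\<close> is chosen such that the
  resolvents for the shift \<open>l\<^sub>j\<close> are close to their limit at \<open>g\<^sub>0, \<dots>, g\<^sub>j\<close>.
\<close>

lemma trace_Mosco_vanishing_shift:
  fixes l :: "nat \<Rightarrow> real"
  assumes l: "\<And>j. l j > 0" "l \<longlonglongrightarrow> 0"
  obtains n :: "nat \<Rightarrow> nat" where "filterlim n at_top sequentially"
    "Mosco_conv \<mu> (\<lambda>j. trace_at (Fn (n j)) (l j)) (trace_form0 m \<mu> E F)"
proof -
  obtain \<U> :: "'a set set" where \<U>: "countable \<U>" "\<U> \<noteq> {}" "\<Union>\<U> = UNIV" "Int_stable \<U>"
    "\<And>U. U \<in> \<U> \<Longrightarrow> open U" "\<And>U. U \<in> \<U> \<Longrightarrow> compact (closure U)" "sets borel = sigma_sets UNIV \<U>"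
    using relatively_compact_pi_basis[OF locally_compact] by metis
  define g where "g i = (indicator (from_nat_into \<U> i) :: 'a \<Rightarrow> real)" for i
  have g: "g i \<in> L2 \<mu>" for i
    unfolding g_def using \<U>(5,6)[OF from_nat_into[OF \<U>(2)]]
    by (intro indicator_L2 relatively_compact_finite[OF radon_\<mu>])
  define R where "R n j f = resolvent1 \<mu> (trace_at (Fn n) (l j)) f" for n j f
  define R' where "R' j f = resolvent1 \<mu> (trace_at F (l j)) f" for j f
  define R0 where "R0 f = resolvent1 \<mu> (trace_form0 m \<mu> E F) f" for f
  have cl: "closed_form \<mu> (trace_at (Fn n) (l j))" for n j
    using comparable_form.trace_closed[OF comp_n l(1)] .
  have RL: "R n j f \<in> L2 \<mu>" "R' j f \<in> L2 \<mu>" "R0 f \<in> L2 \<mu>" if "f \<in> L2 \<mu>" for n j f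
    unfolding R_def R'_def R0_def
    using resolvent1_mem[OF cl that] resolvent1_mem[OF F.trace_closed[OF l(1)] that]
      resolvent1_mem[OF F.trace_form0_spec(1) that] by auto
  have "\<exists>N. N \<ge> j \<and> (\<forall>i\<le>j. sq (ip \<mu>) (R N j (g i) - R' j (g i)) < 1 / real (Suc j))" for j
  proof -
    have "\<forall>\<^sub>F N in sequentially. sq (ip \<mu>) (R N j (g i) - R' j (g i)) < 1 / real (Suc j)" for i
    proof -
      have "(\<lambda>N. sq (ip \<mu>) (R N j (g i) - R' j (g i))) \<longlonglongrightarrow> 0"
        using trace_resolvents_converge[OF l(1) g] RL[OF g]
          strong_conv_iff[of "\<lambda>N. R N j (g i)" \<mu> "R' j (g i)" sequentially] by (simp add: R_def R'_def)
      then show ?thesis by (rule order_tendstoD(2)) simp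
    qed
    then have "\<forall>\<^sub>F N in sequentially. \<forall>i\<in>{..j}. sq (ip \<mu>) (R N j (g i) - R' j (g i)) < 1 / real (Suc j)"
      by (intro eventually_ball_finite) auto
    then have "\<forall>\<^sub>F N in sequentially. N \<ge> j \<and> (\<forall>i\<in>{..j}. sq (ip \<mu>) (R N j (g i) - R' j (g i)) < 1 / real (Suc j))"
      using eventually_ge_at_top by (intro eventually_conj)
    then obtain N where "N \<ge> j" "\<forall>i\<in>{..j}. sq (ip \<mu>) (R N j (g i) - R' j (g i)) < 1 / real (Suc j)"
      unfolding eventually_sequentially by blast
    then show ?thesis by auto
  qed
  then obtain n where n: "\<And>j. n j \<ge> j"
    "\<And>j i. i \<le> j \<Longrightarrow> sq (ip \<mu>) (R (n j) j (g i) - R' j (g i)) < 1 / real (Suc j)"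
    by metis
  have l0: "filterlim l (at_right 0) sequentially"
    using l by (intro tendsto_imp_filterlim_at_right) auto
  have conv: "strong_conv \<mu> (\<lambda>j. R (n j) j (g i)) (R0 (g i)) sequentially" for i
  proof -
    have "strong_conv \<mu> (\<lambda>j. R' j (g i)) (R0 (g i)) sequentially"
      using filterlim_compose[OF F.trace_form0_spec(2)[OF g, unfolded strong_conv_def] l0]
      by (simp add: strong_conv_def R'_def R0_def)
    then have lim': "(\<lambda>j. sq (ip \<mu>) (R' j (g i) - R0 (g i))) \<longlonglongrightarrow> 0"
      using strong_conv_iff[of "\<lambda>j. R' j (g i)" \<mu> "R0 (g i)" sequentially] RL[OF g] by simp
    have "(\<lambda>j. 2 * (1 / real (Suc j)) + 2 * sq (ip \<mu>) (R' j (g i) - R0 (g i))) \<longlonglongrightarrow> 2 * 0 + 2 * 0"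
      by (intro tendsto_intros lim' LIMSEQ_Suc[OF lim_1_over_n])
    then have lim: "(\<lambda>j. 2 * (1 / real (Suc j)) + 2 * sq (ip \<mu>) (R' j (g i) - R0 (g i))) \<longlonglongrightarrow> 0"
      by simp
    have "(\<lambda>j. sq (ip \<mu>) (R (n j) j (g i) - R0 (g i))) \<longlonglongrightarrow> 0"
    proof (rule Lim_null_comparison[OF _ lim])
      show "\<forall>\<^sub>F j in sequentially. norm (sq (ip \<mu>) (R (n j) j (g i) - R0 (g i)))
          \<le> 2 * (1 / real (Suc j)) + 2 * sq (ip \<mu>) (R' j (g i) - R0 (g i))"
        using eventually_ge_at_top[of i]
      proof eventually_elim
        case (elim j)
        have "sq (ip \<mu>) (R (n j) j (g i) - R0 (g i))
            \<le> 2 * sq (ip \<mu>) (R (n j) j (g i) - R' j (g i))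
              + 2 * sq (ip \<mu>) (R' j (g i) - R0 (g i))"
          by (intro L\<mu>.sq_triangle RL g)
        moreover have "0 \<le> sq (ip \<mu>) (R (n j) j (g i) - R0 (g i))"
          by (intro L\<mu>.nonneg L\<mu>.diff_mem RL g)
        ultimately show ?case using n(2)[OF elim] unfolding real_norm_def by linarith
      qed
    qed
    then show ?thesis
      using strong_conv_iff[of "\<lambda>j. R (n j) j (g i)" \<mu> "R0 (g i)" sequentially] RL[OF g] by simp
  qed
  interpret resolvent_convergence \<mu> "\<lambda>j. trace_at (Fn (n j)) (l j)" "trace_form0 m \<mu> E F"
  proof
    fix f assume f: "f \<in> L2 \<mu>"
    show "strong_conv \<mu> (\<lambda>j. resolvent1 \<mu> (trace_at (Fn (n j)) (l j)) f)
        (resolvent1 \<mu> (trace_form0 m \<mu> E F) f) sequentially"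
    proof (rule strong_resolvent_total[OF cl F.trace_form0_spec(1) _ _ _ f])
      show "range g \<subseteq> L2 \<mu>" using g by auto
      show "AE x in \<mu>. z x = 0" if z: "z \<in> L2 \<mu>" and orth: "\<And>h. h \<in> range g \<Longrightarrow> ip \<mu> z h = 0" for z
      proof (rule L2_orthogonal_to_indicators[OF radon_\<mu> z \<U>(1,3,4,7,5,6)])
        fix U assume "U \<in> \<U>"
        then obtain i where "from_nat_into \<U> i = U" using \<U>(1) from_nat_into_surj by metis
        then have "indicator U = g i" by (simp add: g_def)
        then show "ip \<mu> z (indicator U) = 0" using orth by simp
      qed
      show "strong_conv \<mu> (\<lambda>j. resolvent1 \<mu> (trace_at (Fn (n j)) (l j)) h)
          (resolvent1 \<mu> (trace_form0 m \<mu> E F) h) sequentially" if "h \<in> range g" for h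
        using conv that by (auto simp: R_def R0_def)
    qed
  qed (use cl F.trace_form0_spec(1) in auto)
  have "filterlim n at_top sequentially"
    using n(1) filterlim_at_top_mono[OF filterlim_ident, of n] by simp
  then show ?thesis using Mosco that by blast
qed

end

theorem theorem6p1:
  fixes m \<mu> :: "'a::{metric_space, second_countable_topology} measure"
    and E :: "'a form"
    and En :: "enat \<Rightarrow> 'a form"
  assumes "locally_compact_space (euclidean :: 'a topology)"
    and "radon_measure m" and "full_support m"
    and "regular_dirichlet_form m E"
    and "radon_measure \<mu>" and "charges_no_zero_capacity m E \<mu>"
    and "\<And>n::nat. regular_dirichlet_form m (En (enat n))"
    and "dirichlet_form m (En \<infinity>)"
    and "\<And>n::enat. fdom (En n) = fdom E"
    and A1: "\<exists>c>0. \<forall>n::enat. \<forall>u\<in>fdom E.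
          inverse c * bil E u u \<le> bil (En n) u u \<and> bil (En n) u u \<le> c * bil E u u"
    and A2: "J1_continuous m \<mu> E E"
    and A3: "\<And>u. u \<in> L2 m \<Longrightarrow>
          strong_conv \<mu> (\<lambda>n::nat. J1_ext m \<mu> E (En (enat n)) (resolvent1 m (En (enat n)) u))
            (J1_ext m \<mu> E (En \<infinity>) (resolvent1 m (En \<infinity>) u)) sequentially"
    and "Mosco_conv m (\<lambda>n. En (enat n)) (En \<infinity>)"
  shows "(\<forall>l>0. Mosco_conv \<mu> (\<lambda>n. trace_form m \<mu> E (En (enat n)) l) (trace_form m \<mu> E (En \<infinity>) l)) \<and>
    (\<forall>l :: nat \<Rightarrow> real. (\<forall>j. l j > 0) \<and> decseq l \<and> l \<longlonglongrightarrow> 0 \<longrightarrow>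
       (\<exists>n :: nat \<Rightarrow> nat. filterlim n at_top sequentially \<and>
          Mosco_conv \<mu> (\<lambda>j. trace_form m \<mu> E (En (enat (n j))) (l j)) (trace_form0 m \<mu> E (En \<infinity>))))"
proof -
  have E: "dirichlet_form m E" using assms(4) by (simp add: regular_dirichlet_form_def)
  interpret trace_setting m E \<mu>
    by unfold_locales (use E assms in auto)
  obtain c where c: "c > 0" and cb: "\<And>n u. u \<in> fdom E \<Longrightarrow>
      inverse c * bil E u u \<le> bil (En n) u u \<and> bil (En n) u u \<le> c * bil E u u"
    using A1 by blast
  have "closed_form m (En n)" for n
    using assms(7,8) by (cases n) (auto simp: regular_dirichlet_form_def dirichlet_form_def)
  then have comp: "comparable_form m E \<mu> (En n) c" for n
    by unfold_locales (use assms(9) c cb in auto)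
  interpret trace_sequence m E \<mu> "\<lambda>n. En (enat n)" "En \<infinity>" c
    by (rule trace_sequence.intro[OF trace_setting_axioms], rule trace_sequence_axioms.intro)
      (rule comp A3 assms(13) | assumption)+
  show ?thesis
  proof (intro conjI allI impI)
    show "Mosco_conv \<mu> (\<lambda>n. trace_form m \<mu> E (En (enat n)) l) (trace_form m \<mu> E (En \<infinity>) l)" if "l > 0" for l
      using that by (rule trace_Mosco)
    fix l :: "nat \<Rightarrow> real" assume "(\<forall>j. l j > 0) \<and> decseq l \<and> l \<longlonglongrightarrow> 0"
    then show "\<exists>n :: nat \<Rightarrow> nat. filterlim n at_top sequentially \<and>
          Mosco_conv \<mu> (\<lambda>j. trace_form m \<mu> E (En (enat (n j))) (l j)) (trace_form0 m \<mu> E (En \<infinity>))"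
      using trace_Mosco_vanishing_shift[of l] by metis
  qed
qed

end
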